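(* Let $P$ be a surface with very ample anticanonical bundle, $f(X,Y)$ its toric potential in the quantum torus, and $p=1-f$ its quantum mirror curve. Define the quantum A-period $$a(z,q)=\mathrm{Const}_{X,Y}(\log p(X,Y))=-\sum_{n>0}\frac1n\,\mathrm{Const}_{X,Y}(f^n)$$ and the series $$\underline a(z,q)=\mathrm{Const}_X\left(\log\frac{\Psi(qX)}{\Psi(X)}\right)=\mathrm{Const}_X(\log Y(X)),$$ where $\Psi$ is the wavefunction, $p\cdot\Psi=0$, and $Y(X)=\Psi(qX)/\Psi(X)$ is the corresponding solution of $p(X,Y(X))=0$ in $1+X\mathbb C[X]+\big(\mathbb C[q^{\pm\frac12}][[X]][X^{-1}][[\mathrm{NE}(P)]]\big)_{>0}$. Then $$a(z,q)=\underline a(z,q)$$ in $\mathbb C[q^{\pm\frac12}][[\mathrm{NE}(P)]]$.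
   Context: **Surface and gradings.** $P$ is a smooth projective surface with very ample anticanonical bundle (i.e. $\mathbb P^1\times\mathbb P^1$ or a blow-up of $\mathbb P^2$ in $0\le k\le 6$ points), $E$ a smooth anticanonical divisor, $\mathrm{NE}(P)$ the monoid of effective curve classes with monomials $z^\beta$, graded by $\deg z^\beta=\beta\cdot E$. For $R=\mathbb C[q^{\pm\frac12}]$ or $R=\mathbb C[q^{\pm\frac12}][[X]][X^{-1}]$, $(R[[\mathrm{NE}(P)]])_{>0}$ is the part of degree at least one. **Toric potential.** Fix a $\mathbb Q$-Gorenstein degeneration of $P$ to a Gorenstein toric Fano surface with fan $\Sigma'$ (equal to $P$ if $P$ is toric). Let $\Delta^\star$ be the reflexive polygon spanned by the primitive ray generators of $\Sigma'$, and $\Sigma$ the fan whose ray generators are all boundary lattice points $m_1,\dots,m_{r+2}$ of $\Delta^\star$, cyclically numbered, $m_k=(a_k,b_k)$. $P_\Sigma$ is a smooth toric surface with toric divisors $D_k$; classes in $H_2(P_\Sigma,\mathbb Z)$ are regarded as classes on $P$ via the degeneration. Conventions: $m_{r+1}=(1,0)$, $m_{r+2}=(0,1)$, and $\Delta^\star$ has no integral point with second coordinate $>1$. Put $\beta_{r+1}=\beta_{r+2}=0$ and for $k\le r$ let $\beta_k$ be given by $D_k\cdot\beta_k=1$, $D_{r+1}\cdot\beta_k=-a_k$, $D_{r+2}\cdot\beta_k=-b_k$, $D_i\cdot\beta_k=0$ otherwise. If $m_k$ lies on an edge of $\Delta^\star$, let $\mu_k,\nu_k\ge 0$ be its lattice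 distances from the two end vertices of this edge (in the direction of decreasing, respectively increasing, index). For $m_k$ in the interior of an edge let $\tilde\beta_k$ be given by $D_k\cdot\tilde\beta_k=-2$, $D_{k\pm1}\cdot\tilde\beta_k=1$, $D_i\cdot\tilde\beta_k=0$ otherwise (indices mod $r+2$). For $0<i_1<\dots<i_l\le\mu_k$, $0<j_1<\dots<j_l\le\nu_k$ put $$\beta_{k,(i),(j)}=\beta_k+\sum_{p=1}^l\sum_{s=0}^{i_p-1}\tilde\beta_{k-s}+\sum_{p=1}^l\sum_{s=1}^{j_p-1}\tilde\beta_{k+s}.$$ The potential is $f=\sum_{k=1}^{r+2}c_k\,\hat z^{m_k}$ with $c_k=\sum_{l=0}^{\min(\mu_k,\nu_k)}\sum_{(i),(j)}z^{\beta_{k,(i),(j)}}$. With these conventions $f=X+Y+{}$(terms whose $z$-degree is at least one). **Quantum torus.** $X,Y$ satisfy $YX=qXY$, and $\hat z^{(a,b)}=q^{ab/2}X^aY^b$. E.g. for $\mathbb P^2$: $f=X+Y+q^{1/2}zX^{-1}Y^{-1}$. $\mathrm{Const}_{X,Y}$ is the coefficient of $X^0Y^0$ after writing an element as $\sum c_{ab}X^aY^b$; $\mathrm{Const}_X$ is the coefficient of $X^0$. **Wavefunction.** Operators act by $(X\cdot\Phi)(X)=X\Phi(X)$, $(Y\cdot\Phi)(X)=\Phi(qX)$. A wavefunction satisfies $p\cdot\Psi=0$. Dividing by $\Psi(X)$, the equation $p(X,Y(X))=0$ for $Y(X)=\Psi(qX)/\Psi(X)$ means $$1=\sum_{k}c_k\,q^{a_kb_k/2}X^{a_k}\,Y^{[b_k]}(X),$$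 with $Y^{[1]}=Y(X)$, $Y^{[0]}=1$, $Y^{[-b]}=\prod_{j=1}^{b}Y(q^{-j}X)^{-1}$ for $b>0$. For $\mathbb P^2$ this is $1-X-Y(X)-\frac{q^{1/2}z}{X\,Y(q^{-1}X)}=0$. The series $\underline a$ is defined with the unique solution $Y(X)$ in the ring displayed in the claim.
   Formalization: That f = X + Y + terms of z-degree at least one is assumed rather than derived from the index conventions; it fails e.g. for the cubic surface (nine-point polygon), where no solution Y(X) exists in the stated ring. *)

theory Defs
  imports
    "HOL-Analysis.Analysis"
    "HOL-Computational_Algebra.Formal_Laurent_Series"
    "HOL-Computational_Algebra.Polynomial_FPS"
    "HOL-Library.Poly_Mapping"
    "HOL-Library.Groups_Big_Fun"
begin

section \<open>Surfaces with very ample anticanonical bundle\<close>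

text \<open>
  A surface with very ample anticanonical bundle is the product of two projective lines or the
  blow-up of the projective plane in at most six points in general position.
  The points are given by homogeneous coordinates.
\<close>

datatype surface = P1xP1 | BlP2 "(complex^3) list"

text \<open>Homogeneous forms of degree \<open>d\<close> in three variables, as functions.\<close>

definition form :: "nat \<Rightarrow> (complex^3 \<Rightarrow> complex) \<Rightarrow> bool" where
  "form d F \<longleftrightarrow> (\<exists>c. \<forall>v. F v =
     (\<Sum>i\<le>d. \<Sum>j\<le>d - i. c i j * (v $ 1) ^ i * (v $ 2) ^ j * (v $ 3) ^ (d - i - j)))"

text \<open>The form \<open>F\<close> has multiplicity at least \<open>m\<close> at the point \<open>x\<close>: no monomials of degree less
  than \<open>m\<close> occur in the Taylor expansion at \<open>x\<close>.\<close>

definition vanishes_to_order :: "nat \<Rightarrow> (complex^3 \<Rightarrow> complex) \<Rightarrow> complex^3 \<Rightarrow> bool" where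
  "vanishes_to_order m F x \<longleftrightarrow>
     (\<forall>v. \<exists>g :: complex poly. \<forall>t. F (x + t *s v) = t ^ m * poly g t)"

text \<open>No two points coincide, no three lie on a line, no six lie on a conic.\<close>

definition general_position :: "(complex^3) list \<Rightarrow> bool" where
  "general_position ps \<longleftrightarrow>
     (\<forall>i<length ps. ps ! i \<noteq> 0) \<and>
     (\<forall>i<length ps. \<forall>j<length ps. i \<noteq> j \<longrightarrow> (\<forall>t. ps ! i \<noteq> t *s (ps ! j))) \<and>
     (\<forall>I \<subseteq> {..<length ps}. card I = 3 \<longrightarrow>
        \<not> (\<exists>F. form 1 F \<and> F \<noteq> (\<lambda>_. 0) \<and> (\<forall>i\<in>I. F (ps ! i) = 0))) \<and>
     (\<forall>I \<subseteq> {..<length ps}. card I = 6 \<longrightarrow>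
        \<not> (\<exists>F. form 2 F \<and> F \<noteq> (\<lambda>_. 0) \<and> (\<forall>i\<in>I. F (ps ! i) = 0)))"

fun very_ample_anticanonical :: "surface \<Rightarrow> bool" where
  "very_ample_anticanonical P1xP1 \<longleftrightarrow> True"
| "very_ample_anticanonical (BlP2 ps) \<longleftrightarrow> length ps \<le> 6 \<and> general_position ps"

fun toric_surface :: "surface \<Rightarrow> bool" where
  "toric_surface P1xP1 \<longleftrightarrow> True"
| "toric_surface (BlP2 ps) \<longleftrightarrow> length ps \<le> 3"

text \<open>
  Curve classes. On \<^term>\<open>P1xP1\<close> the coordinates \<open>0\<close> and \<open>1\<close> are those with respect to the
  two rulings (the bidegree). On a blow-up the class \<open>d H - (\<Sum>i. a\<^sub>i E\<^sub>i)\<close> has coordinates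
  \<open>d\<close> at \<open>0\<close> and \<open>a\<^sub>i\<close> at \<open>Suc i\<close>; here \<open>H\<close> is the pullback of the line class and the \<open>E\<^sub>i\<close>
  are the exceptional curves.
\<close>

type_synonym cls = "nat \<Rightarrow>\<^sub>0 int"

fun H2 :: "surface \<Rightarrow> cls set" where
  "H2 P1xP1 = {\<beta>. Poly_Mapping.keys \<beta> \<subseteq> {0, 1}}"
| "H2 (BlP2 ps) = {\<beta>. Poly_Mapping.keys \<beta> \<subseteq> {..length ps}}"

fun inter :: "surface \<Rightarrow> cls \<Rightarrow> cls \<Rightarrow> int" where
  "inter P1xP1 \<beta> \<gamma> =
     Poly_Mapping.lookup \<beta> 0 * Poly_Mapping.lookup \<gamma> 1 +
     Poly_Mapping.lookup \<beta> 1 * Poly_Mapping.lookup \<gamma> 0"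
| "inter (BlP2 ps) \<beta> \<gamma> =
     Poly_Mapping.lookup \<beta> 0 * Poly_Mapping.lookup \<gamma> 0 -
     (\<Sum>i<length ps. Poly_Mapping.lookup \<beta> (Suc i) * Poly_Mapping.lookup \<gamma> (Suc i))"

text \<open>The class of the anticanonical divisor \<open>E\<close>.\<close>

fun anticanonical :: "surface \<Rightarrow> cls" where
  "anticanonical P1xP1 = Poly_Mapping.single 0 2 + Poly_Mapping.single 1 2"
| "anticanonical (BlP2 ps) =
     Poly_Mapping.single 0 3 + (\<Sum>i<length ps. Poly_Mapping.single (Suc i) 1)"

definition cls_deg :: "surface \<Rightarrow> cls \<Rightarrow> int" where
  "cls_deg P \<beta> = inter P \<beta> (anticanonical P)"

text \<open>
  A class is effective if the corresponding line bundle has a nonzero section. On the blow-up,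
  sections of the line bundle of \<open>d H - (\<Sum>i. a\<^sub>i E\<^sub>i)\<close> are the forms of degree \<open>d\<close> that have
  multiplicity at least \<open>a\<^sub>i\<close> at the \<open>i\<close>-th point, which is no condition if \<open>a\<^sub>i \<le> 0\<close>
  (the section then vanishes \<open>- a\<^sub>i\<close> times along \<open>E\<^sub>i\<close>). On \<^term>\<open>P1xP1\<close> they are
  the bihomogeneous forms of the given bidegree.
\<close>

fun NE :: "surface \<Rightarrow> cls set" where
  "NE P1xP1 = {\<beta> \<in> H2 P1xP1. Poly_Mapping.lookup \<beta> 0 \<ge> 0 \<and> Poly_Mapping.lookup \<beta> 1 \<ge> 0}"
| "NE (BlP2 ps) = {\<beta> \<in> H2 (BlP2 ps). Poly_Mapping.lookup \<beta> 0 \<ge> 0 \<and>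
     (\<exists>F. form (nat (Poly_Mapping.lookup \<beta> 0)) F \<and> F \<noteq> (\<lambda>_. 0) \<and>
        (\<forall>i<length ps. vanishes_to_order (nat (Poly_Mapping.lookup \<beta> (Suc i))) F (ps ! i)))}"


section \<open>Reflexive polygons and the toric surface \<open>P\<^sub>\<Sigma>\<close>\<close>

definition pt :: "int \<times> int \<Rightarrow> real \<times> real" where
  "pt u = (of_int (fst u), of_int (snd u))"

definition lattice_polytope :: "(real \<times> real) set \<Rightarrow> bool" where
  "lattice_polytope K \<longleftrightarrow> (\<exists>V. finite V \<and> K = convex hull (pt ` V))"

definition polar_dual :: "(real \<times> real) set \<Rightarrow> (real \<times> real) set" where
  "polar_dual K = {u. \<forall>x\<in>K. u \<bullet> x \<ge> -1}"

definition reflexive_polygon :: "(real \<times> real) set \<Rightarrow> bool" where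
  "reflexive_polygon K \<longleftrightarrow>
     lattice_polytope K \<and> 0 \<in> interior K \<and> lattice_polytope (polar_dual K)"

definition det2 :: "int \<times> int \<Rightarrow> int \<times> int \<Rightarrow> int" where
  "det2 u v = fst u * snd v - snd u * fst v"

text \<open>
  Cyclically ordered data with indices modulo \<open>N\<close> are \<open>N\<close>-periodic functions on the integers.
  Here \<open>m\<close> enumerates the boundary lattice points of \<open>K\<close> counterclockwise.
\<close>

definition boundary_enumeration ::
    "(real \<times> real) set \<Rightarrow> int \<Rightarrow> (int \<Rightarrow> int \<times> int) \<Rightarrow> bool" where
  "boundary_enumeration K N m \<longleftrightarrow>
     (\<forall>k. m (k + N) = m k) \<and>
     bij_betw m {1..N} {u. pt u \<in> frontier K} \<and>
     (\<forall>k. det2 (m k) (m (k + 1)) > 0 \<and>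
        closed_segment (pt (m k)) (pt (m (k + 1))) \<subseteq> frontier K \<and>
        {u. pt u \<in> closed_segment (pt (m k)) (pt (m (k + 1)))} = {m k, m (k + 1)})"

text \<open>
  The surface \<open>P\<^sub>\<Sigma>\<close> has fan with rays through all \<open>m k\<close>. A class \<open>\<beta>\<close> in its second homology
  is identified with the vector of its intersection numbers \<open>\<beta> i = D\<^sub>i \<cdot> \<beta>\<close>; the vectors that occur
  are exactly the linear relations among the ray generators.
\<close>

definition toric_H2 :: "int \<Rightarrow> (int \<Rightarrow> int \<times> int) \<Rightarrow> (int \<Rightarrow> int) set" where
  "toric_H2 N m = {\<beta>. (\<forall>i. \<beta> (i + N) = \<beta> i) \<and>
     (\<Sum>i=1..N. \<beta> i * fst (m i)) = 0 \<and> (\<Sum>i=1..N. \<beta> i * snd (m i)) = 0}"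

text \<open>\<open>ind N k i\<close> is \<open>1\<close> if the cyclic indices \<open>i\<close> and \<open>k\<close> coincide, else \<open>0\<close>.\<close>

definition ind :: "int \<Rightarrow> int \<Rightarrow> int \<Rightarrow> int" where
  "ind N k i = (if i mod N = k mod N then 1 else 0)"

text \<open>The self-intersection number of \<open>D\<^sub>k\<close> is determined by
  \<open>m\<^bsub>k-1\<^esub> + m\<^bsub>k+1\<^esub> = - (D\<^sub>k \<cdot> D\<^sub>k) m\<^sub>k\<close>.\<close>

definition toric_self_inter :: "(int \<Rightarrow> int \<times> int) \<Rightarrow> int \<Rightarrow> int" where
  "toric_self_inter m k =
     (THE s. fst (m (k - 1)) + fst (m (k + 1)) = - s * fst (m k) \<and>
             snd (m (k - 1)) + snd (m (k + 1)) = - s * snd (m k))"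

text \<open>The class of the curve \<open>D\<^sub>k\<close>.\<close>

definition toric_divisor :: "int \<Rightarrow> (int \<Rightarrow> int \<times> int) \<Rightarrow> int \<Rightarrow> int \<Rightarrow> int" where
  "toric_divisor N m k i =
     toric_self_inter m k * ind N k i + ind N (k - 1) i + ind N (k + 1) i"

text \<open>
  A degeneration of \<open>P\<close> enters only through the identification \<open>\<phi>\<close> of the curve classes of
  \<open>P\<^sub>\<Sigma>\<close> with those of \<open>P\<close>: an isomorphism of lattices compatible with the intersection forms
  and with the anticanonical classes (the class of \<open>\<Sum>k. D\<^sub>k\<close> on \<open>P\<^sub>\<Sigma>\<close>). The classes of the
  curves \<open>D\<^sub>k\<close> generate, so the third condition determines the intersection form. If \<open>P\<close> is
  toric, its fan is the one spanned by the faces of \<open>K\<close>, i.e. the cones over the edges of \<open>K\<close>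
  are smooth and all boundary lattice points are vertices.
\<close>

definition degeneration_identification ::
    "surface \<Rightarrow> (real \<times> real) set \<Rightarrow> int \<Rightarrow> (int \<Rightarrow> int \<times> int) \<Rightarrow> ((int \<Rightarrow> int) \<Rightarrow> cls) \<Rightarrow> bool" where
  "degeneration_identification P K N m \<phi> \<longleftrightarrow>
     bij_betw \<phi> (toric_H2 N m) (H2 P) \<and>
     (\<forall>\<beta>\<in>toric_H2 N m. \<forall>\<gamma>\<in>toric_H2 N m. \<phi> (\<lambda>i. \<beta> i + \<gamma> i) = \<phi> \<beta> + \<phi> \<gamma>) \<and>
     (\<forall>k. \<forall>\<beta>\<in>toric_H2 N m. inter P (\<phi> (toric_divisor N m k)) (\<phi> \<beta>) = \<beta> k) \<and>
     \<phi> (\<lambda>i. \<Sum>k=1..N. toric_divisor N m k i) = anticanonical P \<and>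
     (toric_surface P \<longrightarrow> (\<forall>k. pt (m k) extreme_point_of K))"

text \<open>
  The distances of \<open>m k\<close> from the next vertices with smaller and with larger index. For a vertex
  both are \<open>0\<close>, so that only \<open>l = 0\<close> contributes to its coefficient in the potential, as for
  either of the two edges containing it.
\<close>

definition mu :: "(real \<times> real) set \<Rightarrow> (int \<Rightarrow> int \<times> int) \<Rightarrow> int \<Rightarrow> nat" where
  "mu K m k = (LEAST s. pt (m (k - int s)) extreme_point_of K)"

definition nu :: "(real \<times> real) set \<Rightarrow> (int \<Rightarrow> int \<times> int) \<Rightarrow> int \<Rightarrow> nat" where
  "nu K m k = (LEAST s. pt (m (k + int s)) extreme_point_of K)"

text \<open>\<open>\<beta>\<^sub>k\<close>, where the indices of \<open>(1, 0)\<close> and \<open>(0, 1)\<close> are \<open>N - 1\<close> and \<open>N\<close>. For these two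
  indices the formula gives \<open>0\<close>.\<close>

definition beta :: "int \<Rightarrow> (int \<Rightarrow> int \<times> int) \<Rightarrow> int \<Rightarrow> int \<Rightarrow> int" where
  "beta N m k i = ind N k i - fst (m k) * ind N (N - 1) i - snd (m k) * ind N N i"

definition beta_tilde :: "int \<Rightarrow> int \<Rightarrow> int \<Rightarrow> int" where
  "beta_tilde N k i = - 2 * ind N k i + ind N (k - 1) i + ind N (k + 1) i"

text \<open>Increasing sequences \<open>i\<^sub>1 < \<dots> < i\<^sub>l\<close> and \<open>j\<^sub>1 < \<dots> < j\<^sub>l\<close> are represented by their sets of
  entries \<open>I\<close> and \<open>J\<close>.\<close>

definition beta_ij ::
    "int \<Rightarrow> (int \<Rightarrow> int \<times> int) \<Rightarrow> int \<Rightarrow> nat set \<Rightarrow> nat set \<Rightarrow> int \<Rightarrow> int" where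
  "beta_ij N m k I J x = beta N m k x
     + (\<Sum>i\<in>I. \<Sum>s=0..<i. beta_tilde N (k - int s) x)
     + (\<Sum>j\<in>J. \<Sum>s=1..<j. beta_tilde N (k + int s) x)"

definition index_pairs :: "nat \<Rightarrow> nat \<Rightarrow> (nat set \<times> nat set) set" where
  "index_pairs u v = {(I, J). I \<subseteq> {1..u} \<and> J \<subseteq> {1..v} \<and> card I = card J}"


section \<open>The quantum torus\<close>

text \<open>
  Laurent polynomials in \<open>q\<^sup>1\<^sup>/\<^sup>2\<close>: the exponent \<open>n\<close> stands for \<open>(q\<^sup>1\<^sup>/\<^sup>2)\<^sup>n\<close>. The type
  \<open>zpoly\<close> consists of the finite sums of monomials \<open>z\<^sup>\<beta>\<close> with such coefficients.
\<close>

type_synonym qpoly = "int \<Rightarrow>\<^sub>0 complex"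
type_synonym zpoly = "cls \<Rightarrow>\<^sub>0 qpoly"

definition qhalf :: "int \<Rightarrow> qpoly" where
  "qhalf n = Poly_Mapping.single n 1"

definition qconst :: "complex \<Rightarrow> qpoly" where
  "qconst c = Poly_Mapping.single 0 c"

text \<open>An element \<open>\<Sum>(a, b). c\<^sub>a\<^sub>b X\<^sup>a Y\<^sup>b\<close> of the quantum torus is given by its coefficients, and
  \<open>X\<^sup>a Y\<^sup>b X\<^sup>c Y\<^sup>d = q\<^sup>b\<^sup>c X\<^sup>a\<^sup>+\<^sup>c Y\<^sup>b\<^sup>+\<^sup>d\<close>.\<close>

typedef qtorus = "UNIV :: ((int \<times> int) \<Rightarrow>\<^sub>0 zpoly) set"
  morphisms coeffs Abs_qtorus ..

setup_lifting type_definition_qtorus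

definition twist :: "int \<times> int \<Rightarrow> int \<times> int \<Rightarrow> zpoly" where
  "twist u v = Poly_Mapping.single 0 (qhalf (2 * snd u * fst v))"

definition twisted_mult ::
    "((int \<times> int) \<Rightarrow>\<^sub>0 zpoly) \<Rightarrow> ((int \<times> int) \<Rightarrow>\<^sub>0 zpoly) \<Rightarrow> ((int \<times> int) \<Rightarrow>\<^sub>0 zpoly)" where
  "twisted_mult F G = (\<Sum>u\<in>Poly_Mapping.keys F. \<Sum>v\<in>Poly_Mapping.keys G.
     Poly_Mapping.single (u + v)
       (twist u v * Poly_Mapping.lookup F u * Poly_Mapping.lookup G v))"

lemma twisted_mult_add_left: "twisted_mult (F + F') G = twisted_mult F G + twisted_mult F' G"
  unfolding twisted_mult_def
  by (rule setsum_keys_plus_distrib)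
     (simp_all add: distrib_left distrib_right single_add sum.distrib)

lemma twisted_mult_add_right: "twisted_mult F (G + G') = twisted_mult F G + twisted_mult F G'"
proof -
  have "(\<Sum>v\<in>Poly_Mapping.keys (G + G'). Poly_Mapping.single (u + v)
          (twist u v * Poly_Mapping.lookup F u * Poly_Mapping.lookup (G + G') v)) =
        (\<Sum>v\<in>Poly_Mapping.keys G. Poly_Mapping.single (u + v)
          (twist u v * Poly_Mapping.lookup F u * Poly_Mapping.lookup G v)) +
        (\<Sum>v\<in>Poly_Mapping.keys G'. Poly_Mapping.single (u + v)
          (twist u v * Poly_Mapping.lookup F u * Poly_Mapping.lookup G' v))" for u
    by (rule setsum_keys_plus_distrib)
       (simp_all add: distrib_left single_add)
  then show ?thesis
    by (simp add: twisted_mult_def sum.distrib)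
qed

lemma twisted_mult_zero [simp]: "twisted_mult 0 G = 0" "twisted_mult F 0 = 0"
  by (simp_all add: twisted_mult_def)

lemma twisted_mult_single:
  "twisted_mult (Poly_Mapping.single u c) (Poly_Mapping.single v d) =
     Poly_Mapping.single (u + v) (twist u v * c * d)"
  by (simp add: twisted_mult_def)

lemma qtorus_coeffs_induct:
  fixes F :: "(int \<times> int) \<Rightarrow>\<^sub>0 zpoly"
  assumes "P 0" "\<And>u c. P (Poly_Mapping.single u c)" "\<And>F G. P F \<Longrightarrow> P G \<Longrightarrow> P (F + G)"
  shows "P F"
proof -
  have "P (\<Sum>u\<in>A. Poly_Mapping.single u (Poly_Mapping.lookup F u))" if "finite A" for A
    using that by induction (auto intro: assms)
  moreover have "(\<Sum>u\<in>Poly_Mapping.keys F. Poly_Mapping.single u (Poly_Mapping.lookup F u)) = F"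
    by (rule poly_mapping_eqI) (simp add: lookup_sum lookup_single when_def in_keys_iff)
  ultimately show ?thesis
    using finite_keys by metis
qed

lemma twist_cocycle: "twist (u + v) w * twist u v = twist u (v + w) * twist v w"
  by (simp add: twist_def qhalf_def mult_single algebra_simps)

lemma twisted_mult_assoc:
  "twisted_mult (twisted_mult F G) K = twisted_mult F (twisted_mult G K)"
proof (induction F rule: qtorus_coeffs_induct)
  case (2 u c)
  show ?case
  proof (induction G rule: qtorus_coeffs_induct)
    case (2 v d)
    show ?case
    proof (induction K rule: qtorus_coeffs_induct)
      case (2 w e)
      have "twist (u + v) w * (twist u v * c * d) * e = twist (u + v) w * twist u v * (c * d * e)"
        by (simp add: ac_simps)
      also have "\<dots> = twist u (v + w) * c * (twist v w * d * e)"
        unfolding twist_cocycle by (simp only: ac_simps)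
      finally show ?case
        unfolding twisted_mult_single add.assoc by (rule arg_cong)
    qed (simp_all add: twisted_mult_add_left twisted_mult_add_right)
  qed (simp_all add: twisted_mult_add_left twisted_mult_add_right)
qed (simp_all add: twisted_mult_add_left twisted_mult_add_right)

lemma twisted_mult_one:
  "twisted_mult (Poly_Mapping.single 0 1) G = G" "twisted_mult G (Poly_Mapping.single 0 1) = G"
proof -
  have [simp]: "twist 0 v = 1" "twist v 0 = 1" for v
    by (simp_all add: twist_def qhalf_def)
  show "twisted_mult (Poly_Mapping.single 0 1) G = G"
    by (induction G rule: qtorus_coeffs_induct)
       (simp_all add: twisted_mult_single twisted_mult_add_right del: single_one)
  show "twisted_mult G (Poly_Mapping.single 0 1) = G"
    by (induction G rule: qtorus_coeffs_induct)
       (simp_all add: twisted_mult_single twisted_mult_add_left del: single_one)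
qed

instantiation qtorus :: ring_1
begin

lift_definition zero_qtorus :: qtorus is 0 .
lift_definition one_qtorus :: qtorus is "Poly_Mapping.single 0 1" .
lift_definition plus_qtorus :: "qtorus \<Rightarrow> qtorus \<Rightarrow> qtorus" is "(+)" .
lift_definition minus_qtorus :: "qtorus \<Rightarrow> qtorus \<Rightarrow> qtorus" is "(-)" .
lift_definition uminus_qtorus :: "qtorus \<Rightarrow> qtorus" is uminus .
lift_definition times_qtorus :: "qtorus \<Rightarrow> qtorus \<Rightarrow> qtorus" is twisted_mult .

instance
proof
  fix a b c :: qtorus
  note rep = zero_qtorus.rep_eq one_qtorus.rep_eq plus_qtorus.rep_eq minus_qtorus.rep_eq
    uminus_qtorus.rep_eq times_qtorus.rep_eq
  show "a * b * c = a * (b * c)"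
    by (simp only: rep twisted_mult_assoc flip: coeffs_inject)
  show "1 * a = a" and "a * 1 = a"
    by (simp_all only: rep twisted_mult_one flip: coeffs_inject)
  show "a + b + c = a + (b + c)" and "a + b = b + a" and "0 + a = a"
    and "- a + a = 0" and "a - b = a + - b"
    by (simp_all add: rep ac_simps flip: coeffs_inject)
  show "(a + b) * c = a * c + b * c" and "a * (b + c) = a * b + a * c"
    by (simp_all only: rep twisted_mult_add_left twisted_mult_add_right flip: coeffs_inject)
  show "(0::qtorus) \<noteq> 1"
    by (simp add: rep flip: coeffs_inject)
qed

end

text \<open>The element \<open>c X\<^sup>a Y\<^sup>b\<close> for \<open>u = (a, b)\<close>.\<close>

definition qmonom :: "int \<times> int \<Rightarrow> zpoly \<Rightarrow> qtorus" where
  "qmonom u c = Abs_qtorus (Poly_Mapping.single u c)"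

lemma coeffs_qmonom [simp]: "coeffs (qmonom u c) = Poly_Mapping.single u c"
  by (simp add: qmonom_def Abs_qtorus_inverse)

lemma qmonom_mult: "qmonom u c * qmonom v d = qmonom (u + v) (twist u v * c * d)"
  by (simp add: times_qtorus.rep_eq twisted_mult_single flip: coeffs_inject)

lemma one_qtorus_eq: "1 = qmonom (0, 0) 1"
  by (simp add: one_qtorus.rep_eq flip: coeffs_inject zero_prod_def)

definition qX :: qtorus where "qX = qmonom (1, 0) 1"
definition qY :: qtorus where "qY = qmonom (0, 1) 1"

lemma qY_qX: "qY * qX = qmonom (0, 0) (Poly_Mapping.single 0 (qhalf 2)) * (qX * qY)"
  by (simp add: qX_def qY_def qmonom_mult twist_def qhalf_def)

lemma qmonom_eq: "qmonom (int a, int b) 1 = qX ^ a * qY ^ b"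
proof -
  have X: "qX ^ a = qmonom (int a, 0) 1"
    by (induction a) (simp_all add: one_qtorus_eq qX_def qmonom_mult twist_def qhalf_def)
  have Y: "qY ^ b = qmonom (0, int b) 1"
    by (induction b) (simp_all add: one_qtorus_eq qY_def qmonom_mult twist_def qhalf_def)
  show ?thesis
    by (simp add: X Y qmonom_mult twist_def qhalf_def)
qed

definition zhat :: "int \<times> int \<Rightarrow> zpoly \<Rightarrow> qtorus" where
  "zhat u c = qmonom u (Poly_Mapping.single 0 (qhalf (fst u * snd u)) * c)"

text \<open>The coefficient \<open>c\<^sub>k\<close> and the toric potential \<open>f = (\<Sum>k. c\<^sub>k zhat\<^bsup>m\<^sub>k\<^esup>)\<close>.\<close>

definition potential_coeff ::
    "(real \<times> real) set \<Rightarrow> int \<Rightarrow> (int \<Rightarrow> int \<times> int) \<Rightarrow> ((int \<Rightarrow> int) \<Rightarrow> cls) \<Rightarrow> int \<Rightarrow> zpoly" where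
  "potential_coeff K N m \<phi> k =
     (\<Sum>(I, J)\<in>index_pairs (mu K m k) (nu K m k). Poly_Mapping.single (\<phi> (beta_ij N m k I J)) 1)"

definition toric_potential ::
    "(real \<times> real) set \<Rightarrow> int \<Rightarrow> (int \<Rightarrow> int \<times> int) \<Rightarrow> ((int \<Rightarrow> int) \<Rightarrow> cls) \<Rightarrow> qtorus" where
  "toric_potential K N m \<phi> = (\<Sum>k=1..N. zhat (m k) (potential_coeff K N m \<phi> k))"

text \<open>\<open>f = X + Y +\<close> terms whose \<open>z\<close>-degree is at least one.\<close>

definition leading_terms_XY :: "surface \<Rightarrow> qtorus \<Rightarrow> bool" where
  "leading_terms_XY P f \<longleftrightarrow>
     (\<forall>u \<beta>. Poly_Mapping.lookup (Poly_Mapping.lookup (coeffs (f - qX - qY)) u) \<beta> \<noteq> 0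
        \<longrightarrow> cls_deg P \<beta> \<ge> 1)"

definition Const_XY :: "qtorus \<Rightarrow> zpoly" where
  "Const_XY F = Poly_Mapping.lookup (coeffs F) (0, 0)"


section \<open>Formal power series on the monoid of effective classes\<close>

text \<open>
  Series \<open>\<Sum>\<beta>. F\<^sub>\<beta> z\<^sup>\<beta>\<close> are functions on classes. The ring \<open>R[[M]]\<close> consists of those supported
  on \<open>M\<close>. For the monoids of effective classes considered here, every class is a sum
  of two effective ones in finitely many ways only, so the sum in the product is finite
  (\<^const>\<open>Sum_any\<close> adds up the nonzero terms).
\<close>

definition power_series :: "cls set \<Rightarrow> (cls \<Rightarrow> 'r::zero) set" where
  "power_series M = {F. \<forall>\<beta>. F \<beta> \<noteq> 0 \<longrightarrow> \<beta> \<in> M}"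

definition positive_part :: "surface \<Rightarrow> (cls \<Rightarrow> 'r::zero) set" where
  "positive_part P = {F \<in> power_series (NE P). \<forall>\<beta>. F \<beta> \<noteq> 0 \<longrightarrow> cls_deg P \<beta> \<ge> 1}"

definition ser_const :: "'r \<Rightarrow> cls \<Rightarrow> 'r::zero" where
  "ser_const c \<beta> = (if \<beta> = 0 then c else 0)"

definition ser_mult :: "(cls \<Rightarrow> 'r) \<Rightarrow> (cls \<Rightarrow> 'r) \<Rightarrow> cls \<Rightarrow> 'r::comm_ring_1" where
  "ser_mult F G \<delta> = Sum_any (\<lambda>\<beta>. F \<beta> * G (\<delta> - \<beta>))"

definition ser_power :: "(cls \<Rightarrow> 'r) \<Rightarrow> nat \<Rightarrow> cls \<Rightarrow> 'r::comm_ring_1" where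
  "ser_power F n = (ser_mult F ^^ n) (ser_const 1)"

definition ser_prod_list :: "(cls \<Rightarrow> 'r) list \<Rightarrow> cls \<Rightarrow> 'r::comm_ring_1" where
  "ser_prod_list Fs = foldr ser_mult Fs (ser_const 1)"

definition ser_inverse :: "cls set \<Rightarrow> (cls \<Rightarrow> 'r) \<Rightarrow> cls \<Rightarrow> 'r::comm_ring_1" where
  "ser_inverse M F = (THE G. G \<in> power_series M \<and> ser_mult F G = ser_const 1)"

text \<open>The elements of \<open>R[[X]][X\<^sup>-\<^sup>1]\<close> are the Laurent series of type \<open>qpoly fls\<close>.\<close>

type_synonym xseries = "cls \<Rightarrow> qpoly fls"

text \<open>The logarithm \<open>\<Sum>n>0. (-1)\<^sup>n\<^sup>+\<^sup>1/n (F - 1)\<^sup>n\<close>, convergent in the sense that the coefficient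
  of each \<open>z\<^sup>\<beta> X\<^sup>i\<close> is a finite sum.\<close>

definition ser_log :: "xseries \<Rightarrow> xseries" where
  "ser_log F \<beta> = Abs_fls (\<lambda>i. Sum_any (\<lambda>n::nat. if n = 0 then 0 else
     qconst ((- 1) ^ (n + 1) / of_nat n) *
     fls_nth (ser_power (\<lambda>\<gamma>. F \<gamma> - ser_const 1 \<gamma>) n \<beta>) i))"

definition Const_X :: "xseries \<Rightarrow> cls \<Rightarrow> qpoly" where
  "Const_X F \<beta> = fls_nth (F \<beta>) 0"

text \<open>The substitution of \<open>q\<^sup>j X\<close> for \<open>X\<close>.\<close>

definition fls_dilate :: "int \<Rightarrow> qpoly fls \<Rightarrow> qpoly fls" where
  "fls_dilate j f = Abs_fls (\<lambda>i. qhalf (2 * j * i) * fls_nth f i)"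

lemma fls_nth_dilate [simp]: "fls_nth (fls_dilate j f) i = qhalf (2 * j * i) * fls_nth f i"
  unfolding fls_dilate_def
  by (rule nth_Abs_fls_lower_bound[of "fls_subdegree f"]) simp

definition dilate :: "int \<Rightarrow> xseries \<Rightarrow> xseries" where
  "dilate j F \<beta> = fls_dilate j (F \<beta>)"

text \<open>
  If \<open>Y(X) = \<Psi>(qX)/\<Psi>(X)\<close>, then \<open>Y\<^sup>b\<close> acts on \<open>\<Psi>\<close> as multiplication by
  \<open>\<Psi>(q\<^sup>bX)/\<Psi>(X)\<close>, the product of all \<open>Y(q\<^sup>jX)\<close> with \<open>0 \<le> j < b\<close> or, for negative \<open>b\<close>, of all
  \<open>Y(q\<^sup>-\<^sup>jX)\<^sup>-\<^sup>1\<close> with \<open>1 \<le> j \<le> -b\<close>.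
\<close>

definition Y_bracket :: "cls set \<Rightarrow> xseries \<Rightarrow> int \<Rightarrow> xseries" where
  "Y_bracket M Y b =
     (if b \<ge> 0 then ser_prod_list (map (\<lambda>j. dilate (int j) Y) [0..<nat b])
      else ser_prod_list (map (\<lambda>j. ser_inverse M (dilate (- int j) Y)) [1..<nat (- b) + 1]))"

text \<open>For \<open>p = \<Sum>(a, b). p\<^sub>a\<^sub>b X\<^sup>a Y\<^sup>b\<close> this is \<open>p(X, Y(X)) = (p \<cdot> \<Psi>)(X)/\<Psi>(X)\<close>.\<close>

definition eval_curve :: "cls set \<Rightarrow> qtorus \<Rightarrow> xseries \<Rightarrow> xseries" where
  "eval_curve M p Y \<delta> =
     (\<Sum>u\<in>Poly_Mapping.keys (coeffs p).
        \<Sum>\<beta>\<in>Poly_Mapping.keys (Poly_Mapping.lookup (coeffs p) u).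
          fls_const (Poly_Mapping.lookup (Poly_Mapping.lookup (coeffs p) u) \<beta>) *
          fls_X_intpow (fst u) * Y_bracket M Y (snd u) (\<delta> - \<beta>))"

text \<open>The solutions \<open>Y(X)\<close> of \<open>p(X, Y(X)) = 0\<close> whose degree zero part is in \<open>1 + X \<complex>[X]\<close>.\<close>

definition wavefunction_ratio :: "surface \<Rightarrow> qtorus \<Rightarrow> xseries \<Rightarrow> bool" where
  "wavefunction_ratio P p Y \<longleftrightarrow>
     (\<exists>(g :: complex poly) U. U \<in> positive_part P \<and>
        Y = (\<lambda>\<beta>. ser_const (1 + fls_X * fps_to_fls (fps_of_poly (map_poly qconst g))) \<beta> + U \<beta>)) \<and>
     eval_curve (NE P) p Y = (\<lambda>_. 0)"


section \<open>The two periods\<close>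

text \<open>\<open>Const\<^sub>X\<^sub>,\<^sub>Y (log p) = - (\<Sum>n>0. Const\<^sub>X\<^sub>,\<^sub>Y (f\<^sup>n) / n)\<close> for \<open>p = 1 - f\<close>; only finitely
  many \<open>n\<close> contribute to the coefficient of each \<open>z\<^sup>\<beta>\<close>.\<close>

definition quantum_A_period :: "qtorus \<Rightarrow> cls \<Rightarrow> qpoly" where
  "quantum_A_period p \<beta> = - Sum_any (\<lambda>n::nat. if n = 0 then 0 else
     qconst (1 / of_nat n) * Poly_Mapping.lookup (Const_XY ((1 - p) ^ n)) \<beta>)"

definition wavefunction_A_period :: "surface \<Rightarrow> qtorus \<Rightarrow> cls \<Rightarrow> qpoly" where
  "wavefunction_A_period P p = Const_X (ser_log (THE Y. wavefunction_ratio P p Y))"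

end

theory Submission
  imports Defs
begin

text \<open>
  The operator \<open>Y - Y(X)\<close> annihilates the wavefunction, so the curve is
  divisible by it from the right, \<open>p = Q (Y(X) - Y)\<close>. As no exponent of \<open>Y\<close> exceeds \<open>1\<close>, the
  quotient contains only nonpositive powers of \<open>Y\<close>. Splitting off its part \<open>1 - T\<close> of degree zero in
  \<open>Y\<close> gives \<open>p = (1 - T) (1 - R) (1 - S) Y(X)\<close>, where \<open>T\<close> contains only negative powers of \<open>X\<close>,
  \<open>R\<close> only negative and \<open>S\<close> only positive powers of \<open>Y\<close> (\<open>curve_factorization\<close>). The constant term
  is a trace on the quantum torus, and under a trace the logarithm of a product is the sum of
  the logarithms even if the factors do not commute (\<open>tr_log_mult\<close>). The logarithms of the
  first three factors have no constant term, so that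
  \<open>Const\<^sub>X\<^sub>,\<^sub>Y (log p) = Const\<^sub>X (log Y(X))\<close>.

  To make sense of the infinite series, a monomial \<open>z\<^sup>\<beta> X\<^sup>a Y\<^sup>b\<close> is marked with the power of a
  variable \<open>t\<close> given by a weight \<open>c deg \<beta> + a + b\<close>, with \<open>c\<close> so large that all monomials of the
  potential have positive weight. The computation then takes place in the ring of power series in
  \<open>t\<close> over the quantum torus, where each coefficient is a finite sum and logarithms and inverses
  exist; there \<open>Y(X)\<close> is the fixed point of a contraction (\<open>wave_fixed_point\<close>). The series in \<open>X\<close>
  alone are carried over to Laurent series by a ring homomorphism (\<open>Laurent_mult\<close>). Uniqueness among all
  admissible series follows by induction on the degree (\<open>solution_unique\<close>).

  What remains is geometry: all classes \<open>\<beta>\<close> that occur in the potential besides those of \<open>X\<close> and \<open>Y\<close>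
  are effective. For the monomial \<open>X\<^sup>a Y\<^sup>b\<close> one finds \<open>\<beta>\<^sup>2 = a b\<close> and \<open>deg \<beta> = 1 - a - b\<close>: adding
  chains of curves with self-intersection \<open>-2\<close> reflects the class and changes neither number
  (\<open>beta_ij_H_square\<close>). Hence
  \<open>\<beta>\<^sup>2 + deg \<beta> = (1 - a) (1 - b)\<close>, which is not negative by the shape of the polygon, and a
  count of the conditions imposed on plane curves gives a curve in the class
  (\<open>effective_by_dimension\<close>).
\<close>

section \<open>Power series over a noncommutative ring\<close>

definition unit_inv :: "'a::ring_1 fps \<Rightarrow> 'a fps" where
  "unit_inv u = fps_left_inverse u 1"

lemma unit_inv:
  fixes u :: "'a::ring_1 fps"
  assumes "fps_nth u 0 = 1"
  shows unit_inv_left: "unit_inv u * u = 1"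
    and unit_inv_right: "u * unit_inv u = 1"
  using assms fps_left_inverse[of 1 u] fps_right_inverse'[of 1 u 1] by (simp_all add: unit_inv_def)

lemma unit_inv_0 [simp]: "fps_nth (unit_inv u) 0 = (1::'a::ring_1)"
  by (simp add: unit_inv_def)

lemma right_inverse_unique:
  fixes u :: "'a::ring_1 fps"
  assumes "fps_nth u 0 = 1" "u * v = 1"
  shows "v = unit_inv u"
  by (metis assms mult.assoc mult.left_neutral mult.right_neutral unit_inv_left)

definition agree :: "nat \<Rightarrow> 'a fps \<Rightarrow> 'a fps \<Rightarrow> bool" where
  "agree n F G \<longleftrightarrow> (\<forall>k<n. fps_nth F k = fps_nth G k)"

lemma agree_refl [simp]: "agree n F F"
  and agree_sym: "agree n F G \<Longrightarrow> agree n G F"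
  and agree_trans: "agree n F G \<Longrightarrow> agree n G H \<Longrightarrow> agree n F H"
  by (auto simp: agree_def)

lemma agree_diff: "agree n F G \<Longrightarrow> agree n F' G' \<Longrightarrow> agree n (F - F') (G - G')"
  for F G F' G' :: "'a::ring_1 fps"
  by (auto simp: agree_def)

lemma agree_sum:
  fixes F G :: "'i \<Rightarrow> 'a::ring_1 fps"
  shows "(\<And>s. s \<in> S \<Longrightarrow> agree n (F s) (G s)) \<Longrightarrow> agree n (\<Sum>s\<in>S. F s) (\<Sum>s\<in>S. G s)"
  by (auto simp: agree_def fps_sum_nth intro!: sum.cong)

lemma agree_mult:
  "agree n F G \<Longrightarrow> agree n F' G' \<Longrightarrow> agree n (F * F') (G * G')" for F G :: "'a::ring_1 fps"
  by (auto simp: agree_def fps_mult_nth intro!: sum.cong)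

lemma agree_shift:
  fixes F G :: "'a::ring_1 fps"
  assumes "agree n F G" "fps_nth H 0 = 0"
  shows "agree (Suc n) (H * F) (H * G)"
proof -
  have "fps_nth H i * fps_nth F (k - i) = fps_nth H i * fps_nth G (k - i)"
    if "k < Suc n" "i \<le> k" for k i
    using that assms by (cases "i = 0") (auto simp: agree_def)
  then show ?thesis
    by (auto simp: agree_def fps_mult_nth intro!: sum.cong)
qed

lemma agree_unit_inv:
  fixes F G :: "'a::ring_1 fps"
  assumes "agree n F G" "fps_nth F 0 = 1" "fps_nth G 0 = 1"
  shows "agree n (unit_inv F) (unit_inv G)"
proof -
  have "agree n (unit_inv F * G * unit_inv G) (unit_inv F * F * unit_inv G)"
    using assms(1) by (intro agree_mult agree_refl) (rule agree_sym)
  then show ?thesis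
    using assms(2,3) by (simp add: unit_inv mult.assoc)
qed

lemma fps_power_nth_eq_0:
  fixes h :: "'a::ring_1 fps"
  assumes "fps_nth h 0 = 0" "k < n"
  shows "fps_nth (h ^ n) k = 0"
  using assms(2)
proof (induction n arbitrary: k)
  case (Suc n)
  have "fps_nth h i * fps_nth (h ^ n) (k - i) = 0" if "i \<le> k" for i
    using that Suc assms(1) by (cases "i = 0") auto
  then show ?case by (simp add: fps_mult_nth)
qed simp

text \<open>Convergence in the \<open>t\<close>-adic topology: coefficient number \<open>n\<close> of the iterates is
  constant from the iterate \<open>n + 1\<close> on. The hypothesis is only required on a set given by
  conditions \<open>C n\<close> on the separate coefficients, and the fixed point lies in this set.\<close>

lemma contraction_fixed_point:
  fixes \<Phi> :: "'a::ring_1 fps \<Rightarrow> 'a fps" and C :: "nat \<Rightarrow> 'a set"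
  defines "S \<equiv> {F. \<forall>n. fps_nth F n \<in> C n}"
  assumes start: "F0 \<in> S" and closed: "\<And>F. F \<in> S \<Longrightarrow> \<Phi> F \<in> S"
    and contr: "\<And>n F G. F \<in> S \<Longrightarrow> G \<in> S \<Longrightarrow> agree n F G \<Longrightarrow> agree (Suc n) (\<Phi> F) (\<Phi> G)"
  obtains F where "F \<in> S" "\<Phi> F = F"
proof -
  define A where "A k = (\<Phi> ^^ k) F0" for k
  have A: "A k \<in> S" for k
    by (induction k) (auto simp: A_def start closed)
  have step: "agree k (A k) (A (Suc k))" for k
  proof (induction k)
    case 0
    show ?case by (simp add: agree_def)
  next
    case (Suc k)
    have "A (Suc k) = \<Phi> (A k)" for k
      by (simp add: A_def)
    with contr[OF A A Suc] show ?case by simp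
  qed
  have later: "agree k (A k) (A (k + l))" for k l
  proof (induction l)
    case (Suc l)
    have "agree k (A (k + l)) (A (Suc (k + l)))"
      using step[of "k + l"] by (auto simp: agree_def)
    with Suc show ?case by (auto intro: agree_trans)
  qed simp
  define F where "F = Abs_fps (\<lambda>n. fps_nth (A (Suc n)) n)"
  have F: "agree k (A k) F" for k
    unfolding agree_def F_def fps_nth_Abs_fps
  proof (intro allI impI)
    fix n assume "n < k"
    then have "agree (Suc n) (A (Suc n)) (A k)"
      using later[of "Suc n" "k - Suc n"] by simp
    then show "fps_nth (A k) n = fps_nth (A (Suc n)) n"
      by (simp add: agree_def)
  qed
  have FS: "F \<in> S"
    using A by (auto simp: S_def F_def)
  have "agree (Suc k) (A (Suc k)) (\<Phi> F)" for k
    using contr[OF A FS F] by (simp add: A_def)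
  then have "agree (Suc k) F (\<Phi> F)" for k
    using F agree_sym agree_trans by blast
  then have "\<Phi> F = F"
    by (metis agree_def fps_ext lessI)
  with FS that show thesis by blast
qed

lemma graded_mult:
  fixes F G :: "'a::ring_1 fps" and A B C :: "nat \<Rightarrow> 'a set"
  assumes F: "\<And>n. fps_nth F n \<in> A n" and G: "\<And>n. fps_nth G n \<in> B n"
    and mult: "\<And>i j x y. x \<in> A i \<Longrightarrow> y \<in> B j \<Longrightarrow> x * y \<in> C (i + j)"
    and zero: "\<And>n. 0 \<in> C n" and add: "\<And>n x y. x \<in> C n \<Longrightarrow> y \<in> C n \<Longrightarrow> x + y \<in> C n"
  shows "fps_nth (F * G) n \<in> C n"
proof -
  have sum: "sum f I \<in> C n" if "finite I" "\<And>i. i \<in> I \<Longrightarrow> f i \<in> C n" for f and I :: "nat set"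
    using that by (induction I) (auto intro: zero add)
  have "fps_nth F i * fps_nth G (n - i) \<in> C n" if "i \<in> {0..n}" for i
    using mult[OF F[of i] G[of "n - i"]] that by simp
  then have "(\<Sum>i=0..n. fps_nth F i * fps_nth G (n - i)) \<in> C n"
    by (intro sum) simp_all
  then show ?thesis
    by (simp add: fps_mult_nth)
qed

text \<open>The recursion for the coefficients of the inverse stays inside a graded subring.\<close>

lemma graded_unit_inv:
  fixes F :: "'a::ring_1 fps" and C :: "nat \<Rightarrow> 'a set"
  assumes F: "\<And>n. fps_nth F n \<in> C n" and F0: "fps_nth F 0 = 1"
    and one: "1 \<in> C 0"
    and mult: "\<And>i j x y. x \<in> C i \<Longrightarrow> y \<in> C j \<Longrightarrow> x * y \<in> C (i + j)"
    and zero: "\<And>n. 0 \<in> C n"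
    and add: "\<And>n x y. x \<in> C n \<Longrightarrow> y \<in> C n \<Longrightarrow> x + y \<in> C n"
    and minus: "\<And>n x. x \<in> C n \<Longrightarrow> - x \<in> C n"
  shows "fps_nth (unit_inv F) n \<in> C n"
proof (induction n rule: less_induct)
  case (less n)
  show ?case
  proof (cases "n = 0")
    case True
    then show ?thesis by (simp add: one)
  next
    case False
    have sum: "sum f I \<in> C n" if "finite I" "\<And>i. i \<in> I \<Longrightarrow> f i \<in> C n" for f and I :: "nat set"
      using that by (induction I) (auto intro: zero add)
    have "(\<Sum>i=0..n. fps_nth F i * fps_nth (unit_inv F) (n - i)) = 0"
      using False unit_inv_right[OF F0] by (simp flip: fps_mult_nth)
    then have "fps_nth (unit_inv F) n = - (\<Sum>i\<in>{0<..n}. fps_nth F i * fps_nth (unit_inv F) (n - i))"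
      by (simp add: F0 sum.head eq_neg_iff_add_eq_0)
    moreover have "fps_nth F i * fps_nth (unit_inv F) (n - i) \<in> C n" if "i \<in> {0<..n}" for i
      using mult[OF F[of i] less[of "n - i"]] that by simp
    then have "(\<Sum>i\<in>{0<..n}. fps_nth F i * fps_nth (unit_inv F) (n - i)) \<in> C n"
      by (intro sum) simp_all
    ultimately show ?thesis
      by (simp only: minus)
  qed
qed

lemma geometric_sum_right: "(\<Sum>i<n. h ^ i) * (1 - h) = 1 - h ^ n" for h :: "'a::ring_1"
proof (induction n)
  case (Suc n)
  have "(\<Sum>i<Suc n. h ^ i) * (1 - h) = (\<Sum>i<n. h ^ i) * (1 - h) + h ^ n * (1 - h)"
    by (simp only: sum.lessThan_Suc distrib_right)
  also have "\<dots> = 1 - h ^ Suc n"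
    unfolding Suc by (simp add: right_diff_distrib power_commutes)
  finally show ?case .
qed simp

section \<open>The logarithm under a trace\<close>

locale trace_functional =
  fixes tr :: "'a::ring_1 \<Rightarrow> 'k::field_char_0"
  assumes tr_add: "tr (x + y) = tr x + tr y"
    and tr_commute: "tr (x * y) = tr (y * x)"
begin

lemma tr_0 [simp]: "tr 0 = 0"
  using tr_add[of 0 0] by simp

lemma tr_uminus: "tr (- x) = - tr x"
  using tr_add[of x "- x"] by (simp add: eq_neg_iff_add_eq_0 add.commute)

lemma tr_sum: "tr (sum f I) = (\<Sum>i\<in>I. tr (f i))"
  by (induction I rule: infinite_finite_induct) (simp_all add: tr_add)

lemma tr_of_nat: "tr (of_nat n * x) = of_nat n * tr x"
  by (induction n) (simp_all add: tr_add algebra_simps)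

lemma tr_commute_fps: "tr (fps_nth (F * G) n) = tr (fps_nth (G * F) n)"
proof -
  have "(\<Sum>i=0..n. tr (fps_nth F i * fps_nth G (n - i))) =
        (\<Sum>i=0..n. tr (fps_nth G i * fps_nth F (n - i)))"
    by (subst sum.atLeastAtMost_rev) (auto intro!: sum.cong simp: tr_commute)
  then show ?thesis
    by (simp add: fps_mult_nth tr_sum)
qed

text \<open>The coefficients of \<open>tr (log u)\<close> for a series \<open>u\<close> with constant term \<open>1\<close>.\<close>

definition tr_log :: "'a fps \<Rightarrow> nat \<Rightarrow> 'k" where
  "tr_log u N = - (\<Sum>n=1..N. tr (fps_nth ((1 - u) ^ n) N) / of_nat n)"

text \<open>By the product rule the derivative of \<open>h\<^sup>n\<close> is the sum of the \<open>h\<^sup>i h' h\<^sup>n\<^sup>-\<^sup>i\<^sup>-\<^sup>1\<close>. Under the trace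
  \<open>h'\<close> can be moved to the end of each term. The additional factor \<open>G\<close> makes the induction work.\<close>

lemma tr_deriv_power:
  "tr (fps_nth (G * fps_deriv (h ^ n)) N) = (\<Sum>i<n. tr (fps_nth (h ^ (n - Suc i) * G * h ^ i * fps_deriv h) N))"
proof (induction n arbitrary: G)
  case (Suc n)
  have "tr (fps_nth (G * fps_deriv (h ^ Suc n)) N) =
        tr (fps_nth (G * h * fps_deriv (h ^ n)) N) + tr (fps_nth (G * fps_deriv h * h ^ n) N)"
    by (subst power_Suc) (simp only: fps_deriv_mult fps_add_nth tr_add distrib_left mult.assoc)
  also have "tr (fps_nth (G * fps_deriv h * h ^ n) N) = tr (fps_nth (h ^ n * G * fps_deriv h) N)"
    using tr_commute_fps[of "G * fps_deriv h" "h ^ n"] by (simp add: mult.assoc)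
  also have "tr (fps_nth (G * h * fps_deriv (h ^ n)) N) =
      (\<Sum>i<n. tr (fps_nth (h ^ (n - Suc i) * G * h ^ Suc i * fps_deriv h) N))"
    unfolding Suc.IH by (simp add: mult.assoc)
  finally show ?case
    by (simp only: sum.lessThan_Suc_shift) (simp add: mult.assoc add.commute)
qed simp

text \<open>In a commutative ring this is the logarithmic derivative \<open>u'/u\<close>. Without commutativity the derivative
  of \<open>h\<^sup>n\<close> for \<open>u = 1 - h\<close> still is \<open>n h\<^sup>n\<^sup>-\<^sup>1 h'\<close> under the trace, and the powers of \<open>h\<close> add up to
  the inverse of \<open>u\<close>.\<close>

lemma tr_log_deriv:
  assumes "fps_nth u 0 = 1"
  shows "of_nat (Suc N) * tr_log u (Suc N) = tr (fps_nth (unit_inv u * fps_deriv u) N)"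
proof -
  define h where "h = 1 - u"
  define S where "S = (\<Sum>n<Suc N. h ^ n)"
  have h0: "fps_nth h 0 = 0"
    using assms by (simp add: h_def)
  have "of_nat (Suc N) * tr (fps_nth (h ^ n) (Suc N)) / of_nat n =
      tr (fps_nth (h ^ (n - 1) * fps_deriv h) N)" if "n \<in> {1..Suc N}" for n
  proof -
    have "of_nat (Suc N) * tr (fps_nth (h ^ n) (Suc N)) = tr (fps_nth (1 * fps_deriv (h ^ n)) N)"
      by (simp add: tr_of_nat del: of_nat_Suc)
    also have "\<dots> = (\<Sum>i<n. tr (fps_nth (h ^ (n - 1) * fps_deriv h) N))"
      unfolding tr_deriv_power by (rule sum.cong) (simp_all flip: power_add)
    finally show ?thesis
      using that by simp
  qed
  then have "of_nat (Suc N) * tr_log u (Suc N) =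
      - (\<Sum>n=1..Suc N. tr (fps_nth (h ^ (n - 1) * fps_deriv h) N))"
    unfolding tr_log_def h_def mult_minus_right sum_distrib_left times_divide_eq_right
    by (intro arg_cong[where f = uminus] sum.cong refl)
  also have "(\<Sum>n=1..Suc N. tr (fps_nth (h ^ (n - 1) * fps_deriv h) N)) =
      (\<Sum>n<Suc N. tr (fps_nth (h ^ n * fps_deriv h) N))"
    by (rule sum.reindex_bij_witness[of _ Suc "\<lambda>n. n - 1"]) auto
  also have "\<dots> = tr (fps_nth (S * fps_deriv h) N)"
    by (simp add: S_def sum_distrib_right fps_sum_nth tr_sum del: sum.lessThan_Suc)
  finally have *: "of_nat (Suc N) * tr_log u (Suc N) = tr (fps_nth (S * fps_deriv u) N)"
    by (simp add: h_def tr_uminus del: of_nat_Suc)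
  have "S * u = 1 - h ^ Suc N"
    using geometric_sum_right[of h "Suc N"] by (simp only: S_def h_def) simp
  then have "agree (Suc N) (S * u) 1"
    using fps_power_nth_eq_0[OF h0] by (simp add: agree_def del: power_Suc)
  then have "agree (Suc N) (S * u * unit_inv u) (1 * unit_inv u)"
    by (rule agree_mult) simp
  then have "agree (Suc N) S (unit_inv u)"
    using assms by (simp add: mult.assoc unit_inv)
  then have "agree (Suc N) (S * fps_deriv u) (unit_inv u * fps_deriv u)"
    by (rule agree_mult) simp
  with * show ?thesis
    by (simp add: agree_def)
qed

text \<open>The logarithmic derivative of \<open>u v\<close> is \<open>v\<^sup>-\<^sup>1 u\<^sup>-\<^sup>1 u' v + v\<^sup>-\<^sup>1 v'\<close>, and cyclic permutation under the trace
  turns the first summand into \<open>u\<^sup>-\<^sup>1 u'\<close>. In characteristic zero a series without constant term is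
  determined by its derivative.\<close>

theorem tr_log_mult:
  assumes u: "fps_nth u 0 = 1" and v: "fps_nth v 0 = 1"
  shows "tr_log (u * v) N = tr_log u N + tr_log v N"
proof (cases N)
  case 0
  then show ?thesis by (simp add: tr_log_def)
next
  case (Suc M)
  have uv: "fps_nth (u * v) 0 = 1"
    using u v by simp
  have inv: "unit_inv (u * v) = unit_inv v * unit_inv u"
  proof (rule right_inverse_unique[OF uv, symmetric])
    have "u * v * (unit_inv v * unit_inv u) = u * (v * unit_inv v) * unit_inv u"
      by (simp only: mult.assoc)
    then show "u * v * (unit_inv v * unit_inv u) = 1"
      using u v by (simp add: unit_inv)
  qed
  have "unit_inv (u * v) * fps_deriv (u * v) =
      unit_inv v * (unit_inv u * u) * fps_deriv v + unit_inv v * (unit_inv u * fps_deriv u * v)"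
    by (simp only: inv fps_deriv_mult distrib_left mult.assoc)
  also have "\<dots> = unit_inv v * fps_deriv v + unit_inv v * (unit_inv u * fps_deriv u * v)"
    using u by (simp add: unit_inv)
  finally have "of_nat N * tr_log (u * v) N = tr (fps_nth (unit_inv v * fps_deriv v) M) +
      tr (fps_nth (unit_inv v * (unit_inv u * fps_deriv u * v)) M)"
    by (simp only: Suc tr_log_deriv[OF uv] fps_add_nth tr_add)
  also have "tr (fps_nth (unit_inv v * (unit_inv u * fps_deriv u * v)) M) =
      tr (fps_nth (unit_inv u * fps_deriv u * (v * unit_inv v)) M)"
    by (subst tr_commute_fps) (simp only: mult.assoc)
  also have "\<dots> = of_nat N * tr_log u N"
    using v by (simp add: Suc tr_log_deriv[OF u] unit_inv del: of_nat_Suc)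
  also have "tr (fps_nth (unit_inv v * fps_deriv v) M) = of_nat N * tr_log v N"
    by (simp only: Suc tr_log_deriv[OF v])
  finally have "of_nat N * tr_log (u * v) N = of_nat N * (tr_log u N + tr_log v N)"
    by (simp add: algebra_simps)
  then show ?thesis
    using Suc by (simp del: of_nat_Suc)
qed

end

section \<open>Coefficients in the quantum torus\<close>

definition qcoeff :: "qtorus \<Rightarrow> int \<times> int \<Rightarrow> cls \<Rightarrow> qpoly" where
  "qcoeff x u \<beta> = Poly_Mapping.lookup (Poly_Mapping.lookup (coeffs x) u) \<beta>"

definition qmono :: "int \<times> int \<Rightarrow> cls \<Rightarrow> qpoly \<Rightarrow> qtorus" where
  "qmono u \<beta> c = qmonom u (Poly_Mapping.single \<beta> c)"

definition qsupport :: "qtorus \<Rightarrow> ((int \<times> int) \<times> cls) set" where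
  "qsupport x = {(u, \<beta>). qcoeff x u \<beta> \<noteq> 0}"

lemma qtorus_eqI: "(\<And>u \<beta>. qcoeff x u \<beta> = qcoeff y u \<beta>) \<Longrightarrow> x = y"
  unfolding qcoeff_def by (metis coeffs_inject poly_mapping_eqI)

lemma lookup_single_0_mult: "Poly_Mapping.lookup (Poly_Mapping.single 0 a * x) k = a * Poly_Mapping.lookup x k"
  by (simp add: Poly_Mapping.map.rep_eq when_def flip: mult_map_scale_conv_mult)

lemma qcoeff_simps [simp]:
  "qcoeff 0 u \<beta> = 0" "qcoeff (x + y) u \<beta> = qcoeff x u \<beta> + qcoeff y u \<beta>"
  "qcoeff (- x) u \<beta> = - qcoeff x u \<beta>" "qcoeff (x - y) u \<beta> = qcoeff x u \<beta> - qcoeff y u \<beta>"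
  by (simp_all add: qcoeff_def zero_qtorus.rep_eq plus_qtorus.rep_eq uminus_qtorus.rep_eq
      minus_qtorus.rep_eq lookup_add lookup_minus)

lemma qcoeff_qmono: "qcoeff (qmono u \<beta> c) v \<gamma> = (if u = v \<and> \<beta> = \<gamma> then c else 0)"
  by (simp add: qcoeff_def qmono_def lookup_single when_def)

lemma qcoeff_sum: "qcoeff (sum f S) u \<beta> = (\<Sum>s\<in>S. qcoeff (f s) u \<beta>)"
  by (induction S rule: infinite_finite_induct) simp_all

lemma qmono_one: "qmono 0 0 1 = 1"
  by (simp add: qmono_def one_qtorus_eq zero_prod_def)

lemma qcoeff_one: "qcoeff 1 u \<beta> = (if u = 0 \<and> \<beta> = 0 then 1 else 0)"
  by (auto simp: qcoeff_qmono simp flip: qmono_one)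

lemma qX_eq: "qX = qmono (1, 0) 0 1" and qY_eq: "qY = qmono (0, 1) 0 1"
  by (simp_all add: qX_def qY_def qmono_def)

lemma qmono_mult:
  "qmono u \<beta> c * qmono v \<gamma> d = qmono (u + v) (\<beta> + \<gamma>) (qhalf (2 * snd u * fst v) * c * d)"
  by (simp add: qmono_def qmonom_mult twist_def mult_single)

lemma finite_qsupport: "finite (qsupport x)"
proof -
  have "qsupport x \<subseteq> (\<Union>u\<in>Poly_Mapping.keys (coeffs x).
          {u} \<times> Poly_Mapping.keys (Poly_Mapping.lookup (coeffs x) u))"
    by (auto simp: qsupport_def qcoeff_def in_keys_iff)
  then show ?thesis
    by (rule finite_subset) simp
qed

lemma qtorus_decompose:
  assumes "finite S" "qsupport x \<subseteq> S"
  shows "x = (\<Sum>(u, \<beta>)\<in>S. qmono u \<beta> (qcoeff x u \<beta>))"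
proof (rule qtorus_eqI)
  fix v \<gamma>
  have "qcoeff (\<Sum>(u, \<beta>)\<in>S. qmono u \<beta> (qcoeff x u \<beta>)) v \<gamma> =
      (\<Sum>s\<in>S. if s = (v, \<gamma>) then qcoeff x v \<gamma> else 0)"
    by (auto simp: qcoeff_sum qcoeff_qmono case_prod_beta intro!: sum.cong)
  also have "\<dots> = qcoeff x v \<gamma>"
    using assms by (auto simp: sum.delta qsupport_def)
  finally show "qcoeff x v \<gamma> = qcoeff (\<Sum>(u, \<beta>)\<in>S. qmono u \<beta> (qcoeff x u \<beta>)) v \<gamma>" ..
qed

lemma qcoeff_qmono_mult:
  "qcoeff (qmono u \<beta> c * x) v \<gamma> = qhalf (2 * snd u * fst (v - u)) * c * qcoeff x (v - u) (\<gamma> - \<beta>)"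
proof -
  define S where "S = insert (v - u, \<gamma> - \<beta>) (qsupport x)"
  have S: "finite S" "qsupport x \<subseteq> S"
    by (auto simp: S_def finite_qsupport)
  have "qcoeff (qmono u \<beta> c * x) v \<gamma> = qcoeff (qmono u \<beta> c * (\<Sum>(w, \<delta>)\<in>S. qmono w \<delta> (qcoeff x w \<delta>))) v \<gamma>"
    using qtorus_decompose[OF S] by simp
  also have "\<dots> = (\<Sum>s\<in>S. if s = (v - u, \<gamma> - \<beta>)
      then qhalf (2 * snd u * fst (v - u)) * c * qcoeff x (v - u) (\<gamma> - \<beta>) else 0)"
    by (auto simp: sum_distrib_left qcoeff_sum qmono_mult qcoeff_qmono case_prod_beta
        algebra_simps intro!: sum.cong)
  also have "\<dots> = qhalf (2 * snd u * fst (v - u)) * c * qcoeff x (v - u) (\<gamma> - \<beta>)"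
    using S(1) by (simp add: S_def)
  finally show ?thesis .
qed

lemma qcoeff_mult:
  assumes "finite S" "qsupport x \<subseteq> S"
  shows "qcoeff (x * y) v \<gamma> =
    (\<Sum>(u, \<beta>)\<in>S. qhalf (2 * snd u * fst (v - u)) * qcoeff x u \<beta> * qcoeff y (v - u) (\<gamma> - \<beta>))"
proof -
  have "x * y = (\<Sum>(u, \<beta>)\<in>S. qmono u \<beta> (qcoeff x u \<beta>)) * y"
    using qtorus_decompose[OF assms] by simp
  then show ?thesis
    by (simp add: sum_distrib_right qcoeff_sum case_prod_beta qcoeff_qmono_mult)
qed

lemma qcoeff_mult_nonzero:
  assumes "qcoeff (x * y) v \<gamma> \<noteq> 0"
  obtains u \<beta> where "qcoeff x u \<beta> \<noteq> 0" "qcoeff y (v - u) (\<gamma> - \<beta>) \<noteq> 0"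
proof -
  have "\<exists>s\<in>qsupport x. qcoeff y (v - fst s) (\<gamma> - snd s) \<noteq> 0"
  proof (rule ccontr)
    assume "\<not> ?thesis"
    then have "qcoeff (x * y) v \<gamma> = 0"
      by (auto simp: qcoeff_mult[OF finite_qsupport order_refl] intro!: sum.neutral)
    with assms show False by simp
  qed
  then show thesis
    using that by (auto simp: qsupport_def)
qed

lemma Const_XY_qcoeff: "Poly_Mapping.lookup (Const_XY x) \<beta> = qcoeff x 0 \<beta>"
  by (simp add: Const_XY_def qcoeff_def zero_prod_def)

text \<open>Two monomials contribute to the constant term of their product only if one of them is a multiple of the
  inverse of the other, and then they commute. Hence the constant term is a trace.\<close>

lemma qcoeff_0_mult_commute: "qcoeff (x * y) 0 \<gamma> = qcoeff (y * x) 0 \<gamma>"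
proof -
  define S where "S = qsupport x \<union> (\<lambda>(u, \<beta>). (- u, \<gamma> - \<beta>)) ` qsupport y"
  define S' where "S' = (\<lambda>(u, \<beta>). (- u, \<gamma> - \<beta>)) ` S"
  have S: "finite S" "qsupport x \<subseteq> S" and "finite S'"
    by (auto simp: S_def S'_def finite_qsupport)
  moreover have "qsupport y \<subseteq> S'"
    by (force simp: S_def S'_def image_iff)
  ultimately show ?thesis
    by (simp add: qcoeff_mult[OF S] qcoeff_mult[of S'])
       (auto simp: S'_def intro!: sum.reindex_bij_witness[of _ "\<lambda>(u, \<beta>). (- u, \<gamma> - \<beta>)" "\<lambda>(u, \<beta>). (- u, \<gamma> - \<beta>)"] simp: mult_ac)
qed

lemma trace_qcoeff: "trace_functional (\<lambda>x. Poly_Mapping.lookup (qcoeff x 0 \<beta>) k)"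
  by standard (simp_all add: lookup_add qcoeff_0_mult_commute)

section \<open>The ring of series supported on a monoid of curve classes\<close>

locale graded_monoid =
  fixes M :: "cls set" and deg :: "cls \<Rightarrow> int"
  assumes zero_M: "0 \<in> M" and add_M: "\<beta> \<in> M \<Longrightarrow> \<gamma> \<in> M \<Longrightarrow> \<beta> + \<gamma> \<in> M"
    and finite_split: "finite {\<beta> \<in> M. \<delta> - \<beta> \<in> M}"
    and deg_add: "deg (\<beta> + \<gamma>) = deg \<beta> + deg \<gamma>"
begin

lemma deg_0 [simp]: "deg 0 = 0"
  using deg_add[of 0 0] by simp

lemma deg_diff: "deg (\<beta> - \<gamma>) = deg \<beta> - deg \<gamma>"
  using deg_add[of "\<beta> - \<gamma>" \<gamma>] by simp

definition splits :: "cls \<Rightarrow> cls set" where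
  "splits \<delta> = {\<beta> \<in> M. \<delta> - \<beta> \<in> M}"

lemma finite_splits [simp]: "finite (splits \<delta>)"
  using finite_split by (simp add: splits_def)

lemma ser_mult_eq:
  assumes "F \<in> power_series M" "G \<in> power_series M"
  shows "ser_mult F G \<delta> = (\<Sum>\<beta>\<in>splits \<delta>. F \<beta> * G (\<delta> - \<beta>))"
proof -
  have "F \<beta> \<noteq> 0 \<and> G (\<delta> - \<beta>) \<noteq> 0" if "F \<beta> * G (\<delta> - \<beta>) \<noteq> 0" for \<beta>
    using that by auto
  then have "{\<beta>. F \<beta> * G (\<delta> - \<beta>) \<noteq> 0} \<subseteq> splits \<delta>"
    using assms unfolding power_series_def splits_def by blast
  then show ?thesis
    unfolding ser_mult_def by (rule Sum_any.expand_superset[OF finite_splits])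
qed

lemma ser_const_M [simp]: "ser_const c \<in> power_series M"
  using zero_M by (auto simp: power_series_def ser_const_def)

lemma ser_mult_M [simp]:
  assumes "F \<in> power_series M" "G \<in> power_series M"
  shows "ser_mult F G \<in> power_series M"
proof -
  have "\<delta> \<in> M" if "ser_mult F G \<delta> \<noteq> 0" for \<delta>
  proof -
    have "\<exists>\<beta>\<in>splits \<delta>. F \<beta> * G (\<delta> - \<beta>) \<noteq> 0"
      using that unfolding ser_mult_eq[OF assms] by (rule contrapos_np) simp
    then show "\<delta> \<in> M"
      using add_M by (force simp: splits_def)
  qed
  then show ?thesis
    by (simp add: power_series_def)
qed

lemma ser_mult_commute:
  assumes "F \<in> power_series M" "G \<in> power_series M"
  shows "ser_mult F G = ser_mult G F"
proof
  fix \<delta>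
  show "ser_mult F G \<delta> = ser_mult G F \<delta>"
    unfolding ser_mult_eq[OF assms] ser_mult_eq[OF assms(2,1)]
    by (rule sum.reindex_bij_witness[of _ "\<lambda>\<beta>. \<delta> - \<beta>" "\<lambda>\<beta>. \<delta> - \<beta>"])
       (auto simp: splits_def mult.commute)
qed

lemma ser_mult_assoc:
  assumes F: "F \<in> power_series M" and G: "G \<in> power_series M" and H: "H \<in> power_series M"
  shows "ser_mult (ser_mult F G) H = ser_mult F (ser_mult G H)"
proof
  fix \<delta>
  have "ser_mult (ser_mult F G) H \<delta> =
      (\<Sum>(\<gamma>, \<beta>)\<in>(SIGMA \<gamma>:splits \<delta>. splits \<gamma>). F \<beta> * G (\<gamma> - \<beta>) * H (\<delta> - \<gamma>))"
    using assms by (simp add: ser_mult_eq sum_distrib_right sum.Sigma)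
  also have "\<dots> = (\<Sum>(\<beta>, \<gamma>)\<in>(SIGMA \<beta>:splits \<delta>. splits (\<delta> - \<beta>)). F \<beta> * G \<gamma> * H (\<delta> - \<beta> - \<gamma>))"
  proof (rule sum.reindex_bij_witness[of _ "\<lambda>(\<beta>, \<gamma>). (\<beta> + \<gamma>, \<beta>)" "\<lambda>(\<gamma>, \<beta>). (\<beta>, \<gamma> - \<beta>)"];
      clarsimp simp: splits_def algebra_simps)
    fix \<gamma> \<beta> assume "\<gamma> \<in> M" "\<beta> \<in> M" "\<delta> - \<gamma> \<in> M" "\<gamma> - \<beta> \<in> M"
    then show "\<delta> - \<beta> \<in> M"
      using add_M[of "\<delta> - \<gamma>" "\<gamma> - \<beta>"] by simp
  next
    fix \<gamma> \<beta> assume "\<gamma> \<in> M" "\<beta> \<in> M"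
    then show "\<beta> + \<gamma> \<in> M"
      by (rule add_M[rotated])
  qed
  also have "\<dots> = ser_mult F (ser_mult G H) \<delta>"
    using assms by (simp add: ser_mult_eq sum_distrib_left sum.Sigma mult.assoc)
  finally show "ser_mult (ser_mult F G) H \<delta> = ser_mult F (ser_mult G H) \<delta>" .
qed

lemma ser_mult_const:
  assumes "F \<in> power_series M"
  shows "ser_mult (ser_const c) F \<delta> = c * F \<delta>"
proof -
  have "ser_mult (ser_const c) F \<delta> = (\<Sum>\<beta>\<in>splits \<delta>. if \<beta> = 0 then c * F \<delta> else 0)"
    unfolding ser_mult_eq[OF ser_const_M assms] by (rule sum.cong) (auto simp: ser_const_def)
  also have "\<dots> = (if 0 \<in> splits \<delta> then c * F \<delta> else 0)"
    by simp
  also have "\<dots> = c * F \<delta>"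
    using assms zero_M unfolding splits_def power_series_def by (auto, metis mult_zero_right)
  finally show ?thesis .
qed

lemma ser_mult_one:
  assumes "F \<in> power_series M"
  shows "ser_mult (ser_const 1) F = F" "ser_mult F (ser_const 1) = F"
  using assms by (auto simp: ser_mult_const ser_mult_commute[OF _ ser_const_M])

text \<open>Inverses in a commutative ring are unique, so the definite description in the definition of
  \<^const>\<open>ser_inverse\<close> denotes any inverse that can be exhibited.\<close>

lemma ser_inverse_eqI:
  assumes F: "F \<in> power_series M" and G: "G \<in> power_series M" and FG: "ser_mult F G = ser_const 1"
  shows "ser_inverse M F = G"
  unfolding ser_inverse_def
proof (rule the_equality)
  fix H assume H: "H \<in> power_series M \<and> ser_mult F H = ser_const 1"
  then have "H = ser_mult (ser_mult G F) H"
    unfolding ser_mult_commute[OF G F] FG using ser_mult_one by metis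
  also have "\<dots> = ser_mult G (ser_const 1)"
    using F G H ser_mult_assoc by metis
  finally show "H = G"
    using G ser_mult_one by metis
qed (use assms in simp)

subsection \<open>Series with terms of degree zero only at the class zero\<close>

text \<open>The coefficient of a product of such series at a class depends only on the coefficients of the factors
  at classes of at most the same degree. Inductions on the degree rest on this.\<close>

definition local_ser :: "(cls \<Rightarrow> 'r::comm_ring_1) \<Rightarrow> bool" where
  "local_ser F \<longleftrightarrow> (\<forall>\<beta>. F \<beta> \<noteq> 0 \<longrightarrow> \<beta> \<in> M \<and> (\<beta> = 0 \<or> deg \<beta> \<ge> 1))"

lemma local_ser_M [simp]: "local_ser F \<Longrightarrow> F \<in> power_series M"
  by (auto simp: local_ser_def power_series_def)

lemma local_ser_const [simp]: "local_ser (ser_const c)"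
  by (auto simp: local_ser_def ser_const_def zero_M)

lemma local_ser_eq_0: "local_ser F \<Longrightarrow> deg \<beta> < 0 \<Longrightarrow> F \<beta> = 0"
  by (force simp: local_ser_def)

lemma local_ser_mult [simp]:
  assumes "local_ser F" "local_ser G"
  shows "local_ser (ser_mult F G)"
  unfolding local_ser_def
proof (intro allI impI)
  fix \<delta> assume nz: "ser_mult F G \<delta> \<noteq> 0"
  then have "\<exists>\<beta>\<in>splits \<delta>. F \<beta> * G (\<delta> - \<beta>) \<noteq> 0"
    unfolding ser_mult_eq[OF assms[THEN local_ser_M]] by (rule contrapos_np) simp
  then obtain \<beta> where "F \<beta> \<noteq> 0" "G (\<delta> - \<beta>) \<noteq> 0"
    by (metis mult_zero_left mult_zero_right)
  then have "\<beta> = 0 \<or> deg \<beta> \<ge> 1" "\<delta> - \<beta> = 0 \<or> deg (\<delta> - \<beta>) \<ge> 1"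
    using assms unfolding local_ser_def by metis+
  then have "\<delta> = 0 \<or> deg \<delta> \<ge> 1"
    by (auto simp: deg_diff)
  moreover have "\<delta> \<in> M"
    using nz assms ser_mult_M local_ser_M unfolding power_series_def by blast
  ultimately show "\<delta> \<in> M \<and> (\<delta> = 0 \<or> 1 \<le> deg \<delta>)" by blast
qed

definition deg_agree :: "int \<Rightarrow> (cls \<Rightarrow> 'r) \<Rightarrow> (cls \<Rightarrow> 'r) \<Rightarrow> bool" where
  "deg_agree d F G \<longleftrightarrow> (\<forall>\<beta>. deg \<beta> < d \<longrightarrow> F \<beta> = G \<beta>)"

lemma deg_agree_mult:
  assumes "deg_agree d F F'" "deg_agree d G G'" "local_ser F" "local_ser F'" "local_ser G" "local_ser G'"
  shows "deg_agree d (ser_mult F G) (ser_mult F' G')"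
  unfolding deg_agree_def
proof (intro allI impI)
  fix \<delta> assume \<delta>: "deg \<delta> < d"
  have "F \<beta> * G (\<delta> - \<beta>) = F' \<beta> * G' (\<delta> - \<beta>)" for \<beta>
  proof -
    consider "deg \<beta> < 0" | "deg (\<delta> - \<beta>) < 0" | "deg \<beta> < d" "deg (\<delta> - \<beta>) < d"
      using \<delta> by (force simp: deg_diff)
    then show ?thesis
      by cases (use assms in \<open>simp_all add: local_ser_eq_0 deg_agree_def\<close>)
  qed
  then show "ser_mult F G \<delta> = ser_mult F' G' \<delta>"
    using assms by (simp add: ser_mult_eq)
qed

text \<open>The coefficients of the inverse of \<open>F\<close> are determined by recursion on the degree, starting with the inverse
  \<open>c\<close> of the coefficient at the class \<open>0\<close>. Only the other coefficients, called \<open>U\<close> here, enter the recursion.\<close>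

function recip :: "'r::comm_ring_1 \<Rightarrow> (cls \<Rightarrow> 'r) \<Rightarrow> cls \<Rightarrow> 'r" where
  "recip c U \<delta> = (if \<delta> = 0 then c else if \<delta> \<notin> M \<or> deg \<delta> < 1 then 0
     else - c * (\<Sum>\<beta>\<in>{\<beta> \<in> splits \<delta>. deg \<beta> \<ge> 1 \<and> deg (\<delta> - \<beta>) \<ge> 0}. U \<beta> * recip c U (\<delta> - \<beta>)))"
  by pat_completeness auto
termination
  by (relation "Wellfounded.measure (\<lambda>(c, U, \<delta>). nat (deg \<delta>))") (auto simp: deg_diff)

declare recip.simps [simp del]

lemma local_ser_recip: "local_ser (recip c U)"
  by (auto simp: local_ser_def recip.simps zero_M)

lemma ser_mult_recip:
  assumes F: "local_ser F" and c: "F 0 * c = 1"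
  shows "ser_mult F (recip c F) = ser_const 1"
proof
  fix \<delta>
  let ?G = "recip c F"
  have G: "local_ser ?G"
    by (rule local_ser_recip)
  show "ser_mult F ?G \<delta> = ser_const 1 \<delta>"
  proof (cases "\<delta> \<in> M \<and> (\<delta> = 0 \<or> deg \<delta> \<ge> 1)")
    case False
    then have "ser_mult F ?G \<delta> = 0"
      using local_ser_mult[OF F G] unfolding local_ser_def by blast
    then show ?thesis
      using False zero_M by (auto simp: ser_const_def)
  next
    case True
    let ?A = "{\<beta> \<in> splits \<delta>. deg \<beta> \<ge> 1 \<and> deg (\<delta> - \<beta>) \<ge> 0}"
    have zero: "0 \<in> splits \<delta>"
      using True zero_M by (auto simp: splits_def)
    have "ser_mult F ?G \<delta> = F 0 * ?G \<delta> + (\<Sum>\<beta>\<in>splits \<delta> - {0}. F \<beta> * ?G (\<delta> - \<beta>))"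
      using F G zero by (simp add: ser_mult_eq sum.remove)
    also have "(\<Sum>\<beta>\<in>splits \<delta> - {0}. F \<beta> * ?G (\<delta> - \<beta>)) = (\<Sum>\<beta>\<in>?A. F \<beta> * ?G (\<delta> - \<beta>))"
    proof (rule sum.mono_neutral_right)
      have "F \<beta> = 0" if "\<beta> \<noteq> 0" "\<not> deg \<beta> \<ge> 1" for \<beta>
        using F that unfolding local_ser_def by metis
      then show "\<forall>\<beta>\<in>splits \<delta> - {0} - ?A. F \<beta> * ?G (\<delta> - \<beta>) = 0"
        using local_ser_eq_0[OF G] by (force simp: not_le)
    qed auto
    also have "F 0 * ?G \<delta> + (\<Sum>\<beta>\<in>?A. F \<beta> * ?G (\<delta> - \<beta>)) = ser_const 1 \<delta>"
    proof (cases "\<delta> = 0")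
      case True
      then have "?A = {}" using deg_diff[of 0] by auto
      then have "(\<Sum>\<beta>\<in>?A. F \<beta> * ?G (\<delta> - \<beta>)) = 0"
        by (simp only: sum.empty)
      moreover have "?G \<delta> = c"
        using True by (simp add: recip.simps)
      ultimately show ?thesis
        using True c by (simp add: ser_const_def)
    next
      case False
      then have "?G \<delta> = - c * (\<Sum>\<beta>\<in>?A. F \<beta> * ?G (\<delta> - \<beta>))"
        using True by (subst recip.simps) simp
      then have "F 0 * ?G \<delta> = - (F 0 * c) * (\<Sum>\<beta>\<in>?A. F \<beta> * ?G (\<delta> - \<beta>))"
        by (simp only: mult_minus_left mult_minus_right mult.assoc)
      then show ?thesis
        using False by (simp add: c ser_const_def)
    qed
    finally show ?thesis .
  qed
qed

lemma local_ser_inverse: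
  assumes F: "local_ser F" and c: "F 0 * c = 1"
  shows "local_ser (ser_inverse M F)" "ser_mult F (ser_inverse M F) = ser_const 1"
proof -
  have eq: "ser_inverse M F = recip c F"
    by (rule ser_inverse_eqI) (use assms in \<open>simp_all add: local_ser_recip ser_mult_recip\<close>)
  show "local_ser (ser_inverse M F)" "ser_mult F (ser_inverse M F) = ser_const 1"
    unfolding eq using assms by (simp_all add: local_ser_recip ser_mult_recip)
qed

text \<open>The difference of the inverses is \<open>G G' (F' - F)\<close>.\<close>

lemma deg_agree_inverse:
  assumes agree: "deg_agree d F F'" and F: "local_ser F" "F 0 * c = 1" and F': "local_ser F'" "F' 0 * c' = 1"
  shows "deg_agree d (ser_inverse M F) (ser_inverse M F')"
proof -
  let ?G = "ser_inverse M F" and ?G' = "ser_inverse M F'"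
  note G = local_ser_inverse[OF F] and G' = local_ser_inverse[OF F']
  have refl: "deg_agree d H H" for H :: "cls \<Rightarrow> 'b"
    by (simp add: deg_agree_def)
  have "deg_agree d (ser_mult ?G (ser_mult F' ?G')) (ser_mult ?G (ser_mult F ?G'))"
    using agree F G F' G' by (intro deg_agree_mult refl local_ser_mult) (auto simp: deg_agree_def)
  moreover have "ser_mult ?G (ser_mult F' ?G') = ?G"
    unfolding G'(2) by (rule ser_mult_one) (simp add: G(1))
  moreover have "ser_mult ?G (ser_mult F ?G') = ser_mult (ser_mult F ?G) ?G'"
    unfolding ser_mult_commute[OF F(1)[THEN local_ser_M] G(1)[THEN local_ser_M]]
    by (rule ser_mult_assoc[symmetric]) (use F G G' in simp_all)
  then have "ser_mult ?G (ser_mult F ?G') = ?G'"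
    unfolding G(2) using ser_mult_one(1)[OF G'(1)[THEN local_ser_M]] by (rule trans)
  ultimately show ?thesis by simp
qed

end

section \<open>Uniqueness of the solution\<close>

lemma fls_times_nth_bounds:
  fixes f g :: "'r::comm_ring_1 fls"
  assumes "\<And>i. i < A \<Longrightarrow> fls_nth f i = 0" "\<And>i. i < B \<Longrightarrow> fls_nth g i = 0"
  shows "fls_nth (f * g) n = (\<Sum>i=A..n - B. fls_nth f i * fls_nth g (n - i))"
proof -
  let ?S = "{min A (fls_subdegree f)..max (n - B) (n - fls_subdegree g)}"
  have "fls_nth (f * g) n = (\<Sum>i=fls_subdegree f..n - fls_subdegree g. fls_nth f i * fls_nth g (n - i))"
    by (rule fls_times_nth)
  also have "\<dots> = (\<Sum>i\<in>?S. fls_nth f i * fls_nth g (n - i))"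
    by (rule sum.mono_neutral_left) auto
  also have "\<dots> = (\<Sum>i=A..n - B. fls_nth f i * fls_nth g (n - i))"
    by (rule sum.mono_neutral_right) (use assms in auto)
  finally show ?thesis .
qed

lemma qhalf_add: "qhalf (a + b) = qhalf a * qhalf b" and qhalf_0 [simp]: "qhalf 0 = 1"
  by (simp_all add: qhalf_def mult_single)

lemma fls_dilate_mult: "fls_dilate j (f * g) = fls_dilate j f * fls_dilate j g"
proof (rule fls_eqI)
  fix n
  have "fls_nth (fls_dilate j (f * g)) n =
      (\<Sum>i=fls_subdegree f..n - fls_subdegree g. qhalf (2 * j * n) * (fls_nth f i * fls_nth g (n - i)))"
    by (simp add: fls_times_nth_bounds[of "fls_subdegree f" f "fls_subdegree g" g] sum_distrib_left)
  also have "\<dots> = (\<Sum>i=fls_subdegree f..n - fls_subdegree g.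
      fls_nth (fls_dilate j f) i * fls_nth (fls_dilate j g) (n - i))"
  proof (rule sum.cong[OF refl])
    fix i
    have "qhalf (2 * j * n) = qhalf (2 * j * i) * qhalf (2 * j * (n - i))"
      by (simp add: algebra_simps flip: qhalf_add)
    then show "qhalf (2 * j * n) * (fls_nth f i * fls_nth g (n - i)) =
        fls_nth (fls_dilate j f) i * fls_nth (fls_dilate j g) (n - i)"
      by (simp add: mult_ac)
  qed
  also have "\<dots> = fls_nth (fls_dilate j f * fls_dilate j g) n"
    by (rule fls_times_nth_bounds[symmetric]) simp_all
  finally show "fls_nth (fls_dilate j (f * g)) n = fls_nth (fls_dilate j f * fls_dilate j g) n" .
qed

lemma fls_dilate_1 [simp]: "fls_dilate j 1 = 1" and fls_dilate_0 [simp]: "fls_dilate j 0 = 0"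
  by (rule fls_eqI; simp)+

lemma dilate_0 [simp]: "dilate 0 F = F"
  by (rule ext, rule fls_eqI) (simp add: dilate_def)

lemma eval_curve_eq:
  assumes "finite S" "qsupport p \<subseteq> S"
  shows "eval_curve M p Y \<delta> = (\<Sum>(u, \<beta>)\<in>S. fls_const (qcoeff p u \<beta>) * fls_X_intpow (fst u) *
    Y_bracket M Y (snd u) (\<delta> - \<beta>))"
proof -
  have S: "(SIGMA u:Poly_Mapping.keys (coeffs p). Poly_Mapping.keys (Poly_Mapping.lookup (coeffs p) u)) = qsupport p"
    by (auto simp: qsupport_def qcoeff_def in_keys_iff)
  have "eval_curve M p Y \<delta> = (\<Sum>(u, \<beta>)\<in>qsupport p. fls_const (qcoeff p u \<beta>) *
      fls_X_intpow (fst u) * Y_bracket M Y (snd u) (\<delta> - \<beta>))"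
    unfolding eval_curve_def by (simp add: sum.Sigma S qcoeff_def)
  also have "\<dots> = (\<Sum>(u, \<beta>)\<in>S. fls_const (qcoeff p u \<beta>) *
      fls_X_intpow (fst u) * Y_bracket M Y (snd u) (\<delta> - \<beta>))"
    by (rule sum.mono_neutral_left) (use assms in \<open>auto simp: qsupport_def\<close>)
  finally show ?thesis .
qed

lemma eval_curve_diff:
  "eval_curve M (x - y) Y \<delta> = eval_curve M x Y \<delta> - eval_curve M y Y \<delta>"
proof -
  let ?S = "qsupport x \<union> qsupport y"
  have "finite ?S" "qsupport (x - y) \<subseteq> ?S"
    using finite_qsupport by (auto simp: qsupport_def)
  then show ?thesis
    by (simp add: eval_curve_eq[of ?S] case_prod_beta left_diff_distrib sum_subtractf flip: fls_minus_const)
qed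

lemma eval_curve_qmono:
  "eval_curve M (qmono u \<beta> c) Y \<delta> = fls_const c * fls_X_intpow (fst u) * Y_bracket M Y (snd u) (\<delta> - \<beta>)"
  by (subst eval_curve_eq[of "{(u, \<beta>)}"]) (auto simp: qsupport_def qcoeff_qmono)

context graded_monoid
begin

definition unital_ser :: "(cls \<Rightarrow> 'r::comm_ring_1) \<Rightarrow> bool" where
  "unital_ser F \<longleftrightarrow> local_ser F \<and> (\<exists>c. F 0 * c = 1)"

lemma unital_ser_dilate:
  assumes "unital_ser F"
  shows "unital_ser (dilate j F)"
proof -
  obtain c where c: "F 0 * c = 1"
    using assms by (auto simp: unital_ser_def)
  have "dilate j F 0 * fls_dilate j c = 1"
    by (simp add: dilate_def c flip: fls_dilate_mult)
  moreover have "local_ser (dilate j F)"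
    using assms unfolding local_ser_def unital_ser_def dilate_def by (metis fls_dilate_0)
  ultimately show ?thesis
    by (auto simp: unital_ser_def)
qed

lemma local_ser_prod_list: "(\<And>F. F \<in> set Fs \<Longrightarrow> local_ser F) \<Longrightarrow> local_ser (ser_prod_list Fs)"
  by (induction Fs) (simp_all add: ser_prod_list_def)

lemma deg_agree_prod_list:
  assumes "list_all2 (\<lambda>F G. local_ser F \<and> local_ser G \<and> deg_agree d F G) Fs Gs"
  shows "deg_agree d (ser_prod_list Fs) (ser_prod_list Gs)"
  using assms
proof (induction Fs Gs rule: list_all2_induct)
  case Nil
  then show ?case by (simp add: deg_agree_def)
next
  case (Cons F Fs G Gs)
  then have "local_ser (ser_prod_list Fs)" "local_ser (ser_prod_list Gs)"
    by (auto intro!: local_ser_prod_list simp: list_all2_conv_all_nth in_set_conv_nth)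
  with Cons show ?case
    by (auto simp: ser_prod_list_def intro!: deg_agree_mult)
qed

lemma Y_bracket_agree:
  assumes Y: "unital_ser Y" and Y': "unital_ser Y'" and agree: "deg_agree d Y Y'"
  shows "deg_agree d (Y_bracket M Y b) (Y_bracket M Y' b)"
proof -
  have dil: "deg_agree d (dilate j Y) (dilate j Y')" for j
    using agree by (simp add: deg_agree_def dilate_def)
  have u: "unital_ser (dilate j Y)" "unital_ser (dilate j Y')" for j
    by (simp_all add: Y Y' unital_ser_dilate)
  then have inv: "local_ser (ser_inverse M (dilate j Y))" "local_ser (ser_inverse M (dilate j Y'))" 
    "deg_agree d (ser_inverse M (dilate j Y)) (ser_inverse M (dilate j Y'))" for j
    using local_ser_inverse deg_agree_inverse[OF dil] unfolding unital_ser_def by metis+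
  show ?thesis
    unfolding Y_bracket_def
    by (auto intro!: deg_agree_prod_list simp: list_all2_conv_all_nth inv dil u[unfolded unital_ser_def] simp del: upt_Suc)
qed

lemma eval_curve_leading:
  assumes "Y \<in> power_series M"
  shows "eval_curve M (1 - qX - qY - g) Y \<delta> = ser_const (1 - fls_X) \<delta> - Y \<delta> - eval_curve M g Y \<delta>"
proof -
  have "Y_bracket M Y 0 = ser_const 1"
    by (simp add: Y_bracket_def ser_prod_list_def)
  moreover have "fls_X_intpow 1 = (fls_X :: qpoly fls)"
    by (rule fls_eqI) simp
  moreover have "Y_bracket M Y 1 = Y"
    using assms by (simp add: Y_bracket_def ser_prod_list_def ser_mult_one)
  ultimately show ?thesis
    by (simp add: eval_curve_diff eval_curve_qmono qX_eq qY_eq flip: qmono_one)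
       (auto simp: ser_const_def)
qed

text \<open>In \<open>Y = 1 - X - g(X, Y)\<close> all monomials of \<open>g\<close> have positive degree, so the coefficient of \<open>Y\<close> at a
  class is determined by the coefficients at classes of lower degree.\<close>

lemma solution_unique:
  assumes Y: "unital_ser Y" "eval_curve M (1 - qX - qY - g) Y = (\<lambda>_. 0)"
    and Y': "unital_ser Y'" "eval_curve M (1 - qX - qY - g) Y' = (\<lambda>_. 0)"
    and g: "\<And>u \<beta>. (u, \<beta>) \<in> qsupport g \<Longrightarrow> deg \<beta> \<ge> 1"
  shows "Y = Y'"
proof -
  have M: "Y \<in> power_series M" "Y' \<in> power_series M"
    using Y(1) Y'(1) by (auto simp: unital_ser_def)
  have eq: "Y \<delta> = ser_const (1 - fls_X) \<delta> - eval_curve M g Y \<delta>"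
    "Y' \<delta> = ser_const (1 - fls_X) \<delta> - eval_curve M g Y' \<delta>" for \<delta>
    using eval_curve_leading[OF M(1), of g \<delta>, unfolded Y(2)]
      eval_curve_leading[OF M(2), of g \<delta>, unfolded Y'(2)]
    by (simp_all add: algebra_simps)
  have "deg_agree (int d) Y Y'" for d
  proof (induction d)
    case 0
    show ?case
      using Y(1) Y'(1) by (simp add: deg_agree_def unital_ser_def local_ser_eq_0)
  next
    case (Suc d)
    have "Y \<delta> = Y' \<delta>" if "deg \<delta> < int (Suc d)" for \<delta>
    proof -
      have "Y_bracket M Y b (\<delta> - \<beta>) = Y_bracket M Y' b (\<delta> - \<beta>)" if "deg \<beta> \<ge> 1" for b \<beta>
        using Y_bracket_agree[OF Y(1) Y'(1) Suc, of b] that \<open>deg \<delta> < int (Suc d)\<close>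
        by (auto simp: deg_agree_def deg_diff)
      then have "eval_curve M g Y \<delta> = eval_curve M g Y' \<delta>"
        using g by (auto simp: eval_curve_eq[OF finite_qsupport order_refl] intro!: sum.cong)
      then show ?thesis by (simp add: eq)
    qed
    then show ?case by (simp add: deg_agree_def)
  qed
  then have "deg_agree (int (nat (deg \<delta>) + 1)) Y Y'" for \<delta>
    by blast
  moreover have "deg \<delta> < int (nat (deg \<delta>) + 1)" for \<delta>
    by simp
  ultimately show ?thesis
    unfolding deg_agree_def by (intro ext) blast
qed

end

section \<open>Series in the quantum torus, graded by a weight\<close>

lemma qcoeff_mult_qmono:
  "qcoeff (x * qmono u \<beta> c) v \<gamma> = qhalf (2 * snd (v - u) * fst u) * c * qcoeff x (v - u) (\<gamma> - \<beta>)"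
proof -
  define S where "S = insert (v - u, \<gamma> - \<beta>) (qsupport x)"
  have S: "finite S" "qsupport x \<subseteq> S"
    by (auto simp: S_def finite_qsupport)
  have "qcoeff (x * qmono u \<beta> c) v \<gamma> =
      (\<Sum>s\<in>S. if s = (v - u, \<gamma> - \<beta>)
        then qhalf (2 * snd (v - u) * fst u) * c * qcoeff x (v - u) (\<gamma> - \<beta>) else 0)"
    by (subst qcoeff_mult[OF S]) (auto simp: qcoeff_qmono algebra_simps intro!: sum.cong)
  also have "\<dots> = qhalf (2 * snd (v - u) * fst u) * c * qcoeff x (v - u) (\<gamma> - \<beta>)"
    using S(1) by (simp add: S_def)
  finally show ?thesis .
qed

definition exponents_in :: "(int \<times> int) set \<Rightarrow> qtorus fps \<Rightarrow> bool" where
  "exponents_in A F \<longleftrightarrow> (\<forall>n u \<beta>. qcoeff (fps_nth F n) u \<beta> \<noteq> 0 \<longrightarrow> u \<in> A)"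

lemma exponents_in_add: "exponents_in A F \<Longrightarrow> exponents_in A G \<Longrightarrow> exponents_in A (F + G)"
  and exponents_in_uminus: "exponents_in A F \<Longrightarrow> exponents_in A (- F)"
proof -
  show "exponents_in A F \<Longrightarrow> exponents_in A G \<Longrightarrow> exponents_in A (F + G)"
    unfolding exponents_in_def fps_add_nth qcoeff_simps by (metis add.right_neutral)
qed (simp add: exponents_in_def)

lemma exponents_in_sum: "(\<And>s. s \<in> S \<Longrightarrow> exponents_in A (F s)) \<Longrightarrow> exponents_in A (\<Sum>s\<in>S. F s)"
  by (induction S rule: infinite_finite_induct)
     (simp_all add: exponents_in_add, simp_all add: exponents_in_def)

lemma exponents_in_mult:
  assumes F: "exponents_in A F" and G: "exponents_in B G"
    and add: "\<And>u v. u \<in> A \<Longrightarrow> v \<in> B \<Longrightarrow> u + v \<in> C"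
  shows "exponents_in C (F * G)"
  unfolding exponents_in_def
proof (intro allI impI)
  fix n u \<beta> assume "qcoeff (fps_nth (F * G) n) u \<beta> \<noteq> 0"
  then obtain i where "qcoeff (fps_nth F i * fps_nth G (n - i)) u \<beta> \<noteq> 0"
    by (auto simp: fps_mult_nth qcoeff_sum elim: sum.not_neutral_contains_not_neutral)
  then obtain v \<gamma> where "qcoeff (fps_nth F i) v \<gamma> \<noteq> 0" "qcoeff (fps_nth G (n - i)) (u - v) (\<beta> - \<gamma>) \<noteq> 0"
    by (rule qcoeff_mult_nonzero)
  then show "u \<in> C"
    using add[of v "u - v"] F G unfolding exponents_in_def by force
qed

lemma exponents_in_fps_X_power: "exponents_in A F \<Longrightarrow> exponents_in A (fps_X ^ k * F)"
  by (auto simp: exponents_in_def fps_X_power_mult_nth split: if_splits)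

lemma exponents_in_const_qmono: "u \<in> A \<Longrightarrow> exponents_in A (fps_const (qmono u \<beta> q))"
  by (auto simp: exponents_in_def qcoeff_qmono split: if_splits)

lemma exponents_in_power:
  assumes "exponents_in A F" and "\<And>u v. u \<in> A \<Longrightarrow> v \<in> A \<Longrightarrow> u + v \<in> A"
  shows "exponents_in A (F ^ Suc n)"
  by (induction n) (use assms in \<open>auto intro: exponents_in_mult\<close>)

text \<open>The logarithm of \<open>1 - h\<close> has no constant term if the exponents of \<open>h\<close> lie strictly on one side
  of a line through the origin.\<close>

lemma tr_log_eq_0:
  assumes h: "exponents_in A h" and A: "\<And>u v. u \<in> A \<Longrightarrow> v \<in> A \<Longrightarrow> u + v \<in> A" "0 \<notin> A"
  shows "trace_functional.tr_log (\<lambda>x. Poly_Mapping.lookup (qcoeff x 0 \<beta>) k) (1 - h) N = 0"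
proof -
  have "qcoeff (fps_nth (h ^ n) N) 0 \<beta> = 0" if "n \<in> {1..N}" for n
  proof -
    have "exponents_in A (h ^ Suc (n - 1))"
      using h A(1) by (rule exponents_in_power)
    moreover have "h ^ Suc (n - 1) = h ^ n"
      using that by (simp del: power_Suc)
    ultimately show ?thesis
      using A(2) unfolding exponents_in_def by metis
  qed
  then show ?thesis
    by (simp add: trace_functional.tr_log_def[OF trace_qcoeff])
qed

text \<open>Here the potential is \<open>X + Y + g\<close>. The monomials of \<open>g\<close> have positive weight both without and with
  their powers of \<open>Y\<close>. The former makes the equation for \<open>Y(X)\<close> a contraction, the latter makes the
  powers of the potential converge to zero. The last two conditions say that the coefficient of \<open>Y\<close> in the potential
  is \<open>1\<close> plus negative powers of \<open>X\<close> and that there are no higher powers of \<open>Y\<close>.\<close>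

locale quantum_curve = graded_monoid +
  fixes c :: int and g :: qtorus
  assumes support_M: "(u, \<beta>) \<in> qsupport g \<Longrightarrow> \<beta> \<in> M"
    and support_deg: "(u, \<beta>) \<in> qsupport g \<Longrightarrow> deg \<beta> \<ge> 1"
    and support_weight_X: "(u, \<beta>) \<in> qsupport g \<Longrightarrow> c * deg \<beta> + fst u \<ge> 1"
    and support_weight: "(u, \<beta>) \<in> qsupport g \<Longrightarrow> c * deg \<beta> + fst u + snd u \<ge> 1"
    and support_Y: "(u, \<beta>) \<in> qsupport g \<Longrightarrow> snd u \<le> 1"
    and support_XY: "(u, \<beta>) \<in> qsupport g \<Longrightarrow> snd u = 1 \<Longrightarrow> fst u < 0"
begin

definition weight :: "int \<times> int \<Rightarrow> cls \<Rightarrow> int" where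
  "weight u \<beta> = c * deg \<beta> + fst u + snd u"

lemma weight_diff: "weight (u - v) (\<beta> - \<gamma>) = weight u \<beta> - weight v \<gamma>"
  by (simp add: weight_def deg_diff algebra_simps)

subsection \<open>The series in X alone\<close>

text \<open>In a graded series the coefficient of \<open>t\<^sup>n\<close> consists of terms of weight \<open>n\<close>.\<close>

definition X_part :: "nat \<Rightarrow> qtorus set" where
  "X_part n = {x. \<forall>u \<beta>. qcoeff x u \<beta> \<noteq> 0 \<longrightarrow>
     snd u = 0 \<and> int n = weight u \<beta> \<and> \<beta> \<in> M \<and> (\<beta> = 0 \<or> deg \<beta> \<ge> 1)}"

definition X_series :: "qtorus fps set" where
  "X_series = {F. \<forall>n. fps_nth F n \<in> X_part n}"

lemma X_part_add: "x \<in> X_part n \<Longrightarrow> y \<in> X_part n \<Longrightarrow> x + y \<in> X_part n"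
  unfolding X_part_def mem_Collect_eq qcoeff_simps by (metis add.right_neutral add.left_neutral)

lemma X_part_0: "0 \<in> X_part n" and X_part_uminus: "x \<in> X_part n \<Longrightarrow> - x \<in> X_part n"
  by (auto simp: X_part_def)

lemma X_part_1: "1 \<in> X_part 0"
  by (simp add: X_part_def qcoeff_one weight_def zero_M zero_prod_def)

lemma X_part_mult:
  assumes "x \<in> X_part i" "y \<in> X_part j"
  shows "x * y \<in> X_part (i + j)"
  unfolding X_part_def mem_Collect_eq
proof (intro allI impI)
  fix u \<beta> assume "qcoeff (x * y) u \<beta> \<noteq> 0"
  then obtain v \<gamma> where nz: "qcoeff x v \<gamma> \<noteq> 0" "qcoeff y (u - v) (\<beta> - \<gamma>) \<noteq> 0"
    by (rule qcoeff_mult_nonzero)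
  then have x: "snd v = 0" "int i = weight v \<gamma>" "\<gamma> \<in> M" "\<gamma> = 0 \<or> deg \<gamma> \<ge> 1"
    using assms(1) unfolding X_part_def by blast+
  from nz have y: "snd (u - v) = 0" "int j = weight (u - v) (\<beta> - \<gamma>)" "\<beta> - \<gamma> \<in> M"
    "\<beta> - \<gamma> = 0 \<or> deg (\<beta> - \<gamma>) \<ge> 1"
    using assms(2) unfolding X_part_def by blast+
  have "\<beta> \<in> M"
    using add_M[OF x(3) y(3)] by simp
  then show "snd u = 0 \<and> int (i + j) = weight u \<beta> \<and> \<beta> \<in> M \<and> (\<beta> = 0 \<or> deg \<beta> \<ge> 1)"
    using x y by (auto simp: weight_diff deg_diff)
qed

lemma X_series_add: "F \<in> X_series \<Longrightarrow> G \<in> X_series \<Longrightarrow> F + G \<in> X_series"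
  and X_series_uminus: "F \<in> X_series \<Longrightarrow> - F \<in> X_series"
  by (simp_all add: X_series_def X_part_add X_part_uminus)

lemma X_series_diff: "F \<in> X_series \<Longrightarrow> G \<in> X_series \<Longrightarrow> F - G \<in> X_series"
  using X_series_add[OF _ X_series_uminus] by simp

lemma X_series_1: "1 \<in> X_series"
  by (auto simp: X_series_def X_part_1 X_part_0)

lemma X_series_sum: "(\<And>s. s \<in> S \<Longrightarrow> F s \<in> X_series) \<Longrightarrow> (\<Sum>s\<in>S. F s) \<in> X_series"
  by (induction S rule: infinite_finite_induct)
     (simp_all add: X_series_add, simp_all add: X_series_def X_part_0)

lemma X_series_mult: "F \<in> X_series \<Longrightarrow> G \<in> X_series \<Longrightarrow> F * G \<in> X_series"
  unfolding X_series_def mem_Collect_eq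
  by (intro allI graded_mult[of F X_part G X_part X_part]) (auto intro: X_part_mult X_part_0 X_part_add)

lemma X_series_unit_inv: "F \<in> X_series \<Longrightarrow> fps_nth F 0 = 1 \<Longrightarrow> unit_inv F \<in> X_series"
  unfolding X_series_def mem_Collect_eq
  by (intro allI graded_unit_inv[of F X_part])
     (auto intro: X_part_mult X_part_0 X_part_add X_part_1 X_part_uminus)

lemma X_series_prod_list: "(\<And>F. F \<in> set Fs \<Longrightarrow> F \<in> X_series) \<Longrightarrow> prod_list Fs \<in> X_series"
  by (induction Fs) (auto intro: X_series_1 X_series_mult)

lemma exponents_in_X_series: "F \<in> X_series \<Longrightarrow> exponents_in {u. snd u = 0} F"
  by (auto simp: exponents_in_def X_series_def X_part_def)

lemma X_part_commute:
  assumes "x \<in> X_part i" "y \<in> X_part j"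
  shows "x * y = y * x"
proof -
  have "qmono u \<beta> (qcoeff x u \<beta>) * qmono v \<gamma> (qcoeff y v \<gamma>) =
      qmono v \<gamma> (qcoeff y v \<gamma>) * qmono u \<beta> (qcoeff x u \<beta>)"
    if "(u, \<beta>) \<in> qsupport x" "(v, \<gamma>) \<in> qsupport y" for u v \<beta> \<gamma>
  proof -
    have "snd u = 0" "snd v = 0"
      using that assms unfolding X_part_def qsupport_def by blast+
    then show ?thesis
      by (simp add: qmono_mult ac_simps)
  qed
  then show ?thesis
    by (subst (1 2) qtorus_decompose[OF finite_qsupport order_refl, of x],
        subst (1 2) qtorus_decompose[OF finite_qsupport order_refl, of y])
       (auto simp: sum_product case_prod_beta sum.swap[of _ "qsupport y"] intro!: sum.cong)
qed

lemma X_series_commute: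
  assumes "F \<in> X_series" "G \<in> X_series"
  shows "F * G = G * F"
proof (rule fps_ext)
  fix n
  have "fps_nth (F * G) n = (\<Sum>i=0..n. fps_nth F (n - i) * fps_nth G i)"
    unfolding fps_mult_nth by (subst sum.atLeastAtMost_rev) simp
  also have "\<dots> = fps_nth (G * F) n"
    unfolding fps_mult_nth
    using assms by (intro sum.cong refl X_part_commute) (auto simp: X_series_def)
  finally show "fps_nth (F * G) n = fps_nth (G * F) n" .
qed

definition X_mono :: "int \<Rightarrow> cls \<Rightarrow> qpoly \<Rightarrow> qtorus fps" where
  "X_mono a \<beta> q = fps_X ^ nat (c * deg \<beta> + a) * fps_const (qmono (a, 0) \<beta> q)"

lemma X_mono_X_series:
  assumes "\<beta> \<in> M" "\<beta> = 0 \<or> deg \<beta> \<ge> 1" "c * deg \<beta> + a \<ge> 0"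
  shows "X_mono a \<beta> q \<in> X_series"
  using assms by (auto simp: X_mono_def X_series_def X_part_def fps_X_power_mult_nth qcoeff_qmono
      weight_def split: if_splits)

lemma X_mono_nth_0: "c * deg \<beta> + a \<ge> 1 \<Longrightarrow> fps_nth (X_mono a \<beta> q) 0 = 0"
  by (simp add: X_mono_def fps_X_power_mult_nth)

definition Y_pow :: "int \<Rightarrow> qtorus fps" where
  "Y_pow b = fps_const (qmono (0, b) 0 1)"

lemma Y_pow_mult: "Y_pow a * Y_pow b = Y_pow (a + b)"
  by (simp add: Y_pow_def qmono_mult)

lemma Y_pow_0 [simp]: "Y_pow 0 = 1"
  by (simp add: Y_pow_def qmono_one flip: zero_prod_def)

text \<open>Conjugation with a power of \<open>Y\<close> substitutes \<open>q\<^sup>j X\<close> for \<open>X\<close>.\<close>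

definition conj_Y :: "int \<Rightarrow> qtorus fps \<Rightarrow> qtorus fps" where
  "conj_Y j F = Y_pow j * F * Y_pow (- j)"

lemma conj_Y_commute: "Y_pow j * F = conj_Y j F * Y_pow j"
  by (simp add: conj_Y_def mult.assoc Y_pow_mult)

lemma qcoeff_conj_Y: "qcoeff (fps_nth (conj_Y j F) n) u \<beta> = qhalf (2 * j * fst u) * qcoeff (fps_nth F n) u \<beta>"
proof -
  obtain a b where "u = (a, b)"
    by (rule prod.exhaust)
  then show ?thesis
    by (simp add: conj_Y_def Y_pow_def qcoeff_qmono_mult qcoeff_mult_qmono)
qed

lemma conj_Y_X_series: "F \<in> X_series \<Longrightarrow> conj_Y j F \<in> X_series"
  unfolding X_series_def X_part_def by (auto simp: qcoeff_conj_Y)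

lemma conj_Y_nth_0:
  assumes "fps_nth F 0 = 1"
  shows "fps_nth (conj_Y j F) 0 = 1"
proof -
  have "fps_nth (conj_Y j F) 0 = fps_nth (Y_pow j * Y_pow (- j)) 0"
    using assms by (simp add: conj_Y_def Y_pow_def)
  then show ?thesis by (simp add: Y_pow_mult)
qed

lemma agree_conj_Y: "agree n F G \<Longrightarrow> agree n (conj_Y j F) (conj_Y j G)"
  unfolding conj_Y_def by (intro agree_mult) simp_all

text \<open>The counterpart of \<^const>\<open>Y_bracket\<close>: conjugation takes the place of dilation.\<close>

definition bracket :: "qtorus fps \<Rightarrow> int \<Rightarrow> qtorus fps" where
  "bracket F b =
     (if b \<ge> 0 then prod_list (map (\<lambda>j. conj_Y (int j) F) [0..<nat b])
      else prod_list (map (\<lambda>j. unit_inv (conj_Y (- int j) F)) [1..<nat (- b) + 1]))"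

lemma bracket_X_series:
  assumes "F \<in> X_series" "fps_nth F 0 = 1"
  shows "bracket F b \<in> X_series"
  using assms unfolding bracket_def
  by (auto intro!: X_series_prod_list X_series_unit_inv conj_Y_X_series conj_Y_nth_0 simp del: upt_Suc)

lemma agree_bracket:
  assumes "agree n F G" "fps_nth F 0 = 1" "fps_nth G 0 = 1"
  shows "agree n (bracket F b) (bracket G b)"
proof -
  have "agree n (prod_list (map h js)) (prod_list (map k js))"
    if "\<And>j. agree n (h j) (k j)" for h k :: "nat \<Rightarrow> qtorus fps" and js
    using that by (induction js) (auto intro: agree_mult)
  with assms show ?thesis
    by (simp add: bracket_def agree_conj_Y agree_unit_inv conj_Y_nth_0 del: upt_Suc)
qed

text \<open>The equation for the solution \<open>Y(X)\<close>, written as a fixed point equation. It is contracting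
  because all monomials of \<open>g\<close> have positive weight after omission of their power of \<open>Y\<close>.\<close>

definition wave_step :: "qtorus fps \<Rightarrow> qtorus fps" where
  "wave_step F = 1 - X_mono 1 0 1 -
     (\<Sum>(u, \<beta>)\<in>qsupport g. X_mono (fst u) \<beta> (qcoeff g u \<beta>) * bracket F (snd u))"

lemma wave_fixed_point:
  obtains F where "F \<in> X_series" "fps_nth F 0 = 1" "wave_step F = F"
proof -
  define C where "C n = (if n = 0 then X_part n \<inter> {1} else X_part n)" for n
  define S where "S = {F. \<forall>n. fps_nth F n \<in> C n}"
  have S: "S = {F \<in> X_series. fps_nth F 0 = 1}"
    by (auto simp: S_def C_def X_series_def split: if_splits)
  have mono: "X_mono (fst u) \<beta> q \<in> X_series" "fps_nth (X_mono (fst u) \<beta> q) 0 = 0"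
    if "(u, \<beta>) \<in> qsupport g" for u \<beta> q
    using support_weight_X[OF that] support_M[OF that] support_deg[OF that]
    by (simp_all add: X_mono_X_series X_mono_nth_0)
  have X: "X_mono 1 0 1 \<in> X_series" "fps_nth (X_mono 1 0 1) 0 = 0"
    by (auto intro!: X_mono_X_series X_mono_nth_0 simp: zero_M)
  have "1 \<in> S"
    by (simp add: S X_series_1)
  moreover have "wave_step F \<in> S" if "F \<in> S" for F
  proof -
    have "(\<Sum>(u, \<beta>)\<in>qsupport g. X_mono (fst u) \<beta> (qcoeff g u \<beta>) * bracket F (snd u)) \<in> X_series"
      using that by (auto simp: S intro!: X_series_sum X_series_mult mono bracket_X_series)
    moreover have "fps_nth (\<Sum>(u, \<beta>)\<in>qsupport g. X_mono (fst u) \<beta> (qcoeff g u \<beta>) * bracket F (snd u)) 0 = 0"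
      using mono(2) by (force simp: fps_sum_nth intro: sum.neutral)
    ultimately show ?thesis
      using X by (simp add: S wave_step_def X_series_1 X_series_diff)
  qed
  moreover have "agree (Suc n) (wave_step F) (wave_step G)" if "F \<in> S" "G \<in> S" "agree n F G" for n F G
    using that mono(2) unfolding wave_step_def
    by (auto simp: S intro!: agree_diff agree_sum agree_shift agree_bracket)
  ultimately obtain F where "F \<in> S" "wave_step F = F"
    unfolding S_def by (rule contraction_fixed_point)
  with that show thesis by (auto simp: S)
qed


subsection \<open>Passage to Laurent series in X\<close>

text \<open>The coefficient of \<open>z\<^sup>\<beta> X\<^sup>a\<close> is found at the power of \<open>t\<close> given by its weight.\<close>

definition Laurent :: "qtorus fps \<Rightarrow> xseries" where
  "Laurent F \<beta> = Abs_fls (\<lambda>a. if weight (a, 0) \<beta> < 0 then 0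
     else qcoeff (fps_nth F (nat (weight (a, 0) \<beta>))) (a, 0) \<beta>)"

lemma Laurent_nth:
  "fls_nth (Laurent F \<beta>) a = (if weight (a, 0) \<beta> < 0 then 0
     else qcoeff (fps_nth F (nat (weight (a, 0) \<beta>))) (a, 0) \<beta>)"
  unfolding Laurent_def
  by (rule nth_Abs_fls_lower_bound[of "- c * deg \<beta>"]) (simp add: weight_def)

lemma Laurent_diff: "Laurent (F - G) \<delta> = Laurent F \<delta> - Laurent G \<delta>"
  by (rule fls_eqI) (simp add: Laurent_nth)

lemma Laurent_sum: "Laurent (\<Sum>s\<in>S. F s) \<delta> = (\<Sum>s\<in>S. Laurent (F s) \<delta>)"
proof (induction S rule: infinite_finite_induct)
  case (insert s S)
  have "Laurent (F s + sum F S) \<delta> = Laurent (F s) \<delta> + Laurent (sum F S) \<delta>"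
    by (rule fls_eqI) (simp add: Laurent_nth)
  with insert show ?case by simp
qed (auto intro: fls_eqI simp: Laurent_nth)

lemma Laurent_local:
  assumes "F \<in> X_series"
  shows "local_ser (Laurent F)"
  unfolding local_ser_def
proof (intro allI impI)
  fix \<beta> assume "Laurent F \<beta> \<noteq> 0"
  then obtain a where "fls_nth (Laurent F \<beta>) a \<noteq> 0"
    using fls_eqI[of "Laurent F \<beta>" 0] by auto
  then show "\<beta> \<in> M \<and> (\<beta> = 0 \<or> 1 \<le> deg \<beta>)"
    using assms by (auto simp: Laurent_nth X_series_def X_part_def split: if_splits)
qed

text \<open>The exponent of \<open>X\<close> in a monomial of \<open>x\<close> is determined by its class and the weight \<open>k\<close>, so that only a
  sum over classes remains.\<close>

lemma qcoeff_X_part_mult: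
  assumes x: "x \<in> X_part k" and y: "y \<in> X_part l"
  shows "qcoeff (x * y) (a, 0) \<delta> = (\<Sum>\<beta>\<in>splits \<delta>. qcoeff x (int k - c * deg \<beta>, 0) \<beta> *
    qcoeff y (a - (int k - c * deg \<beta>), 0) (\<delta> - \<beta>))"
proof -
  define e where "e \<beta> = ((int k - c * deg \<beta>, 0 :: int), \<beta>)" for \<beta>
  have e: "inj_on e (splits \<delta>)"
    by (auto simp: e_def inj_on_def)
  let ?t = "\<lambda>s. qhalf (2 * snd (fst s) * fst ((a, 0) - fst s)) * qcoeff x (fst s) (snd s) *
    qcoeff y ((a, 0) - fst s) (\<delta> - snd s)"
  let ?S = "qsupport x \<union> e ` splits \<delta>"
  have "qcoeff (x * y) (a, 0) \<delta> = sum ?t ?S"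
    by (subst qcoeff_mult[of ?S]) (auto simp: finite_qsupport case_prod_beta)
  also have "\<dots> = sum ?t (e ` splits \<delta>)"
  proof (rule sum.mono_neutral_right)
    show "\<forall>s\<in>?S - e ` splits \<delta>. ?t s = 0"
    proof (intro ballI, rule ccontr)
      fix s assume s: "s \<in> ?S - e ` splits \<delta>" and nz: "?t s \<noteq> 0"
      obtain u \<beta> where u: "s = (u, \<beta>)"
        by (rule prod.exhaust)
      have "qcoeff x u \<beta> \<noteq> 0"
        using s by (auto simp: u qsupport_def)
      then have "snd u = 0" "int k = weight u \<beta>" "\<beta> \<in> M"
        using x unfolding X_part_def by blast+
      moreover have "qcoeff y ((a, 0) - u) (\<delta> - \<beta>) \<noteq> 0"
        using nz by (auto simp: u)
      then have "\<delta> - \<beta> \<in> M"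
        using y unfolding X_part_def by blast
      ultimately have "s = e \<beta>" "\<beta> \<in> splits \<delta>"
        by (auto simp: u e_def splits_def weight_def prod_eq_iff)
      with s show False by blast
    qed
  qed (auto simp: finite_qsupport)
  also have "\<dots> = (\<Sum>\<beta>\<in>splits \<delta>. ?t (e \<beta>))"
    using e by (simp add: sum.reindex)
  finally show ?thesis
    by (simp add: e_def)
qed

text \<open>A product of two monomials of weights \<open>k\<close> and \<open>l\<close> occurs on the left for the power \<open>t\<^sup>k\<^sup>+\<^sup>l\<close> only, once
  for each pair of monomials, exactly as on the right.\<close>

lemma Laurent_mult:
  assumes F: "F \<in> X_series" and G: "G \<in> X_series"
  shows "Laurent (F * G) = ser_mult (Laurent F) (Laurent G)"
proof (rule ext, rule fls_eqI)
  fix \<delta> a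
  define n where "n = weight (a, 0) \<delta>"
  let ?t = "\<lambda>k \<beta>. qcoeff (fps_nth F (nat k)) (k - c * deg \<beta>, 0) \<beta> *
    qcoeff (fps_nth G (nat (n - k))) (a - (k - c * deg \<beta>), 0) (\<delta> - \<beta>)"
  have inner: "fls_nth (Laurent F \<beta> * Laurent G (\<delta> - \<beta>)) a =
      (\<Sum>k=0..n. ?t k \<beta>)" for \<beta>
  proof -
    have "fls_nth (Laurent F \<beta> * Laurent G (\<delta> - \<beta>)) a =
        (\<Sum>i = - c * deg \<beta>..a - - c * deg (\<delta> - \<beta>).
          fls_nth (Laurent F \<beta>) i * fls_nth (Laurent G (\<delta> - \<beta>)) (a - i))"
      by (rule fls_times_nth_bounds) (simp_all add: Laurent_nth weight_def)
    also have "\<dots> = (\<Sum>k=0..n. fls_nth (Laurent F \<beta>) (k - c * deg \<beta>) *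
        fls_nth (Laurent G (\<delta> - \<beta>)) (a - (k - c * deg \<beta>)))"
      by (rule sum.reindex_bij_witness[of _ "\<lambda>k. k - c * deg \<beta>" "\<lambda>i. i + c * deg \<beta>"])
         (auto simp: n_def weight_def deg_diff algebra_simps)
    also have "\<dots> = (\<Sum>k=0..n. ?t k \<beta>)"
    proof (rule sum.cong[OF refl])
      fix k assume "k \<in> {0..n}"
      moreover have "weight (k - c * deg \<beta>, 0) \<beta> = k"
        "weight (a - (k - c * deg \<beta>), 0) (\<delta> - \<beta>) = n - k"
        by (simp_all add: weight_def n_def deg_diff algebra_simps)
      ultimately show "fls_nth (Laurent F \<beta>) (k - c * deg \<beta>) *
          fls_nth (Laurent G (\<delta> - \<beta>)) (a - (k - c * deg \<beta>)) =
          ?t k \<beta>"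
        by (simp add: Laurent_nth)
    qed
    finally show ?thesis .
  qed
  have "fls_nth (ser_mult (Laurent F) (Laurent G) \<delta>) a =
      (\<Sum>\<beta>\<in>splits \<delta>. fls_nth (Laurent F \<beta> * Laurent G (\<delta> - \<beta>)) a)"
    using F G by (simp add: ser_mult_eq Laurent_local fls_nth_sum)
  also have "\<dots> = (\<Sum>k=0..n. \<Sum>\<beta>\<in>splits \<delta>. ?t k \<beta>)"
    unfolding inner by (rule sum.swap)
  also have "\<dots> = (\<Sum>k=0..n. qcoeff (fps_nth F (nat k) * fps_nth G (nat (n - k))) (a, 0) \<delta>)"
  proof (rule sum.cong[OF refl])
    fix k assume "k \<in> {0..n}"
    then show "(\<Sum>\<beta>\<in>splits \<delta>. ?t k \<beta>) =
        qcoeff (fps_nth F (nat k) * fps_nth G (nat (n - k))) (a, 0) \<delta>"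
      using F G qcoeff_X_part_mult[of "fps_nth F (nat k)" "nat k" "fps_nth G (nat (n - k))" "nat (n - k)" a \<delta>]
      by (simp add: X_series_def)
  qed
  also have "\<dots> = fls_nth (Laurent (F * G) \<delta>) a"
  proof (cases "n < 0")
    case True
    then show ?thesis by (simp add: Laurent_nth n_def)
  next
    case False
    then have "(\<Sum>k=0..n. qcoeff (fps_nth F (nat k) * fps_nth G (nat (n - k))) (a, 0) \<delta>) =
        (\<Sum>k=0..nat n. qcoeff (fps_nth F k * fps_nth G (nat n - k)) (a, 0) \<delta>)"
      by (intro sum.reindex_bij_witness[of _ int nat]) (auto simp: nat_diff_distrib)
    with False show ?thesis
      by (simp add: Laurent_nth n_def fps_mult_nth qcoeff_sum)
  qed
  finally show "fls_nth (Laurent (F * G) \<delta>) a = fls_nth (ser_mult (Laurent F) (Laurent G) \<delta>) a" ..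
qed

lemma Laurent_1: "Laurent 1 = ser_const 1"
  by (rule ext, rule fls_eqI) (auto simp: Laurent_nth ser_const_def qcoeff_one weight_def zero_prod_def)

lemma Laurent_conj_Y: "Laurent (conj_Y j F) = dilate j (Laurent F)"
  by (rule ext, rule fls_eqI) (simp add: Laurent_nth dilate_def qcoeff_conj_Y)

lemma Laurent_unit_inv:
  assumes "F \<in> X_series" "fps_nth F 0 = 1"
  shows "Laurent (unit_inv F) = ser_inverse M (Laurent F)"
proof (rule ser_inverse_eqI[symmetric])
  show "ser_mult (Laurent F) (Laurent (unit_inv F)) = ser_const 1"
    using assms by (simp add: X_series_unit_inv unit_inv_right Laurent_1 flip: Laurent_mult)
qed (use assms in \<open>simp_all add: Laurent_local X_series_unit_inv\<close>)

lemma Laurent_prod_list: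
  assumes "\<And>F. F \<in> set Fs \<Longrightarrow> F \<in> X_series"
  shows "Laurent (prod_list Fs) = ser_prod_list (map Laurent Fs)"
  using assms by (induction Fs) (simp_all add: Laurent_1 ser_prod_list_def Laurent_mult X_series_prod_list)

lemma Laurent_bracket:
  assumes "F \<in> X_series" "fps_nth F 0 = 1"
  shows "Laurent (bracket F b) = Y_bracket M (Laurent F) b"
proof -
  have "Laurent (prod_list (map (\<lambda>j. conj_Y (int j) F) js)) =
      ser_prod_list (map (\<lambda>j. dilate (int j) (Laurent F)) js)" for js
    using assms by (subst Laurent_prod_list) (auto simp: conj_Y_X_series Laurent_conj_Y o_def)
  moreover have "Laurent (prod_list (map (\<lambda>j. unit_inv (conj_Y (- int j) F)) js)) =
      ser_prod_list (map (\<lambda>j. ser_inverse M (dilate (- int j) (Laurent F))) js)" for js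
    using assms by (subst Laurent_prod_list)
      (auto simp: conj_Y_X_series conj_Y_nth_0 X_series_unit_inv Laurent_unit_inv Laurent_conj_Y o_def)
  ultimately show ?thesis
    by (simp add: bracket_def Y_bracket_def del: upt_Suc)
qed

lemma Laurent_X_mono_mult:
  assumes "c * deg \<beta> + a \<ge> 0"
  shows "Laurent (X_mono a \<beta> q * F) \<delta> = fls_const q * fls_X_intpow a * Laurent F (\<delta> - \<beta>)"
proof (rule fls_eqI)
  fix i
  define k where "k = nat (c * deg \<beta> + a)"
  have k: "weight (i - a, 0) (\<delta> - \<beta>) = weight (i, 0) \<delta> - int k"
    using assms by (simp add: weight_def deg_diff k_def algebra_simps)
  have "fls_nth (Laurent (X_mono a \<beta> q * F) \<delta>) i = q * fls_nth (Laurent F (\<delta> - \<beta>)) (i - a)"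
    by (auto simp: Laurent_nth k X_mono_def mult.assoc fps_X_power_mult_nth qcoeff_qmono_mult
        nat_diff_distrib simp flip: k_def)
  then show "fls_nth (Laurent (X_mono a \<beta> q * F) \<delta>) i =
      fls_nth (fls_const q * fls_X_intpow a * Laurent F (\<delta> - \<beta>)) i"
    by (simp only: mult.assoc fls_X_intpow_times_conv_shift(1) fls_mult_const_nth(1) fls_shift_nth) simp
qed

text \<open>Under the homomorphism the fixed point equation becomes the equation of the curve. The term at the
  class \<open>0\<close> is \<open>1 - X\<close>, as \<open>g\<close> contributes only in positive degree.\<close>

lemma Laurent_solution:
  assumes F: "F \<in> X_series" "fps_nth F 0 = 1" and fixed: "wave_step F = F"
  shows "eval_curve M (1 - qX - qY - g) (Laurent F) = (\<lambda>_. 0)" and "Laurent F 0 = 1 - fls_X"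
proof -
  have g: "Laurent (\<Sum>(u, \<beta>)\<in>qsupport g. X_mono (fst u) \<beta> (qcoeff g u \<beta>) * bracket F (snd u)) \<delta> =
      eval_curve M g (Laurent F) \<delta>" for \<delta>
  proof -
    have "Laurent (X_mono (fst u) \<beta> (qcoeff g u \<beta>) * bracket F (snd u)) \<delta> =
        fls_const (qcoeff g u \<beta>) * fls_X_intpow (fst u) * Y_bracket M (Laurent F) (snd u) (\<delta> - \<beta>)"
      if "(u, \<beta>) \<in> qsupport g" for u \<beta>
      using support_weight_X[OF that] F by (simp add: Laurent_X_mono_mult Laurent_bracket)
    then show ?thesis
      by (auto simp: Laurent_sum eval_curve_eq[OF finite_qsupport order_refl] case_prod_beta
          intro!: sum.cong)
  qed
  have "Laurent (X_mono 1 0 1 * 1) \<delta> = fls_X * ser_const 1 \<delta>" for \<delta>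
    by (subst Laurent_X_mono_mult) (simp_all add: Laurent_1 fls_X_conv_shift_1)
  then have eq: "Laurent F \<delta> = ser_const (1 - fls_X) \<delta> - eval_curve M g (Laurent F) \<delta>" for \<delta>
    by (subst fixed[symmetric]) (simp add: wave_step_def Laurent_diff g Laurent_1 ser_const_def)
  then show "eval_curve M (1 - qX - qY - g) (Laurent F) = (\<lambda>_. 0)"
    using F by (intro ext) (simp add: eval_curve_leading Laurent_local)
  have "Y_bracket M (Laurent F) (snd u) (0 - \<beta>) = 0" if "(u, \<beta>) \<in> qsupport g" for u \<beta>
    using F support_deg[OF that]
    by (intro local_ser_eq_0) (simp_all add: Laurent_local bracket_X_series deg_diff[of 0, simplified] flip: Laurent_bracket)
  then have "eval_curve M g (Laurent F) 0 = 0"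
    by (auto simp: eval_curve_eq[OF finite_qsupport order_refl] intro!: sum.neutral)
  then show "Laurent F 0 = 1 - fls_X"
    by (subst eq) (simp add: ser_const_def)
qed


section \<open>Factorization of the curve and equality of the periods\<close>

text \<open>Evaluation of \<open>F\<close> at \<open>t = 1\<close> recovers \<open>x\<close>, and the powers of \<open>t\<close> record the weights.\<close>

definition homogenizes :: "qtorus fps \<Rightarrow> qtorus \<Rightarrow> bool" where
  "homogenizes F x \<longleftrightarrow> (\<forall>n u \<beta>. qcoeff (fps_nth F n) u \<beta> =
     (if int n = weight u \<beta> then qcoeff x u \<beta> else 0)) \<and> (\<forall>u \<beta>. qcoeff x u \<beta> \<noteq> 0 \<longrightarrow> weight u \<beta> \<ge> 0)"

lemma homogenizes_nth: "homogenizes F x \<Longrightarrow> qcoeff (fps_nth F n) u \<beta> =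
    (if int n = weight u \<beta> then qcoeff x u \<beta> else 0)"
  and homogenizes_weight: "homogenizes F x \<Longrightarrow> qcoeff x u \<beta> \<noteq> 0 \<Longrightarrow> weight u \<beta> \<ge> 0"
  unfolding homogenizes_def by blast+

lemma homogenizes_add: "homogenizes F x \<Longrightarrow> homogenizes G y \<Longrightarrow> homogenizes (F + G) (x + y)"
  unfolding homogenizes_def fps_add_nth qcoeff_simps by (metis add.right_neutral add.left_neutral)

lemma homogenizes_sum:
  "(\<And>s. s \<in> S \<Longrightarrow> homogenizes (F s) (x s)) \<Longrightarrow> homogenizes (\<Sum>s\<in>S. F s) (\<Sum>s\<in>S. x s)"
  by (induction S rule: infinite_finite_induct)
     (simp_all add: homogenizes_add, simp_all add: homogenizes_def)

lemma homogenizes_qmono: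
  "weight u \<beta> \<ge> 0 \<Longrightarrow> homogenizes (fps_X ^ nat (weight u \<beta>) * fps_const (qmono u \<beta> q)) (qmono u \<beta> q)"
  by (auto simp: homogenizes_def fps_X_power_mult_nth qcoeff_qmono)

text \<open>Each pair of monomials of \<open>x\<close> and \<open>y\<close> contributes to exactly one power of \<open>t\<close>, because weights add up.\<close>

lemma homogenizes_mult:
  assumes F: "homogenizes F x" and G: "homogenizes G y"
  shows "homogenizes (F * G) (x * y)"
proof -
  have sub: "qsupport (fps_nth F i) \<subseteq> qsupport x" for i
    by (auto simp: homogenizes_nth[OF F] qsupport_def split: if_splits)
  have "qcoeff (fps_nth (F * G) n) v \<gamma> = (if int n = weight v \<gamma> then qcoeff (x * y) v \<gamma> else 0)" for n v \<gamma>
  proof -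
    let ?q = "\<lambda>s. qhalf (2 * snd (fst s) * fst (v - fst s))"
    let ?l = "\<lambda>i s. ?q s * qcoeff (fps_nth F i) (fst s) (snd s) * qcoeff (fps_nth G (n - i)) (v - fst s) (\<gamma> - snd s)"
    let ?r = "\<lambda>s. ?q s * qcoeff x (fst s) (snd s) * qcoeff y (v - fst s) (\<gamma> - snd s)"
    have "(\<Sum>i=0..n. ?l i s) =
        (if int n = weight v \<gamma> then ?r s else 0)"
      for s
    proof (cases "qcoeff x (fst s) (snd s) \<noteq> 0 \<and> qcoeff y (v - fst s) (\<gamma> - snd s) \<noteq> 0")
      case False
      then have *: "qcoeff (fps_nth F i) (fst s) (snd s) * qcoeff (fps_nth G (n - i)) (v - fst s) (\<gamma> - snd s) = 0"
          and **: "qcoeff x (fst s) (snd s) * qcoeff y (v - fst s) (\<gamma> - snd s) = 0" for i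
        unfolding homogenizes_nth[OF F] homogenizes_nth[OF G] by auto
      show ?thesis
        by (simp only: mult.assoc * ** mult_zero_right sum.neutral_const if_cancel)
    next
      case True
      define k where "k = nat (weight (fst s) (snd s))"
      have w: "weight (fst s) (snd s) = int k" "weight (v - fst s) (\<gamma> - snd s) = weight v \<gamma> - int k"
        using True homogenizes_weight[OF F, of "fst s" "snd s"] by (simp_all add: k_def weight_diff)
      moreover have "weight (v - fst s) (\<gamma> - snd s) \<ge> 0"
        using True homogenizes_weight[OF G] by blast
      ultimately have k: "int k \<le> weight v \<gamma>"
        by simp
      have "(\<Sum>i=0..n. ?l i s) =
        (\<Sum>i=0..n. if i = k then (if int n = weight v \<gamma> then
           ?r s else 0) else 0)"
        using w by (intro sum.cong refl) (auto simp: homogenizes_nth[OF F] homogenizes_nth[OF G] of_nat_diff)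
      also have "\<dots> = (if int n = weight v \<gamma> then
           ?r s else 0)"
        using k by simp
      finally show ?thesis .
    qed
    then have "(\<Sum>s\<in>qsupport x. \<Sum>i=0..n. ?l i s) =
        (if int n = weight v \<gamma> then qcoeff (x * y) v \<gamma> else 0)"
      by (simp add: qcoeff_mult[OF finite_qsupport order_refl, of x] case_prod_beta)
    then show ?thesis
      by (simp add: fps_mult_nth qcoeff_sum qcoeff_mult[OF finite_qsupport sub] case_prod_beta
          sum.swap[of _ "qsupport x"])
  qed
  moreover have "weight v \<gamma> \<ge> 0" if nz: "qcoeff (x * y) v \<gamma> \<noteq> 0" for v \<gamma>
  proof -
    from nz obtain u \<beta> where "qcoeff x u \<beta> \<noteq> 0" "qcoeff y (v - u) (\<gamma> - \<beta>) \<noteq> 0"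
      by (rule qcoeff_mult_nonzero)
    then have "weight u \<beta> \<ge> 0" "weight (v - u) (\<gamma> - \<beta>) \<ge> 0"
      using F G unfolding homogenizes_def by blast+
    then show ?thesis
      by (simp add: weight_diff)
  qed
  ultimately show ?thesis
    by (simp add: homogenizes_def)
qed

lemma homogenizes_power: "homogenizes F x \<Longrightarrow> homogenizes (F ^ n) (x ^ n)"
proof (induction n)
  case 0
  show ?case
    by (auto simp: homogenizes_def qcoeff_one weight_def zero_prod_def)
qed (simp add: homogenizes_mult)

definition potential :: qtorus where
  "potential = qX + qY + g"

definition potential_series :: "qtorus fps" where
  "potential_series = X_mono 1 0 1 + fps_X * Y_pow 1 +
     (\<Sum>(u, \<beta>)\<in>qsupport g. fps_X ^ nat (weight u \<beta>) * fps_const (qmono u \<beta> (qcoeff g u \<beta>)))"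

lemma homogenizes_potential: "homogenizes potential_series potential"
proof -
  have "homogenizes (\<Sum>(u, \<beta>)\<in>qsupport g. fps_X ^ nat (weight u \<beta>) * fps_const (qmono u \<beta> (qcoeff g u \<beta>)))
      (\<Sum>(u, \<beta>)\<in>qsupport g. qmono u \<beta> (qcoeff g u \<beta>))"
  proof (rule homogenizes_sum, clarify)
    fix a b \<beta> assume "((a, b), \<beta>) \<in> qsupport g"
    then show "homogenizes (fps_X ^ nat (weight (a, b) \<beta>) * fps_const (qmono (a, b) \<beta> (qcoeff g (a, b) \<beta>)))
        (qmono (a, b) \<beta> (qcoeff g (a, b) \<beta>))"
      using support_weight[of "(a, b)" \<beta>] by (intro homogenizes_qmono) (simp add: weight_def)
  qed
  then have "homogenizes (\<Sum>(u, \<beta>)\<in>qsupport g. fps_X ^ nat (weight u \<beta>) * fps_const (qmono u \<beta> (qcoeff g u \<beta>))) g"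
    by (simp only: qtorus_decompose[OF finite_qsupport order_refl, of g, symmetric])
  moreover have "homogenizes (X_mono 1 0 1) qX" "homogenizes (fps_X * Y_pow 1) qY"
    using homogenizes_qmono[of "(1, 0)" 0 1] homogenizes_qmono[of "(0, 1)" 0 1]
    by (simp_all add: weight_def X_mono_def Y_pow_def qX_eq qY_eq)
  ultimately show ?thesis
    unfolding potential_def potential_series_def by (intro homogenizes_add)
qed

lemma potential_series_nth_0: "fps_nth potential_series 0 = 0"
proof (rule qtorus_eqI)
  fix u \<beta>
  have "qcoeff potential u \<beta> = 0" if "weight u \<beta> = 0"
  proof -
    have "qcoeff g u \<beta> = 0"
      using support_weight[of u \<beta>] that by (auto simp: qsupport_def weight_def)
    with that show ?thesis
      by (auto simp: potential_def qX_eq qY_eq qcoeff_qmono weight_def)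
  qed
  then show "qcoeff (fps_nth potential_series 0) u \<beta> = qcoeff 0 u \<beta>"
    by (auto simp: homogenizes_nth[OF homogenizes_potential])
qed

text \<open>The coefficient of \<open>z\<^sup>\<beta>\<close> in the constant term of \<open>log u\<close>. The monomial \<open>z\<^sup>\<beta>\<close> has weight
  \<open>c deg \<beta>\<close>, so only this power of \<open>t\<close> is considered.\<close>

definition period :: "qtorus fps \<Rightarrow> cls \<Rightarrow> qpoly" where
  "period u \<beta> = (if c * deg \<beta> < 0 then 0 else
     - (\<Sum>n=1..nat (c * deg \<beta>). qconst (1 / of_nat n) * qcoeff (fps_nth ((1 - u) ^ n) (nat (c * deg \<beta>))) 0 \<beta>))"

lemma lookup_qconst_mult: "Poly_Mapping.lookup (qconst a * x) k = a * Poly_Mapping.lookup x k"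
  by (simp add: qconst_def lookup_single_0_mult)

lemma Sum_any_uminus: "Sum_any (\<lambda>n. - f n) = - Sum_any f" for f :: "'i \<Rightarrow> 'r::ab_group_add"
  by (simp add: Sum_any.expand_set sum_negf)

lemma lookup_period:
  "Poly_Mapping.lookup (period u \<beta>) k = (if c * deg \<beta> < 0 then 0 else
     trace_functional.tr_log (\<lambda>x. Poly_Mapping.lookup (qcoeff x 0 \<beta>) k) u (nat (c * deg \<beta>)))"
  by (simp add: period_def trace_functional.tr_log_def[OF trace_qcoeff] lookup_sum lookup_minus lookup_qconst_mult)

lemma period_series:
  assumes h: "fps_nth h 0 = 0"
  shows "period (1 - h) \<beta> = - Sum_any (\<lambda>n::nat. if n = 0 then 0 else qconst (1 / of_nat n) *
    (if c * deg \<beta> < 0 then 0 else qcoeff (fps_nth (h ^ n) (nat (c * deg \<beta>))) 0 \<beta>))"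
proof (cases "c * deg \<beta> < 0")
  case True
  then show ?thesis
    by (simp add: period_def cong: if_cong)
next
  case False
  let ?f = "\<lambda>n::nat. if n = 0 then 0 else qconst (1 / of_nat n) *
    (if c * deg \<beta> < 0 then 0 else qcoeff (fps_nth (h ^ n) (nat (c * deg \<beta>))) 0 \<beta>)"
  have "?f n = 0" if "n \<notin> {1..nat (c * deg \<beta>)}" for n
    using that fps_power_nth_eq_0[OF h, of "nat (c * deg \<beta>)" n] by auto
  then have "{n. ?f n \<noteq> 0} \<subseteq> {1..nat (c * deg \<beta>)}"
    by blast
  then have "Sum_any ?f = (\<Sum>n=1..nat (c * deg \<beta>). ?f n)"
    by (intro Sum_any.expand_superset) simp_all
  with False show ?thesis
    by (simp add: period_def)
qed

lemma quantum_A_period_eq: "quantum_A_period (1 - potential) \<beta> = period (1 - potential_series) \<beta>"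
proof -
  have "qcoeff (potential ^ n) 0 \<beta> =
      (if c * deg \<beta> < 0 then 0 else qcoeff (fps_nth (potential_series ^ n) (nat (c * deg \<beta>))) 0 \<beta>)" for n
    using homogenizes_weight[OF homogenizes_power[OF homogenizes_potential], of n 0 \<beta>]
    by (cases "qcoeff (potential ^ n) 0 \<beta> = 0") (auto simp: homogenizes_nth[OF homogenizes_power[OF homogenizes_potential]] weight_def)
  then show ?thesis
    by (simp add: period_series[OF potential_series_nth_0] quantum_A_period_def Const_XY_qcoeff cong: if_cong)
qed

lemma Laurent_power:
  assumes "F \<in> X_series"
  shows "Laurent (F ^ n) = ser_power (Laurent F) n" and "F ^ n \<in> X_series"
proof (induction n)
  case (Suc n)
  have "ser_power (Laurent F) (Suc n) = ser_mult (Laurent F) (ser_power (Laurent F) n)"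
    by (simp add: ser_power_def)
  with Suc assms show "Laurent (F ^ Suc n) = ser_power (Laurent F) (Suc n)"
    by (simp add: Laurent_mult)
  show "F ^ Suc n \<in> X_series"
    using Suc assms by (simp add: X_series_mult)
qed (simp_all add: ser_power_def Laurent_1 X_series_1)

lemma Const_X_log_eq:
  assumes F: "F \<in> X_series" "fps_nth F 0 = 1"
  shows "Const_X (ser_log (Laurent F)) \<beta> = period F \<beta>"
proof -
  have "(\<lambda>\<gamma>. Laurent F \<gamma> - ser_const 1 \<gamma>) = Laurent (F - 1)"
    by (simp add: Laurent_diff Laurent_1 fun_eq_iff)
  then have pow: "ser_power (\<lambda>\<gamma>. Laurent F \<gamma> - ser_const 1 \<gamma>) n = Laurent ((F - 1) ^ n)" for n
    using Laurent_power(1)[OF X_series_diff[OF F(1) X_series_1]] by simp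
  have "Const_X (ser_log (Laurent F)) \<beta> = Sum_any (\<lambda>n::nat. if n = 0 then 0 else
      qconst ((- 1) ^ (n + 1) / of_nat n) * fls_nth (Laurent ((F - 1) ^ n) \<beta>) 0)"
    unfolding Const_X_def ser_log_def pow
    by (subst nth_Abs_fls_lower_bound[of "- c * deg \<beta>"]) (auto simp: Laurent_nth weight_def cong: if_cong)
  also have "\<dots> = Sum_any (\<lambda>n::nat. - (if n = 0 then 0 else qconst (1 / of_nat n) *
    (if c * deg \<beta> < 0 then 0 else qcoeff (fps_nth ((1 - F) ^ n) (nat (c * deg \<beta>))) 0 \<beta>)))"
  proof (rule arg_cong[where f = Sum_any], rule ext)
    fix n :: nat
    have "(F - 1) ^ n = (if even n then (1 - F) ^ n else - ((1 - F) ^ n))"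
      by (metis minus_diff_eq power_minus_even power_minus_odd)
    moreover have "qconst (- a) = - qconst a" for a
      by (simp add: qconst_def single_uminus)
    ultimately show "(if n = 0 then 0 else
        qconst ((- 1) ^ (n + 1) / of_nat n) * fls_nth (Laurent ((F - 1) ^ n) \<beta>) 0) =
      - (if n = 0 then 0 else qconst (1 / of_nat n) *
    (if c * deg \<beta> < 0 then 0 else qcoeff (fps_nth ((1 - F) ^ n) (nat (c * deg \<beta>))) 0 \<beta>))"
      by (simp add: Laurent_nth weight_def zero_prod_def)
  qed
  also have "\<dots> = period F \<beta>"
    using period_series[of "1 - F" \<beta>] F(2) by (simp add: Sum_any_uminus)
  finally show ?thesis .
qed

end

lemma fps_X_power_central: "a * (fps_X ^ k * b) = fps_X ^ k * (a * b)" for a b :: "'a::ring_1 fps"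
  by (metis mult.assoc fps_mult_fps_X_power_commute)

context quantum_curve
begin

text \<open>Division by \<open>L = Y(X) - Y\<close> from the right: modulo multiples of \<open>L\<close> the operator \<open>Y\<^sup>-\<^sup>n\<close> is
  multiplication with its eigenvalue on the wavefunction, and the quotient contains only negative
  powers of \<open>Y\<close>.\<close>

lemma divide_Y_power:
  assumes F: "F \<in> X_series" "fps_nth F 0 = 1"
  obtains K where "exponents_in {u. snd u < 0} K"
    and "Y_pow (- int n) = fps_X ^ n * bracket F (- int n) + K * (F - fps_X * Y_pow 1)"
proof -
  define L where "L = F - fps_X * Y_pow 1"
  define h where "h j = unit_inv (conj_Y (- int j) F)" for j :: nat
  have hX: "h j \<in> X_series" for j
    using F by (simp add: h_def X_series_unit_inv conj_Y_X_series conj_Y_nth_0)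
  have B: "bracket F (- int n) = prod_list (map h [1..<n + 1])" for n
    by (cases "n = 0") (simp_all add: bracket_def h_def[abs_def] del: upt_Suc)
  have bX: "prod_list (map h [1..<n + 1]) \<in> X_series" for n
    using hX by (auto intro!: X_series_prod_list simp del: upt_Suc)
  have "\<exists>K. exponents_in {u. snd u < 0} K \<and>
      Y_pow (- int n) = fps_X ^ n * prod_list (map h [1..<n + 1]) + K * L"
  proof (induction n)
    case 0
    show ?case
      by (rule exI[of _ 0]) (simp add: exponents_in_def)
  next
    case (Suc n)
    then obtain K where K: "exponents_in {u. snd u < 0} K"
      and eq: "Y_pow (- int n) = fps_X ^ n * prod_list (map h [1..<n + 1]) + K * L"
      by blast
    let ?m = "Suc n"
    \<comment> \<open>Both summands of \<open>L\<close> are multiplied with \<open>Y\<^sup>-\<^sup>m\<close>. Multiplication with the inverse \<open>h m\<close> of the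
      coefficient of \<open>Y\<^sup>-\<^sup>m\<close> then expresses \<open>Y\<^sup>-\<^sup>m\<close> through \<open>Y\<^sup>-\<^sup>n\<close> modulo multiples of \<open>L\<close>.\<close>
    have "Y_pow (- int ?m) * L = conj_Y (- int ?m) F * Y_pow (- int ?m) - fps_X * Y_pow (- int n)"
    proof -
      have "Y_pow (- int ?m) * (fps_X * Y_pow 1) = fps_X * (Y_pow (- int ?m) * Y_pow 1)"
        using fps_X_power_central[of _ 1] by simp
      then have "Y_pow (- int ?m) * (fps_X * Y_pow 1) = fps_X * Y_pow (- int n)"
        by (simp add: Y_pow_mult)
      then show ?thesis
        by (simp only: L_def right_diff_distrib conj_Y_commute[of _ F])
    qed
    then have "h ?m * (Y_pow (- int ?m) * L) =
        h ?m * conj_Y (- int ?m) F * Y_pow (- int ?m) - h ?m * fps_X * Y_pow (- int n)"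
      by (simp only: right_diff_distrib mult.assoc)
    moreover have "h ?m * conj_Y (- int ?m) F = 1"
      using F unfolding h_def by (intro unit_inv_left conj_Y_nth_0)
    ultimately have "h ?m * (Y_pow (- int ?m) * L) = Y_pow (- int ?m) - h ?m * fps_X * Y_pow (- int n)"
      by (simp only: mult_1_left)
    then have "Y_pow (- int ?m) = h ?m * fps_X * Y_pow (- int n) + h ?m * Y_pow (- int ?m) * L"
      by (simp only: mult.assoc) simp
    also have "h ?m * fps_X * Y_pow (- int n) =
        h ?m * fps_X * (fps_X ^ n * prod_list (map h [1..<n + 1])) + h ?m * fps_X * K * L"
      unfolding eq by (simp only: distrib_left mult.assoc)
    also have "h ?m * fps_X * (fps_X ^ n * prod_list (map h [1..<n + 1])) =
        fps_X ^ ?m * (h ?m * prod_list (map h [1..<n + 1]))"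
      using fps_X_power_central[of "h ?m" ?m] by (simp only: mult.assoc power_Suc)
    also have "h ?m * prod_list (map h [1..<n + 1]) = prod_list (map h [1..<n + 1]) * h ?m"
      by (rule X_series_commute[OF hX bX])
    also have "\<dots> = prod_list (map h [1..<?m + 1])"
      by simp
    finally have "Y_pow (- int ?m) = fps_X ^ ?m * prod_list (map h [1..<?m + 1]) +
        (h ?m * fps_X * K + h ?m * Y_pow (- int ?m)) * L"
      by (simp only: distrib_right add.assoc)
    moreover have "exponents_in {u. snd u < 0} (h ?m * fps_X * K + h ?m * Y_pow (- int ?m))"
    proof (rule exponents_in_add)
      have h: "exponents_in {u. snd u = 0} (h ?m)"
        by (rule exponents_in_X_series[OF hX])
      have "exponents_in {u. snd u < 0} (h ?m * (fps_X ^ 1 * K))"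
        by (rule exponents_in_mult[OF h exponents_in_fps_X_power[OF K]]) auto
      then show "exponents_in {u. snd u < 0} (h ?m * fps_X * K)"
        by (simp add: mult.assoc)
      show "exponents_in {u. snd u < 0} (h ?m * Y_pow (- int ?m))"
        unfolding Y_pow_def
        by (rule exponents_in_mult[OF h exponents_in_const_qmono[of _ "{u. snd u < 0}"]]) auto
    qed
    ultimately show ?case by blast
  qed
  with that show thesis
    by (auto simp: B L_def)
qed

text \<open>For \<open>b \<le> 0\<close> this multiplies the division of \<open>Y\<^sup>b\<close> with a series in \<open>X\<close>, and for \<open>b = 1\<close> it replaces
  \<open>t Y\<close> by \<open>F - L\<close>.\<close>

lemma divide_monomial:
  assumes F: "F \<in> X_series" "fps_nth F 0 = 1" and u: "(u, \<beta>) \<in> qsupport g"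
  obtains K where "exponents_in (if snd u = 1 then {v. snd v = 0 \<and> fst v < 0} else {v. snd v < 0}) K"
    and "fps_nth K 0 = 0" and "snd u = 1 \<Longrightarrow> K \<in> X_series"
    and "fps_X ^ nat (weight u \<beta>) * fps_const (qmono u \<beta> q) =
      X_mono (fst u) \<beta> q * bracket F (snd u) + K * (F - fps_X * Y_pow 1)"
proof -
  define L where "L = F - fps_X * Y_pow 1"
  define a where "a = fst u"
  have w: "weight u \<beta> \<ge> 1" "c * deg \<beta> + a \<ge> 1"
    using support_weight[OF u] support_weight_X[OF u] by (simp_all add: weight_def a_def)
  have split: "fps_const (qmono u \<beta> q) = fps_const (qmono (a, 0) \<beta> q) * Y_pow (snd u)"
    by (simp add: Y_pow_def qmono_mult a_def)
  show thesis
  proof (cases "snd u = 1")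
    case True
    have "nat (c * deg \<beta> + a) + 1 = nat (weight u \<beta>)"
      using w True by (simp add: weight_def a_def)
    then have "fps_X ^ nat (weight u \<beta>) * fps_const (qmono u \<beta> q) = X_mono a \<beta> q * (fps_X * Y_pow 1)"
      unfolding X_mono_def split True
      using fps_X_power_central[of "fps_const (qmono (a, 0) \<beta> q)" 1 "Y_pow 1"]
      by (simp add: mult.assoc power_Suc2 del: power_Suc flip: \<open>nat (c * deg \<beta> + a) + 1 = nat (weight u \<beta>)\<close>)
    also have "\<dots> = X_mono a \<beta> q * F + (- X_mono a \<beta> q) * L"
      by (simp add: L_def algebra_simps)
    also have "F = bracket F (snd u)"
      by (simp add: True bracket_def conj_Y_def)
    finally have "fps_X ^ nat (weight u \<beta>) * fps_const (qmono u \<beta> q) =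
        X_mono a \<beta> q * bracket F (snd u) + (- X_mono a \<beta> q) * L" .
    moreover have "exponents_in {v. snd v = 0 \<and> fst v < 0} (- X_mono a \<beta> q)"
      using support_XY[OF u True] unfolding X_mono_def
      by (intro exponents_in_uminus exponents_in_fps_X_power exponents_in_const_qmono) (simp add: a_def)
    moreover have "- X_mono a \<beta> q \<in> X_series" "fps_nth (- X_mono a \<beta> q) 0 = 0"
      using w support_M[OF u] support_deg[OF u]
      by (auto simp: X_mono_nth_0 intro!: X_series_uminus X_mono_X_series)
    ultimately show thesis
      using that[of "- X_mono a \<beta> q"] True by (simp add: a_def L_def)
  next
    case False
    define n where "n = nat (- snd u)"
    have n: "snd u = - int n"
      using False support_Y[OF u] by (simp add: n_def)
    obtain K where K: "exponents_in {u. snd u < 0} K"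
      and eq: "Y_pow (- int n) = fps_X ^ n * bracket F (- int n) + K * L"
      using divide_Y_power[OF F, of n] unfolding L_def by blast
    define K' where "K' = fps_X ^ nat (weight u \<beta>) * (fps_const (qmono (a, 0) \<beta> q) * K)"
    have "nat (weight u \<beta>) + n = nat (c * deg \<beta> + a)"
      using w n by (simp add: weight_def a_def)
    then have "X_mono a \<beta> q = fps_X ^ (nat (weight u \<beta>) + n) * fps_const (qmono (a, 0) \<beta> q)"
      by (simp add: X_mono_def)
    also have "\<dots> = fps_X ^ nat (weight u \<beta>) * (fps_X ^ n * fps_const (qmono (a, 0) \<beta> q))"
      by (simp only: power_add mult.assoc)
    also have "fps_X ^ n * fps_const (qmono (a, 0) \<beta> q) = fps_const (qmono (a, 0) \<beta> q) * fps_X ^ n"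
      by (rule fps_mult_fps_X_power_commute)
    finally have "fps_X ^ nat (weight u \<beta>) * fps_const (qmono u \<beta> q) = X_mono a \<beta> q * bracket F (snd u) + K' * L"
      unfolding split n eq K'_def by (simp add: distrib_left mult.assoc)
    moreover have "exponents_in {v. snd v < 0} K'"
      unfolding K'_def
      by (intro exponents_in_fps_X_power
          exponents_in_mult[OF exponents_in_const_qmono[of _ "{v. snd v = 0}"] K]) auto
    moreover have "fps_nth K' 0 = 0"
      using w by (simp add: K'_def fps_X_power_mult_nth)
    ultimately show thesis
      using that[of K'] False by (simp add: a_def L_def)
  qed
qed

text \<open>Division of all monomials by \<open>L = Y(X) - t Y\<close> leaves the remainder \<open>L\<close>, because \<open>Y(X)\<close> is a fixed
  point, so that \<open>p\<close> is a multiple \<open>(1 - \<Sum>K) L\<close>. The quotients \<open>K\<close> of the monomials with \<open>b = 1\<close> make up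
  \<open>T\<close>; the others, which contain only negative powers of \<open>Y\<close>, give \<open>R\<close> after division by \<open>1 - T\<close>.\<close>

lemma curve_factorization:
  assumes F: "F \<in> X_series" "fps_nth F 0 = 1" and fixed: "wave_step F = F"
  obtains T R S where
    "1 - potential_series = (1 - T) * ((1 - R) * ((1 - S) * F))"
    "exponents_in {u. snd u = 0 \<and> fst u < 0} T" "fps_nth T 0 = 0"
    "exponents_in {u. snd u < 0} R" "fps_nth R 0 = 0"
    "exponents_in {u. snd u > 0} S" "fps_nth S 0 = 0"
proof -
  define L where "L = F - fps_X * Y_pow 1"
  let ?mono = "\<lambda>s. fps_X ^ nat (weight (fst s) (snd s)) *
    fps_const (qmono (fst s) (snd s) (qcoeff g (fst s) (snd s)))"
  let ?rest = "\<lambda>s. X_mono (fst (fst s)) (snd s) (qcoeff g (fst s) (snd s)) * bracket F (snd (fst s))"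
  define quotient where "quotient s K \<longleftrightarrow>
      exponents_in (if snd (fst s) = 1 then {v. snd v = 0 \<and> fst v < 0} else {v. snd v < 0}) K
      \<and> fps_nth K 0 = 0 \<and> (snd (fst s) = 1 \<longrightarrow> K \<in> X_series) \<and> ?mono s = ?rest s + K * L" for s K
  have "\<forall>s\<in>qsupport g. \<exists>K. quotient s K"
  proof
    fix s assume s: "s \<in> qsupport g"
    obtain u \<beta> where u: "s = (u, \<beta>)"
      by (rule prod.exhaust)
    show "\<exists>K. quotient s K"
      by (rule divide_monomial[OF F s[unfolded u], of "qcoeff g u \<beta>"])
         (auto simp only: u fst_conv snd_conv quotient_def L_def)
  qed
  then obtain K where quot: "\<And>s. s \<in> qsupport g \<Longrightarrow> quotient s (K s)"
    using bchoice[of "qsupport g" quotient] by blast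
  have K: "exponents_in (if snd (fst s) = 1 then {v. snd v = 0 \<and> fst v < 0} else {v. snd v < 0}) (K s)"
    and K0: "fps_nth (K s) 0 = 0" and KX: "snd (fst s) = 1 \<Longrightarrow> K s \<in> X_series"
    and eq: "?mono s = ?rest s + K s * L" if "s \<in> qsupport g" for s
    using quot[OF that] unfolding quotient_def by blast+
  define A where "A = {s \<in> qsupport g. snd (fst s) = 1}"
  define B where "B = {s \<in> qsupport g. snd (fst s) \<noteq> 1}"
  define T where "T = (\<Sum>s\<in>A. K s)"
  define R where "R = unit_inv (1 - T) * (\<Sum>s\<in>B. K s)"
  define S where "S = fps_X * Y_pow 1 * unit_inv F"
  have fin: "finite (qsupport g)"
    by (rule finite_qsupport)
  have T: "exponents_in {u. snd u = 0 \<and> fst u < 0} T" "fps_nth T 0 = 0" "T \<in> X_series"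
  proof -
    have "exponents_in {u. snd u = 0 \<and> fst u < 0} (K s)" "fps_nth (K s) 0 = 0" "K s \<in> X_series"
      if "s \<in> A" for s
      using that K[of s] K0[of s] KX[of s] by (simp_all add: A_def)
    then show "exponents_in {u. snd u = 0 \<and> fst u < 0} T" "fps_nth T 0 = 0" "T \<in> X_series"
      unfolding T_def by (simp_all add: exponents_in_sum X_series_sum fps_sum_nth)
  qed
  then have T1: "1 - T \<in> X_series" "fps_nth (1 - T) 0 = 1"
    by (simp_all add: X_series_diff X_series_1)
  have KB: "exponents_in {u. snd u < 0} (\<Sum>s\<in>B. K s)" "fps_nth (\<Sum>s\<in>B. K s) 0 = 0"
  proof -
    have "exponents_in {u. snd u < 0} (K s)" "fps_nth (K s) 0 = 0" if "s \<in> B" for s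
      using that K[of s] K0[of s] by (simp_all add: B_def)
    then show "exponents_in {u. snd u < 0} (\<Sum>s\<in>B. K s)" "fps_nth (\<Sum>s\<in>B. K s) 0 = 0"
      by (simp_all add: exponents_in_sum fps_sum_nth)
  qed
  have R: "exponents_in {u. snd u < 0} R" "fps_nth R 0 = 0"
    unfolding R_def using T1 KB
    by (auto intro!: exponents_in_mult[OF exponents_in_X_series[OF X_series_unit_inv] KB(1)])
  have "exponents_in {u. snd u > 0} (Y_pow 1 * unit_inv F)"
    unfolding Y_pow_def
    using F by (intro exponents_in_mult[OF exponents_in_const_qmono[of _ "{u. snd u = 1}"]
        exponents_in_X_series[OF X_series_unit_inv]]) auto
  then have S: "exponents_in {u. snd u > 0} S" "fps_nth S 0 = 0"
    using exponents_in_fps_X_power[of _ _ 1] by (simp_all add: S_def mult.assoc)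
  have "(\<Sum>s\<in>qsupport g. K s) = T + (\<Sum>s\<in>B. K s)"
  proof -
    have "qsupport g = A \<union> B" "A \<inter> B = {}" "finite A" "finite B"
      using fin by (auto simp: A_def B_def)
    then show ?thesis
      unfolding T_def by (simp add: sum.union_disjoint)
  qed
  also have "(\<Sum>s\<in>B. K s) = (1 - T) * R"
    using T1 by (simp add: R_def unit_inv_right flip: mult.assoc)
  finally have sumK: "(\<Sum>s\<in>qsupport g. K s) = T + (1 - T) * R" .
  have "(\<Sum>s\<in>qsupport g. ?mono s) = (\<Sum>s\<in>qsupport g. ?rest s) + (T + (1 - T) * R) * L"
    unfolding sumK[symmetric] sum_distrib_right sum.distrib[symmetric] by (rule sum.cong[OF refl eq])
  then have "1 - potential_series = wave_step F - fps_X * Y_pow 1 - (T + (1 - T) * R) * L"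
    by (simp add: potential_series_def wave_step_def case_prod_beta)
  also have "\<dots> = L - (T + (1 - T) * R) * L"
    by (simp add: fixed L_def)
  also have "\<dots> = (1 - T) * ((1 - R) * L)"
    by (simp add: algebra_simps)
  also have "L = (1 - S) * F"
    using F by (simp add: L_def S_def left_diff_distrib mult.assoc unit_inv_left)
  finally show thesis
    using that T(1,2) R S by blast
qed

text \<open>Of the four factors of the curve only \<open>Y(X)\<close> contributes to the trace of the logarithm.\<close>

theorem periods_equal:
  assumes F: "F \<in> X_series" "fps_nth F 0 = 1" and fixed: "wave_step F = F"
  shows "quantum_A_period (1 - potential) = Const_X (ser_log (Laurent F))"
proof
  fix \<beta>
  obtain T R S where eq: "1 - potential_series = (1 - T) * ((1 - R) * ((1 - S) * F))"
    and T: "exponents_in {u. snd u = 0 \<and> fst u < 0} T" "fps_nth T 0 = 0"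
    and R: "exponents_in {u. snd u < 0} R" "fps_nth R 0 = 0"
    and S: "exponents_in {u. snd u > 0} S" "fps_nth S 0 = 0"
    using curve_factorization[OF assms] by blast
  have "period (1 - potential_series) \<beta> = period F \<beta>"
  proof (rule poly_mapping_eqI)
    fix k
    interpret trace_functional "\<lambda>x. Poly_Mapping.lookup (qcoeff x 0 \<beta>) k"
      by (rule trace_qcoeff)
    have "tr_log (1 - T) N = 0" "tr_log (1 - R) N = 0" "tr_log (1 - S) N = 0" for N
      by (rule tr_log_eq_0[OF T(1)] tr_log_eq_0[OF R(1)] tr_log_eq_0[OF S(1)]; simp)+
    then have "tr_log (1 - potential_series) N = tr_log F N" for N
      unfolding eq using F(2) T(2) R(2) S(2) by (simp add: tr_log_mult)
    then show "Poly_Mapping.lookup (period (1 - potential_series) \<beta>) k = Poly_Mapping.lookup (period F \<beta>) k"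
      by (simp add: lookup_period)
  qed
  then show "quantum_A_period (1 - potential) \<beta> = Const_X (ser_log (Laurent F)) \<beta>"
    by (simp add: quantum_A_period_eq Const_X_log_eq F)
qed

lemma quantum_A_period_M: "quantum_A_period (1 - potential) \<in> power_series M"
proof -
  have "\<beta> \<in> M" if "qcoeff (potential ^ n) u \<beta> \<noteq> 0" for n u \<beta>
    using that
  proof (induction n arbitrary: u \<beta>)
    case 0
    then show ?case
      by (auto simp: qcoeff_one zero_M split: if_splits)
  next
    case (Suc n)
    then obtain v \<gamma> where "qcoeff potential v \<gamma> \<noteq> 0" "qcoeff (potential ^ n) (u - v) (\<beta> - \<gamma>) \<noteq> 0"
      by (auto elim: qcoeff_mult_nonzero)
    then have "\<gamma> \<in> M" "\<beta> - \<gamma> \<in> M"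
      using support_M[of v \<gamma>] Suc.IH zero_M
      by (auto simp: potential_def qX_eq qY_eq qcoeff_qmono qsupport_def split: if_splits)
    then show ?case
      using add_M[of \<gamma> "\<beta> - \<gamma>"] by simp
  qed
  moreover have "quantum_A_period (1 - potential) \<beta> = 0" if "\<And>n. qcoeff (potential ^ n) 0 \<beta> = 0" for \<beta>
    using that by (simp add: quantum_A_period_def Const_XY_qcoeff cong: if_cong)
  ultimately show ?thesis
    unfolding power_series_def by blast
qed

end

section \<open>Effective classes\<close>

subsection \<open>Homogeneous forms\<close>

abbreviation form_poly :: "nat \<Rightarrow> (nat \<Rightarrow> nat \<Rightarrow> complex) \<Rightarrow> complex^3 \<Rightarrow> complex" where
  "form_poly d c v \<equiv> (\<Sum>i\<le>d. \<Sum>j\<le>d - i. c i j * (v $ 1) ^ i * (v $ 2) ^ j * (v $ 3) ^ (d - i - j))"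

lemma form_0 [simp]: "form d (\<lambda>_. 0)"
  unfolding form_def by (rule exI[of _ "\<lambda>_ _. 0"]) simp

lemma form_add: "form d F \<Longrightarrow> form d G \<Longrightarrow> form d (\<lambda>v. F v + G v)"
  unfolding form_def
proof (elim exE)
  fix c c'
  assume "\<forall>v. F v = form_poly d c v"
    "\<forall>v. G v = form_poly d c' v"
  then show "\<exists>c. \<forall>v. F v + G v =
      form_poly d c v"
    by (intro exI[of _ "\<lambda>i j. c i j + c' i j"]) (simp add: sum.distrib distrib_right)
qed

lemma form_sum: "(\<And>s. s \<in> S \<Longrightarrow> form d (F s)) \<Longrightarrow> form d (\<lambda>v. \<Sum>s\<in>S. F s v)"
  by (induction S rule: infinite_finite_induct) (simp_all add: form_add)

lemma form_monomial:
  assumes "i + j + k = d"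
  shows "form d (\<lambda>v. a * (v $ 1) ^ i * (v $ 2) ^ j * (v $ 3) ^ k)"
  unfolding form_def
proof (intro exI allI)
  fix v :: "complex^3"
  have "(if i' = i \<and> j' = j then a else 0) * (v $ 1) ^ i' * (v $ 2) ^ j' * (v $ 3) ^ (d - i' - j') =
      (if j' = j then if i' = i then a * (v $ 1) ^ i * (v $ 2) ^ j * (v $ 3) ^ (d - i - j) else 0 else 0)" for i' j'
    by simp
  then have "(\<Sum>i'\<le>d. \<Sum>j'\<le>d - i'. (if i' = i \<and> j' = j then a else 0) *
      (v $ 1) ^ i' * (v $ 2) ^ j' * (v $ 3) ^ (d - i' - j')) =
      (\<Sum>i'\<le>d. if i' = i then if j \<le> d - i then a * (v $ 1) ^ i * (v $ 2) ^ j * (v $ 3) ^ (d - i - j) else 0 else 0)"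
    by (intro sum.cong refl) simp
  also have "\<dots> = a * (v $ 1) ^ i * (v $ 2) ^ j * (v $ 3) ^ k"
    using assms by auto
  finally show "a * (v $ 1) ^ i * (v $ 2) ^ j * (v $ 3) ^ k = (\<Sum>i'\<le>d. \<Sum>j'\<le>d - i'.
      (if i' = i \<and> j' = j then a else 0) * (v $ 1) ^ i' * (v $ 2) ^ j' * (v $ 3) ^ (d - i' - j'))" ..
qed

lemma form_mult:
  assumes "form d F" "form e G"
  shows "form (d + e) (\<lambda>v. F v * G v)"
proof -
  obtain c where F: "\<And>v. F v = form_poly d c v"
    using assms(1) unfolding form_def by blast
  obtain c' where G: "\<And>v. G v = form_poly e c' v"
    using assms(2) unfolding form_def by blast
  have "form (d + e) (\<lambda>v. (c i j * (v $ 1) ^ i * (v $ 2) ^ j * (v $ 3) ^ (d - i - j)) *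
      (c' i' j' * (v $ 1) ^ i' * (v $ 2) ^ j' * (v $ 3) ^ (e - i' - j')))"
    if "i \<le> d" "j \<le> d - i" "i' \<le> e" "j' \<le> e - i'" for i j i' j'
  proof -
    have "form (d + e) (\<lambda>v. c i j * c' i' j' * (v $ 1) ^ (i + i') * (v $ 2) ^ (j + j') *
        (v $ 3) ^ (d - i - j + (e - i' - j')))"
      by (rule form_monomial) (use that in simp)
    then show ?thesis
      by (simp only: power_add mult_ac)
  qed
  then show ?thesis
    unfolding F G sum_product by (intro form_sum) auto
qed

lemma form_const: "form 0 (\<lambda>_. a)"
  using form_monomial[of 0 0 0 0 a] by simp

lemma form_scale: "form d F \<Longrightarrow> form d (\<lambda>v. a * F v)"
  using form_mult[OF form_const, of d F a] by simp

lemma form_power: "form 1 F \<Longrightarrow> form n (\<lambda>v. F v ^ n)"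
  by (induction n) (use form_const form_mult[of 1 F] in auto)

lemma form_coordinate: "form 1 (\<lambda>v :: complex^3. v $ k)"
  using form_monomial[of 1 0 0 1 1] form_monomial[of 0 1 0 1 1] form_monomial[of 0 0 1 1 1] exhaust_3[of k]
  by auto

lemma form_compose_linear:
  fixes T :: "complex^3 \<Rightarrow> complex^3"
  assumes "form d F" and "\<And>k. form 1 (\<lambda>y. T y $ k)"
  shows "form d (\<lambda>y. F (T y))"
proof -
  obtain c where F: "\<And>v. F v = form_poly d c v"
    using assms(1) unfolding form_def by blast
  have "form d (\<lambda>y. c i j * (T y $ 1) ^ i * (T y $ 2) ^ j * (T y $ 3) ^ (d - i - j))"
    if "i \<le> d" "j \<le> d - i" for i j
  proof -
    note pow = form_power[OF assms(2)]
    have "form (i + j + (d - i - j)) (\<lambda>y. c i j * (T y $ 1) ^ i * (T y $ 2) ^ j * (T y $ 3) ^ (d - i - j))"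
      by (rule form_mult[OF form_mult[OF form_scale[OF pow] pow] pow])
    with that show ?thesis by simp
  qed
  then show ?thesis
    unfolding F by (intro form_sum) auto
qed

lemma form_on_line:
  assumes "form d F"
  obtains h where "degree h \<le> d" "\<And>t. F (x + t *s v) = poly h t"
proof -
  obtain c where F: "\<And>v. F v = form_poly d c v"
    using assms unfolding form_def by blast
  let ?l = "\<lambda>k. [:x $ k, v $ k:]"
  define h where "h = (\<Sum>i\<le>d. \<Sum>j\<le>d - i. smult (c i j) (?l 1 ^ i * ?l 2 ^ j * ?l 3 ^ (d - i - j)))"
  have l: "degree (?l k ^ n) \<le> n" for k n
    by (rule order_trans[OF degree_power_le]) simp
  have "degree (smult (c i j) (?l 1 ^ i * ?l 2 ^ j * ?l 3 ^ (d - i - j))) \<le> d" if "i \<le> d" "j \<le> d - i" for i j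
  proof -
    have "degree (?l 1 ^ i * ?l 2 ^ j * ?l 3 ^ (d - i - j)) \<le> i + j + (d - i - j)"
      by (intro order_trans[OF degree_mult_le] add_mono l)
    also have "\<dots> = d"
      using that by simp
    finally show ?thesis
      using degree_smult_le order_trans by blast
  qed
  then have "degree h \<le> d"
    unfolding h_def by (intro degree_sum_le) auto
  moreover have "F (x + t *s v) = poly h t" for t
    by (simp add: F h_def poly_sum algebra_simps)
  ultimately show thesis by (rule that)
qed

lemma form_mult_nonzero:
  assumes F: "form d F" "F \<noteq> (\<lambda>_. 0)" and G: "form e G" "G \<noteq> (\<lambda>_. 0)"
  shows "(\<lambda>v. F v * G v) \<noteq> (\<lambda>_. 0)"
proof -
  obtain v w where v: "F v \<noteq> 0" and w: "G w \<noteq> 0"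
    using F(2) G(2) by blast
  obtain f where f: "\<And>t. F (v + t *s (w - v)) = poly f t"
    using form_on_line[OF F(1)] by blast
  obtain g where g: "\<And>t. G (v + t *s (w - v)) = poly g t"
    using form_on_line[OF G(1)] by blast
  have "f \<noteq> 0" "g \<noteq> 0"
    using f[of 0] g[of 1] v w by auto
  then have "f * g \<noteq> 0"
    by simp
  then obtain t where "poly (f * g) t \<noteq> 0"
    using poly_all_0_iff_0 by blast
  then have "F (v + t *s (w - v)) * G (v + t *s (w - v)) \<noteq> 0"
    by (simp only: f g poly_mult simp_thms)
  then show ?thesis by metis
qed

text \<open>Otherwise \<open>F\<close> would vanish on every line through the point, as its restriction has degree at most \<open>d\<close>.\<close>

lemma vanishing_order_le_degree:
  assumes F: "form d F" "F \<noteq> (\<lambda>_. 0)" and m: "vanishes_to_order m F x"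
  shows "m \<le> d"
proof (rule ccontr)
  assume "\<not> m \<le> d"
  have "F w = 0" for w
  proof -
    obtain h where h: "degree h \<le> d" "\<And>t. F (x + t *s (w - x)) = poly h t"
      using form_on_line[OF F(1)] by blast
    obtain k where k: "\<And>t. F (x + t *s (w - x)) = t ^ m * poly k t"
      using m unfolding vanishes_to_order_def by blast
    have "poly h t = poly (monom 1 m * k) t" for t
      using h(2)[of t] k[of t] by (simp add: poly_monom)
    then have eq: "h = monom 1 m * k"
      using poly_eq_poly_eq_iff by blast
    have "k = 0"
    proof (rule ccontr)
      assume "k \<noteq> 0"
      then have "degree h = m + degree k"
        unfolding eq by (subst degree_mult_eq) (simp_all add: degree_monom_eq)
      with h(1) \<open>\<not> m \<le> d\<close> show False by simp
    qed
    then show "F w = 0"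
      using k[of 1] by simp
  qed
  with F(2) show False by blast
qed

lemma vanishes_to_order_mult:
  assumes "vanishes_to_order m F x" "vanishes_to_order n G x" "k \<le> m + n"
  shows "vanishes_to_order k (\<lambda>v. F v * G v) x"
  unfolding vanishes_to_order_def
proof
  fix v
  obtain f g where "\<And>t. F (x + t *s v) = t ^ m * poly f t" "\<And>t. G (x + t *s v) = t ^ n * poly g t"
    using assms unfolding vanishes_to_order_def by metis
  then have "F (x + t *s v) * G (x + t *s v) = t ^ k * poly (monom 1 (m + n - k) * f * g) t" for t
    using assms(3) by (simp add: poly_monom flip: power_add mult.assoc)
  then show "\<exists>h. \<forall>t. F (x + t *s v) * G (x + t *s v) = t ^ k * poly h t" by blast
qed

subsection \<open>The monoid of effective classes\<close>

lemma NE_0: "0 \<in> NE P"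
proof (cases P)
  case (BlP2 ps)
  have "form 0 (\<lambda>_. 1)" "(\<lambda>_ :: complex^3. 1 :: complex) \<noteq> (\<lambda>_. 0)"
    "vanishes_to_order 0 (\<lambda>_. 1) x" for x
    by (auto simp: form_const vanishes_to_order_def fun_eq_iff intro: exI[of _ 1])
  then show ?thesis
    by (auto simp: BlP2 intro!: exI[of _ "\<lambda>_. 1"])
qed simp

lemma NE_subset_H2: "NE P \<subseteq> H2 P"
  by (cases P) auto

lemma H2_add: "\<beta> \<in> H2 P \<Longrightarrow> \<gamma> \<in> H2 P \<Longrightarrow> \<beta> + \<gamma> \<in> H2 P"
  using Poly_Mapping.keys_add[of \<beta> \<gamma>] by (cases P) auto

text \<open>The product of defining forms is a defining form for the sum of the classes.\<close>

lemma NE_add: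
  assumes \<beta>: "\<beta> \<in> NE P" and \<gamma>: "\<gamma> \<in> NE P"
  shows "\<beta> + \<gamma> \<in> NE P"
proof (cases P)
  case P1xP1
  then show ?thesis
    using assms H2_add[of \<beta> P1xP1 \<gamma>] by (auto simp: lookup_add)
next
  case (BlP2 ps)
  let ?a = "\<lambda>\<beta> i. Poly_Mapping.lookup \<beta> (Suc i)" and ?d = "\<lambda>\<beta>. Poly_Mapping.lookup \<beta> 0"
  obtain F where F: "?d \<beta> \<ge> 0" "form (nat (?d \<beta>)) F" "F \<noteq> (\<lambda>_. 0)"
      "\<And>i. i < length ps \<Longrightarrow> vanishes_to_order (nat (?a \<beta> i)) F (ps ! i)"
    using \<beta> by (auto simp: BlP2)
  obtain G where G: "?d \<gamma> \<ge> 0" "form (nat (?d \<gamma>)) G" "G \<noteq> (\<lambda>_. 0)"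
      "\<And>i. i < length ps \<Longrightarrow> vanishes_to_order (nat (?a \<gamma> i)) G (ps ! i)"
    using \<gamma> by (auto simp: BlP2)
  have "form (nat (?d (\<beta> + \<gamma>))) (\<lambda>v. F v * G v)"
    using form_mult[OF F(2) G(2)] F(1) G(1) by (simp add: lookup_add nat_add_distrib)
  moreover have "vanishes_to_order (nat (?a (\<beta> + \<gamma>) i)) (\<lambda>v. F v * G v) (ps ! i)" if "i < length ps" for i
    by (rule vanishes_to_order_mult[OF F(4)[OF that] G(4)[OF that]]) (simp add: lookup_add)
  moreover have "\<beta> + \<gamma> \<in> H2 P"
    using assms NE_subset_H2 by (blast intro: H2_add)
  ultimately show ?thesis
    using F(1) G(1) form_mult_nonzero[OF F(2,3) G(2,3)] by (auto simp: BlP2 lookup_add)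
qed

lemma finite_bounded_classes:
  assumes "finite A"
  shows "finite {\<beta> :: cls. Poly_Mapping.keys \<beta> \<subseteq> A \<and> (\<forall>i\<in>A. Poly_Mapping.lookup \<beta> i \<in> {l i..u i})}"
    (is "finite ?S")
proof (rule inj_on_finite)
  show "inj_on (\<lambda>\<beta>. restrict (Poly_Mapping.lookup \<beta>) A) ?S"
  proof (rule inj_onI)
    fix \<beta> \<gamma> assume "\<beta> \<in> ?S" "\<gamma> \<in> ?S" and eq: "restrict (Poly_Mapping.lookup \<beta>) A = restrict (Poly_Mapping.lookup \<gamma>) A"
    then have keys: "Poly_Mapping.keys \<beta> \<subseteq> A" "Poly_Mapping.keys \<gamma> \<subseteq> A"
      by auto
    show "\<beta> = \<gamma>"
    proof (rule poly_mapping_eqI)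
      fix i
      show "Poly_Mapping.lookup \<beta> i = Poly_Mapping.lookup \<gamma> i"
        using keys fun_cong[OF eq, of i] by (cases "i \<in> A") (simp, metis in_keys_iff subsetD)
    qed
  qed
  show "(\<lambda>\<beta>. restrict (Poly_Mapping.lookup \<beta>) A) ` ?S \<subseteq> (\<Pi>\<^sub>E i\<in>A. {l i..u i})"
    by auto
  show "finite (\<Pi>\<^sub>E i\<in>A. {l i..u i})"
    using assms by (intro finite_PiE) auto
qed

text \<open>The multiplicities of a nonzero form are at most its degree. Applied to both summands, this bounds all
  coordinates.\<close>

lemma finite_NE_splits: "finite {\<beta> \<in> NE P. \<delta> - \<beta> \<in> NE P}"
proof (cases P)
  case P1xP1
  have "{\<beta> \<in> NE P. \<delta> - \<beta> \<in> NE P} \<subseteq>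
      {\<beta>. Poly_Mapping.keys \<beta> \<subseteq> {0, 1} \<and> (\<forall>i\<in>{0, 1}. Poly_Mapping.lookup \<beta> i \<in> {0..Poly_Mapping.lookup \<delta> i})}"
    by (auto simp: P1xP1 lookup_minus)
  then show ?thesis
    by (rule finite_subset) (rule finite_bounded_classes, simp)
next
  case (BlP2 ps)
  let ?d = "Poly_Mapping.lookup \<delta>"
  have le: "Poly_Mapping.lookup \<beta> i \<le> Poly_Mapping.lookup \<beta> 0" "Poly_Mapping.lookup \<beta> 0 \<ge> 0"
    if "\<beta> \<in> NE P" "i \<le> length ps" for \<beta> i
  proof -
    show "Poly_Mapping.lookup \<beta> 0 \<ge> 0"
      using that by (simp add: BlP2)
    show "Poly_Mapping.lookup \<beta> i \<le> Poly_Mapping.lookup \<beta> 0"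
    proof (cases i)
      case (Suc j)
      with that obtain F where "form (nat (Poly_Mapping.lookup \<beta> 0)) F" "F \<noteq> (\<lambda>_. 0)"
          "vanishes_to_order (nat (Poly_Mapping.lookup \<beta> i)) F (ps ! j)"
        by (auto simp: BlP2 Suc_le_eq)
      then have "nat (Poly_Mapping.lookup \<beta> i) \<le> nat (Poly_Mapping.lookup \<beta> 0)"
        by (rule vanishing_order_le_degree)
      with \<open>Poly_Mapping.lookup \<beta> 0 \<ge> 0\<close> show ?thesis by simp
    qed simp
  qed
  have "{\<beta> \<in> NE P. \<delta> - \<beta> \<in> NE P} \<subseteq> {\<beta>. Poly_Mapping.keys \<beta> \<subseteq> {..length ps} \<and>
      (\<forall>i\<in>{..length ps}. Poly_Mapping.lookup \<beta> i \<in> {?d i - ?d 0..?d 0})}"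
  proof clarify
    fix \<beta> assume \<beta>: "\<beta> \<in> NE P" "\<delta> - \<beta> \<in> NE P"
    have "Poly_Mapping.lookup \<beta> i \<in> {?d i - ?d 0..?d 0}" if "i \<le> length ps" for i
      using le[OF \<beta>(1) that] le[OF \<beta>(2) that] by (simp add: lookup_minus)
    moreover have "Poly_Mapping.keys \<beta> \<subseteq> {..length ps}"
      using \<beta>(1) by (simp add: BlP2)
    ultimately show "Poly_Mapping.keys \<beta> \<subseteq> {..length ps} \<and>
      (\<forall>i\<in>{..length ps}. Poly_Mapping.lookup \<beta> i \<in> {?d i - ?d 0..?d 0})" by simp
  qed
  then show ?thesis
    by (rule finite_subset) (rule finite_bounded_classes, simp)
qed

lemma inter_add: "inter P (\<beta> + \<gamma>) \<eta> = inter P \<beta> \<eta> + inter P \<gamma> \<eta>"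
  and inter_commute: "inter P \<beta> \<gamma> = inter P \<gamma> \<beta>"
  by (cases P; simp add: lookup_add algebra_simps sum.distrib)+

lemma cls_deg_add: "cls_deg P (\<beta> + \<gamma>) = cls_deg P \<beta> + cls_deg P \<gamma>"
  by (simp add: cls_deg_def inter_add)

subsection \<open>Existence of curves by a dimension count\<close>

text \<open>A homogeneous linear system with fewer equations than unknowns, by elimination of one unknown \<open>p\<close> with the
  help of one equation \<open>e\<close>.\<close>

lemma homogeneous_system_solution:
  fixes A :: "'e \<Rightarrow> 'u \<Rightarrow> 'k::field"
  assumes "finite E" "finite U" "card E < card U"
  shows "\<exists>x. (\<exists>u\<in>U. x u \<noteq> 0) \<and> (\<forall>e\<in>E. (\<Sum>u\<in>U. A e u * x u) = 0)"
  using assms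
proof (induction E arbitrary: U A rule: finite_induct)
  case empty
  then have "U \<noteq> {}" by auto
  then show ?case by (intro exI[of _ "\<lambda>_. 1"]) auto
next
  case (insert e E)
  show ?case
  proof (cases "\<forall>u\<in>U. A e u = 0")
    case True
    then show ?thesis
      using insert.IH[of U A] insert by auto
  next
    case False
    then obtain p where p: "p \<in> U" "A e p \<noteq> 0" by blast
    define B where "B e' u = A e' u - A e' p / A e p * A e u" for e' u
    have "card E < card (U - {p})"
      using insert p by simp
    then obtain x where x: "\<exists>u\<in>U - {p}. x u \<noteq> 0" "\<And>e'. e' \<in> E \<Longrightarrow> (\<Sum>u\<in>U - {p}. B e' u * x u) = 0"
      using insert.IH[of "U - {p}" B] insert.prems by auto
    define s where "s = (\<Sum>u\<in>U - {p}. A e u * x u)"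
    define y where "y = x(p := - s / A e p)"
    have sum_y: "(\<Sum>u\<in>U. A e' u * y u) = A e' p * (- s / A e p) + (\<Sum>u\<in>U - {p}. A e' u * x u)" for e'
      using p insert.prems by (subst sum.remove[of U p]) (auto simp: y_def intro!: sum.cong)
    have "(\<Sum>u\<in>U. A e' u * y u) = 0" if "e' \<in> insert e E" for e'
    proof (cases "e' = e")
      case True
      then show ?thesis
        using p by (simp add: sum_y s_def)
    next
      case False
      then have "0 = (\<Sum>u\<in>U - {p}. B e' u * x u)"
        using that x(2) by simp
      also have "\<dots> = (\<Sum>u\<in>U - {p}. A e' u * x u) - A e' p / A e p * s"
        by (simp add: B_def s_def left_diff_distrib sum_subtractf sum_distrib_left mult.assoc)
      finally show ?thesis
        by (simp add: sum_y)
    qed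
    moreover have "\<exists>u\<in>U. y u \<noteq> 0"
      using x(1) by (auto simp: y_def)
    ultimately show ?thesis by blast
  qed
qed

text \<open>The exponents of the monomials of degree less than \<open>m\<close> in two variables. For \<open>m = d + 1\<close> they also
  index the coefficients of the forms of degree \<open>d\<close> in three variables.\<close>

definition low_exponents :: "nat \<Rightarrow> (nat \<times> nat) set" where
  "low_exponents m = (SIGMA i:{..<m}. {..<m - i})"

lemma finite_low_exponents [simp]: "finite (low_exponents m)"
  by (simp add: low_exponents_def)

lemma card_low_exponents: "2 * card (low_exponents m) = m * (m + 1)"
proof -
  have "2 * (\<Sum>i<m. m - i) = m * (m + 1)"
  proof (induction m)
    case (Suc m)
    have "(\<Sum>i<Suc m. Suc m - i) = Suc m + (\<Sum>i<m. m - i)"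
      by (simp only: sum.lessThan_Suc_shift) simp
    with Suc show ?case by simp
  qed simp
  then show ?thesis
    by (simp add: low_exponents_def)
qed

definition form_of :: "nat \<Rightarrow> (nat \<times> nat \<Rightarrow> complex) \<Rightarrow> complex^3 \<Rightarrow> complex" where
  "form_of d c v = (\<Sum>(i, j)\<in>low_exponents (d + 1). c (i, j) * (v $ 1) ^ i * (v $ 2) ^ j * (v $ 3) ^ (d - i - j))"

lemma form_of_eq:
  "form_of d c v = (\<Sum>i\<le>d. \<Sum>j\<le>d - i. c (i, j) * (v $ 1) ^ i * (v $ 2) ^ j * (v $ 3) ^ (d - i - j))"
proof -
  have "low_exponents (d + 1) = (SIGMA i:{..d}. {..d - i})"
    by (auto simp: low_exponents_def)
  then show ?thesis
    by (simp add: form_of_def sum.Sigma)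
qed

lemma form_iff_form_of: "form d F \<longleftrightarrow> (\<exists>c. F = form_of d c)"
proof
  assume "form d F"
  then obtain c where "\<And>v. F v = form_poly d c v"
    unfolding form_def by blast
  then have "F = form_of d (\<lambda>(i, j). c i j)"
    by (simp add: form_of_eq fun_eq_iff)
  then show "\<exists>c. F = form_of d c" by blast
next
  assume "\<exists>c. F = form_of d c"
  then obtain c where "F = form_of d c" by blast
  then show "form d F"
    unfolding form_def by (intro exI[of _ "\<lambda>i j. c (i, j)"]) (simp add: form_of_eq)
qed

lemma form_of_nonzero:
  assumes "s \<in> low_exponents (d + 1)" "c s \<noteq> 0"
  shows "form_of d c \<noteq> (\<lambda>_. 0)"
proof
  assume zero: "form_of d c = (\<lambda>_. 0)"
  have "(\<Sum>i\<le>d. (\<Sum>j\<le>d - i. c (i, j) * y ^ j) * x ^ i) = 0" for x y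
    using fun_cong[OF zero, of "vector [x, y, 1]"] by (simp add: form_of_eq sum_distrib_left sum_distrib_right mult_ac)
  then have "(\<Sum>j\<le>d - i. c (i, j) * y ^ j) = 0" if "i \<le> d" for i y
    using that polyfun_eq_0[of "\<lambda>i. \<Sum>j\<le>d - i. c (i, j) * y ^ j" d] by blast
  then have "c (i, j) = 0" if "i \<le> d" "j \<le> d - i" for i j
    using that polyfun_eq_0[of "\<lambda>j. c (i, j)" "d - i"] by blast
  with assms show False
    by (auto simp: low_exponents_def)
qed

text \<open>A point of multiplicity \<open>m\<close> imposes \<open>m (m + 1) / 2\<close> linear conditions. In coordinates \<open>y\<close> with
  \<open>y\<^sub>1 = y\<^sub>2 = 0\<close> at the point they say that monomials of degree less than \<open>m\<close> in \<open>y\<^sub>1, y\<^sub>2\<close> do not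
  occur.\<close>

lemma vanishing_conditions:
  assumes "x \<noteq> 0"
  obtains \<Lambda> :: "nat \<times> nat \<Rightarrow> nat \<times> nat \<Rightarrow> complex"
  where "\<And>c. (\<And>e. e \<in> low_exponents m \<Longrightarrow> (\<Sum>s\<in>low_exponents (d + 1). \<Lambda> e s * c s) = 0) \<Longrightarrow>
    vanishes_to_order m (form_of d c) x"
proof -
  \<comment> \<open>The point and the coordinate axes other than one on which it has a nonzero coordinate form a basis.\<close>
  have basis: "\<exists>e f. \<forall>v :: complex^3. \<exists>\<alpha> \<beta> \<gamma>. v = \<alpha> *s x + \<beta> *s e + \<gamma> *s f"
    if k: "x $ k \<noteq> 0" and ijk: "i \<noteq> j" "i \<noteq> k" "j \<noteq> k" "\<And>l. l = i \<or> l = j \<or> l = k" for i j k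
  proof -
    have "v = (v $ k / x $ k) *s x + (v $ i - v $ k / x $ k * x $ i) *s axis i 1
        + (v $ j - v $ k / x $ k * x $ j) *s axis j 1" for v :: "complex^3"
      unfolding vec_eq_iff
    proof
      fix l
      show "v $ l = ((v $ k / x $ k) *s x + (v $ i - v $ k / x $ k * x $ i) *s axis i 1
          + (v $ j - v $ k / x $ k * x $ j) *s axis j 1) $ l"
        using k ijk(1-3) ijk(4)[of l] by (auto simp: axis_def)
    qed
    then show ?thesis by blast
  qed
  have "\<exists>k. x $ k \<noteq> 0"
    using assms by (simp add: vec_eq_iff)
  then consider "x $ 1 \<noteq> 0" | "x $ 2 \<noteq> 0" | "x $ 3 \<noteq> 0"
    by (metis exhaust_3)
  then have "\<exists>e f. \<forall>v :: complex^3. \<exists>\<alpha> \<beta> \<gamma>. v = \<alpha> *s x + \<beta> *s e + \<gamma> *s f"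
    by cases (rule basis[of 1 2 3] basis[of 2 1 3] basis[of 3 1 2]; use exhaust_3 in force)+
  then obtain e f where span: "\<And>v :: complex^3. \<exists>\<alpha> \<beta> \<gamma>. v = \<alpha> *s x + \<beta> *s e + \<gamma> *s f"
    by blast
  define T :: "complex^3 \<Rightarrow> complex^3" where "T y = y $ 1 *s e + y $ 2 *s f + y $ 3 *s x" for y
  have T: "form 1 (\<lambda>y. T y $ k)" for k
  proof -
    have "form 1 (\<lambda>y. e $ k * y $ 1 + f $ k * y $ 2 + x $ k * y $ 3)"
      by (intro form_add form_scale form_coordinate)
    then show ?thesis
      by (simp add: T_def mult.commute)
  qed
  define mono where "mono s v = (v $ 1) ^ fst s * (v $ 2) ^ snd s * (v $ 3) ^ (d - fst s - snd s)"
    for s :: "nat \<times> nat" and v :: "complex^3"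
  have "\<exists>B. \<forall>y. mono s (T y) = form_of d B y" if "s \<in> low_exponents (d + 1)" for s
  proof -
    have "fst s + snd s + (d - fst s - snd s) = d"
      using that by (auto simp: low_exponents_def)
    then have "form d (mono s)"
      using form_monomial[of "fst s" "snd s" "d - fst s - snd s" d 1] by (simp add: mono_def[abs_def])
    then have "form d (\<lambda>y. mono s (T y))"
      using T by (rule form_compose_linear)
    then show ?thesis
      unfolding form_iff_form_of by metis
  qed
  then obtain B where B: "\<And>s y. s \<in> low_exponents (d + 1) \<Longrightarrow> mono s (T y) = form_of d (B s) y"
    by metis
  show thesis
  proof (rule that[of "\<lambda>e s. B s e"])
    fix c assume c: "\<And>e. e \<in> low_exponents m \<Longrightarrow> (\<Sum>s\<in>low_exponents (d + 1). B s e * c s) = 0"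
    define C where "C e = (\<Sum>s\<in>low_exponents (d + 1). B s e * c s)" for e
    have comp: "form_of d c (T y) = (\<Sum>e\<in>low_exponents (d + 1). C e * mono e y)" for y
    proof -
      have "form_of d c (T y) = (\<Sum>s\<in>low_exponents (d + 1). c s * mono s (T y))"
        by (simp add: form_of_def mono_def case_prod_beta mult.assoc)
      also have "\<dots> = (\<Sum>s\<in>low_exponents (d + 1). \<Sum>e\<in>low_exponents (d + 1). B s e * c s * mono e y)"
      proof (rule sum.cong[OF refl])
        fix s assume "s \<in> low_exponents (d + 1)"
        then have "mono s (T y) = (\<Sum>e\<in>low_exponents (d + 1). B s e * mono e y)"
          by (simp only: B form_of_def) (simp add: mono_def case_prod_beta mult.assoc)
        then show "c s * mono s (T y) = (\<Sum>e\<in>low_exponents (d + 1). B s e * c s * mono e y)"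
          by (simp add: sum_distrib_left mult_ac)
      qed
      also have "\<dots> = (\<Sum>e\<in>low_exponents (d + 1). \<Sum>s\<in>low_exponents (d + 1). B s e * c s * mono e y)"
        by (rule sum.swap)
      finally show ?thesis
        by (simp add: C_def sum_distrib_right)
    qed
    show "vanishes_to_order m (form_of d c) x"
      unfolding vanishes_to_order_def
    proof
      fix v
      obtain \<alpha> \<beta> \<gamma> where v: "v = \<alpha> *s x + \<beta> *s e + \<gamma> *s f"
        using span by blast
      define h where "h s = (if s \<in> low_exponents m then 0
        else smult (C s * \<beta> ^ fst s * \<gamma> ^ snd s)
          (monom 1 (fst s + snd s - m) * [:1, \<alpha>:] ^ (d - fst s - snd s)))" for s
      define g where "g = (\<Sum>s\<in>low_exponents (d + 1). h s)"
      have "form_of d c (x + t *s v) = t ^ m * poly g t" for t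
      proof -
        have "x + t *s v = T (vector [t * \<beta>, t * \<gamma>, 1 + t * \<alpha>])"
          by (simp add: v T_def vec_eq_iff algebra_simps)
        then have "form_of d c (x + t *s v) = (\<Sum>s\<in>low_exponents (d + 1).
            C s * ((t * \<beta>) ^ fst s * (t * \<gamma>) ^ snd s * (1 + t * \<alpha>) ^ (d - fst s - snd s)))"
          by (simp add: comp mono_def)
        also have "\<dots> = (\<Sum>s\<in>low_exponents (d + 1). t ^ m * poly (h s) t)"
        proof (rule sum.cong[OF refl])
          fix s :: "nat \<times> nat"
          show "C s * ((t * \<beta>) ^ fst s * (t * \<gamma>) ^ snd s * (1 + t * \<alpha>) ^ (d - fst s - snd s)) =
            t ^ m * poly (h s) t"
          proof (cases "s \<in> low_exponents m")
            case True
            then show ?thesis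
              using c by (simp add: C_def h_def)
          next
            case False
            then have "m \<le> fst s + snd s"
              by (cases s) (auto simp: low_exponents_def)
            then have "t ^ fst s * t ^ snd s = t ^ m * t ^ (fst s + snd s - m)"
              by (simp flip: power_add)
            then show ?thesis
              using False by (simp add: h_def poly_monom power_mult_distrib algebra_simps)
          qed
        qed
        finally show ?thesis
          by (simp add: g_def poly_sum sum_distrib_left)
      qed
      then show "\<exists>g. \<forall>t. form_of d c (x + t *s v) = t ^ m * poly g t" by blast
    qed
  qed
qed

lemma form_with_multiplicities:
  fixes n :: nat and p :: "nat \<Rightarrow> complex^3"
  assumes pts: "\<And>i. i < n \<Longrightarrow> p i \<noteq> 0" and count: "(\<Sum>i<n. m i * (m i + 1)) < (d + 1) * (d + 2)"
  obtains F where "form d F" "F \<noteq> (\<lambda>_. 0)" "\<And>i. i < n \<Longrightarrow> vanishes_to_order (m i) F (p i)"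
proof -
  have "\<exists>\<Lambda>. \<forall>c. (\<forall>e\<in>low_exponents (m i). (\<Sum>s\<in>low_exponents (d + 1). \<Lambda> e s * c s) = 0) \<longrightarrow>
      vanishes_to_order (m i) (form_of d c) (p i)" if "i < n" for i
    using vanishing_conditions[OF pts[OF that], of "m i" d] by metis
  then obtain \<Lambda> where \<Lambda>: "\<And>i c. i < n \<Longrightarrow>
      (\<forall>e\<in>low_exponents (m i). (\<Sum>s\<in>low_exponents (d + 1). \<Lambda> i e s * c s) = 0) \<Longrightarrow>
      vanishes_to_order (m i) (form_of d c) (p i)"
    by metis
  let ?E = "SIGMA i:{..<n}. low_exponents (m i)"
  have "2 * card ?E = (\<Sum>i<n. m i * (m i + 1))"
  proof -
    have "card ?E = (\<Sum>i<n. card (low_exponents (m i)))"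
      by (rule card_SigmaI) auto
    then show ?thesis
      by (simp only: sum_distrib_left card_low_exponents)
  qed
  moreover have "2 * card (low_exponents (d + 1)) = (d + 1) * (d + 2)"
    using card_low_exponents[of "d + 1"] by simp
  ultimately have "card ?E < card (low_exponents (d + 1))"
    using count by linarith
  then obtain c where c: "\<exists>s\<in>low_exponents (d + 1). c s \<noteq> 0"
      "\<And>i e. i < n \<Longrightarrow> e \<in> low_exponents (m i) \<Longrightarrow> (\<Sum>s\<in>low_exponents (d + 1). \<Lambda> i e s * c s) = 0"
    using homogeneous_system_solution[of ?E "low_exponents (d + 1)" "\<lambda>(i, e) s. \<Lambda> i e s"] by force
  show thesis
  proof (rule that[of "form_of d c"])
    show "form d (form_of d c)"
      unfolding form_iff_form_of by blast
    show "form_of d c \<noteq> (\<lambda>_. 0)"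
      using c(1) form_of_nonzero by blast
    show "vanishes_to_order (m i) (form_of d c) (p i)" if "i < n" for i
      using \<Lambda>[OF that] c(2)[OF that] by blast
  qed
qed

text \<open>By the theorem of Riemann and Roch a class \<open>\<beta>\<close> with \<open>\<beta>\<^sup>2 + deg \<beta> \<ge> 0\<close> or its Serre dual
  \<open>- E - \<beta>\<close> is effective; positive degree excludes the latter. For the line bundle of a class on a blow-up
  this is a count of the conditions on forms. That their degree is not negative follows
  from the inequality of Cauchy and Schwarz, as there are at most six points.\<close>

lemma effective_by_dimension:
  assumes P: "very_ample_anticanonical P" and \<beta>: "\<beta> \<in> H2 P"
    and deg: "cls_deg P \<beta> \<ge> 1" and square: "inter P \<beta> \<beta> + cls_deg P \<beta> \<ge> 0"
  shows "\<beta> \<in> NE P"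
proof (cases P)
  case P1xP1
  let ?x = "Poly_Mapping.lookup \<beta> 0" and ?y = "Poly_Mapping.lookup \<beta> 1"
  have "Poly_Mapping.lookup (anticanonical P1xP1) 0 = 2" "Poly_Mapping.lookup (anticanonical P1xP1) 1 = 2"
    by (simp_all add: lookup_add lookup_single del: single_numeral)
  then have "2 * ?x + 2 * ?y \<ge> 1" "2 * ?x * ?y + 2 * ?x + 2 * ?y \<ge> 0"
    using deg square by (simp_all add: P1xP1 cls_deg_def algebra_simps del: anticanonical.simps)
  then have "?x + ?y \<ge> 1" "(?x + 1) * (?y + 1) \<ge> 1"
    by (simp_all add: algebra_simps)
  then have "?x \<ge> 0 \<and> ?y \<ge> 0"
    by (smt (verit) mult_nonneg_nonpos mult_nonneg_nonpos2)
  then show ?thesis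
    using \<beta> by (simp add: P1xP1)
next
  case (BlP2 ps)
  define n where "n = length ps"
  define d where "d = Poly_Mapping.lookup \<beta> 0"
  define a where "a i = Poly_Mapping.lookup \<beta> (Suc i)" for i
  define S1 where "S1 = (\<Sum>i<n. a i)"
  define S2 where "S2 = (\<Sum>i<n. a i * a i)"
  have E: "Poly_Mapping.lookup (anticanonical P) (Suc i) = 1" if "i < n" for i
    using that by (simp add: BlP2 n_def lookup_add lookup_sum lookup_single when_def del: single_numeral)
  moreover have "Poly_Mapping.lookup (anticanonical P) 0 = 3"
    by (simp add: BlP2 lookup_add lookup_sum lookup_single del: single_numeral)
  ultimately have "cls_deg P \<beta> = 3 * d - S1"
    by (simp add: BlP2 cls_deg_def d_def S1_def a_def n_def del: anticanonical.simps)
  moreover have "inter P \<beta> \<beta> = d * d - S2"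
    by (simp add: BlP2 d_def S2_def a_def n_def)
  ultimately have deg': "3 * d - S1 \<ge> 1" and sq': "d * d - S2 + 3 * d - S1 \<ge> 0"
    using deg square by simp_all
  have n6: "n \<le> 6" and pts: "\<And>i. i < n \<Longrightarrow> ps ! i \<noteq> 0"
    using P by (simp_all add: BlP2 n_def general_position_def)
  have "S1 * S1 \<le> 6 * S2"
  proof -
    have "(real_of_int S1)\<^sup>2 \<le> real_of_int S2 * real n"
      using sum_squared_le_sum_of_squares[of "\<lambda>i. real_of_int (a i)" "{..<n}"]
      by (simp add: S1_def S2_def power2_eq_square)
    then have "S1 * S1 \<le> S2 * int n"
      unfolding power2_eq_square by (metis of_int_le_iff of_int_mult of_int_of_nat_eq)
    also have "\<dots> \<le> S2 * 6"
      using n6 by (intro mult_left_mono) (auto simp: S2_def intro!: sum_nonneg)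
    finally show ?thesis by simp
  qed
  have d: "d \<ge> 0"
  proof (rule ccontr)
    assume "\<not> d \<ge> 0"
    define s where "s = - S1"
    have s: "s \<ge> 1 - 3 * d" "s \<ge> 4"
      using deg' \<open>\<not> d \<ge> 0\<close> by (simp_all add: s_def)
    have "s * s - 6 * s \<le> 6 * d * d + 18 * d"
      using \<open>S1 * S1 \<le> 6 * S2\<close> sq' by (simp add: s_def)
    moreover have "(s - 3) * (s - 3) \<ge> (- 2 - 3 * d) * (- 2 - 3 * d)"
      using s \<open>\<not> d \<ge> 0\<close> by (intro mult_mono) auto
    ultimately have "3 * (d * d) - 6 * d \<le> 5"
      by (simp add: algebra_simps)
    moreover have "d * d \<ge> 1"
      using \<open>\<not> d \<ge> 0\<close> by (smt (verit) mult_less_0_iff zero_less_mult_iff int_one_le_iff_zero_less)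
    ultimately show False
      using \<open>\<not> d \<ge> 0\<close> by linarith
  qed
  have "int (nat (a i) * (nat (a i) + 1)) \<le> a i * a i + a i" for i
  proof (cases "a i \<ge> 0")
    case True
    then show ?thesis by (simp add: algebra_simps)
  next
    case False
    have "a i * (a i + 1) \<ge> 0"
      using False by (intro mult_nonpos_nonpos) auto
    with False show ?thesis by (simp add: algebra_simps)
  qed
  then have "int (\<Sum>i<n. nat (a i) * (nat (a i) + 1)) \<le> S2 + S1"
    by (simp only: of_nat_sum S1_def S2_def flip: sum.distrib) (rule sum_mono, simp)
  also have "\<dots> < int ((nat d + 1) * (nat d + 2))"
    using sq' d by (simp add: algebra_simps)
  finally have "(\<Sum>i<n. nat (a i) * (nat (a i) + 1)) < (nat d + 1) * (nat d + 2)"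
    by (simp only: of_nat_less_iff)
  then obtain F where "form (nat d) F" "F \<noteq> (\<lambda>_. 0)" "\<And>i. i < n \<Longrightarrow> vanishes_to_order (nat (a i)) F (ps ! i)"
    using form_with_multiplicities[of n "\<lambda>i. ps ! i" "\<lambda>i. nat (a i)" "nat d"] pts by blast
  then show ?thesis
    using \<beta> d by (auto simp: BlP2 n_def a_def d_def)
qed

section \<open>Geometry of the reflexive polygon\<close>

lemma inner_pt: "x \<bullet> pt u = fst x * of_int (fst u) + snd x * of_int (snd u)"
  by (simp add: pt_def inner_prod_def)

lemma inner_pt_pt_iff: "pt h \<bullet> pt u = -1 \<longleftrightarrow> fst h * fst u + snd h * snd u = -1"
proof -
  have "pt h \<bullet> pt u = of_int (fst h * fst u + snd h * snd u)"
    by (simp add: pt_def inner_prod_def)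
  then show ?thesis
    by (metis of_int_1 of_int_eq_iff of_int_minus)
qed

locale polygon =
  fixes K :: "(real \<times> real) set" and N :: int and m :: "int \<Rightarrow> int \<times> int"
  assumes reflexive: "reflexive_polygon K" and enumeration: "boundary_enumeration K N m"
begin

lemma convex_K: "convex K" and compact_K: "compact K" and interior_K: "0 \<in> interior K"
  using reflexive finite_imp_compact_convex_hull
  by (auto simp: reflexive_polygon_def lattice_polytope_def)

lemma periodic: "m (k + N) = m k"
  and bij: "bij_betw m {1..N} {u. pt u \<in> frontier K}"
  and det_pos: "det2 (m k) (m (k + 1)) > 0"
  and edge: "closed_segment (pt (m k)) (pt (m (k + 1))) \<subseteq> frontier K"
  and edge_points: "{u. pt u \<in> closed_segment (pt (m k)) (pt (m (k + 1)))} = {m k, m (k + 1)}"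
  using enumeration unfolding boundary_enumeration_def by blast+

lemma frontier_subset_K: "frontier K \<subseteq> K"
  using compact_K by (simp add: compact_imp_closed frontier_subset_closed)

lemma m_in_K: "pt (m k) \<in> K"
  using edge[of k] frontier_subset_K by auto

text \<open>The linear function that is \<open>-1\<close> on an edge is a vertex of the dual polygon, hence integral. It
  takes the value \<open>-1\<close> at a lattice point, hence is primitive, so that neighbouring lattice points on the
  edge differ by a generator of its kernel.\<close>

lemma edge_function:
  obtains h where "\<forall>x\<in>K. pt h \<bullet> x \<ge> -1"
    and "fst h * fst (m k) + snd h * snd (m k) = -1"
    and "m (k + 1) = (fst (m k) + snd h, snd (m k) - fst h)"
proof -
  let ?u = "m k" and ?v = "m (k + 1)"
  define c where "c = midpoint (pt ?u) (pt ?v)"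
  have "c \<in> frontier K"
    using edge[of k] midpoint_in_closed_segment unfolding c_def by blast
  then have c: "c \<in> K" "c \<notin> interior K"
    using frontier_subset_K by (auto simp: frontier_def)
  moreover have "rel_interior K = interior K"
    using interior_K by (intro rel_interior_nonempty_interior) auto
  ultimately obtain a where a: "\<And>y. y \<in> K \<Longrightarrow> a \<bullet> c \<le> a \<bullet> y" "\<And>y. y \<in> interior K \<Longrightarrow> a \<bullet> c < a \<bullet> y"
    using supporting_hyperplane_rel_boundary[OF convex_K, of c] by metis
  have neg: "a \<bullet> c < 0"
    using a(2)[OF interior_K] by simp
  define h where "h = a /\<^sub>R (- (a \<bullet> c))"
  have hK: "h \<bullet> x \<ge> -1" if "x \<in> K" for x
    using a(1)[OF that] neg by (simp add: h_def field_simps)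
  have "h \<bullet> c = -1"
    using neg by (simp add: h_def)
  then have "h \<bullet> pt ?u + h \<bullet> pt ?v = -2"
    by (simp add: c_def midpoint_def inner_add_right)
  then have huv: "h \<bullet> pt ?u = -1" "h \<bullet> pt ?v = -1"
    using hK[OF m_in_K[of k]] hK[OF m_in_K[of "k + 1"]] by linarith+
  have det: "real_of_int (det2 ?u ?v) > 0"
    using det_pos[of k] by simp
  have unique: "y = h" if "y \<bullet> pt ?u = -1" "y \<bullet> pt ?v = -1" for y
  proof -
    have "(fst y - fst h) * real_of_int (det2 ?u ?v) = 0" "(snd y - snd h) * real_of_int (det2 ?u ?v) = 0"
      using that huv unfolding inner_pt det2_def of_int_diff of_int_mult by algebra+
    with det show ?thesis by (simp add: prod_eq_iff)
  qed
  obtain V where V: "finite V" "polar_dual K = convex hull (pt ` V)"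
    using reflexive by (auto simp: reflexive_polygon_def lattice_polytope_def)
  have "h extreme_point_of polar_dual K"
    unfolding extreme_point_of_def
  proof (intro conjI ballI notI)
    show "h \<in> polar_dual K"
      using hK by (simp add: polar_dual_def)
    fix x y assume x: "x \<in> polar_dual K" and y: "y \<in> polar_dual K" and "h \<in> open_segment x y"
    then obtain t where "x \<noteq> y" and t: "0 < t" "t < 1" "h = (1 - t) *\<^sub>R x + t *\<^sub>R y"
      by (auto simp: in_segment)
    have "x \<bullet> w = -1 \<and> y \<bullet> w = -1" if "w \<in> K" "h \<bullet> w = -1" for w
    proof -
      have "x \<bullet> w \<ge> -1" "y \<bullet> w \<ge> -1"
        using x y that(1) by (simp_all add: polar_dual_def)
      moreover have "(1 - t) * (x \<bullet> w + 1) + t * (y \<bullet> w + 1) = 0"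
        using that(2) by (simp add: t(3) inner_add_left algebra_simps)
      ultimately show ?thesis
        using t(1,2) by (smt (verit) mult_pos_pos mult_nonneg_nonneg)
    qed
    then have "x = h" "y = h"
      using huv m_in_K unique by metis+
    with \<open>x \<noteq> y\<close> show False by simp
  qed
  then obtain h' where h': "h = pt h'"
    using V extreme_points_of_convex_hull[of "pt ` V"] by auto
  let ?x = "fst ?v - fst ?u" and ?y = "snd ?v - snd ?u"
  have u1: "fst h' * fst ?u + snd h' * snd ?u = -1" and v1: "fst h' * fst ?v + snd h' * snd ?v = -1"
    using huv by (simp_all add: h' inner_pt_pt_iff)
  define e where "e = det2 ?u ?v"
  have e: "?x = e * snd h'" "?y = - e * fst h'"
    using u1 v1 unfolding e_def det2_def by algebra+
  have "e > 0"
    using det_pos[of k] by (simp add: e_def)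
  define w where "w = (fst ?u + snd h', snd ?u - fst h')"
  have "pt w = (1 - 1 / of_int e) *\<^sub>R pt ?u + (1 / of_int e) *\<^sub>R pt ?v"
  proof -
    have "real_of_int (fst ?v) = fst ?u + e * snd h'" "real_of_int (snd ?v) = snd ?u - e * fst h'"
      using e by (simp_all flip: of_int_add of_int_mult of_int_diff of_int_minus)
    then show ?thesis
      using \<open>e > 0\<close> by (simp add: pt_def w_def field_simps)
  qed
  moreover have "0 \<le> 1 / real_of_int e" "1 / real_of_int e \<le> 1"
    using \<open>e > 0\<close> by auto
  ultimately have "pt w \<in> closed_segment (pt ?u) (pt ?v)"
    unfolding closed_segment_def by blast
  then have "w = ?u \<or> w = ?v"
    using edge_points[of k] by blast
  moreover have "w \<noteq> ?u"
    using u1 by (auto simp: w_def prod_eq_iff)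
  ultimately have "w = ?v" by blast
  then show thesis
    using that[of h'] hK u1 by (simp add: h' w_def)
qed

lemma det_neighbours: "det2 (m k) (m (k + 1)) = 1"
proof -
  obtain h where "fst h * fst (m k) + snd h * snd (m k) = -1"
      "m (k + 1) = (fst (m k) + snd h, snd (m k) - fst h)"
    by (rule edge_function[of k])
  then show ?thesis
    by (simp add: det2_def algebra_simps)
qed

definition turn :: "int \<Rightarrow> int" where
  "turn k = det2 (m (k - 1)) (m (k + 1))"

text \<open>As \<open>m\<^sub>k\<close> and \<open>m\<^bsub>k+1\<^esub>\<close> form a basis of the lattice, the equations are checked on determinants with these
  two vectors.\<close>

lemma neighbour_sum:
  "fst (m (k - 1)) + fst (m (k + 1)) = turn k * fst (m k)"
  "snd (m (k - 1)) + snd (m (k + 1)) = turn k * snd (m k)"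
  using det_neighbours[of k] det_neighbours[of "k - 1"] unfolding turn_def det2_def
  by (simp_all, algebra+)

lemma m_nonzero: "m k \<noteq> (0, 0)"
  using det_pos[of k] by (auto simp: det2_def)

lemma toric_self_inter_eq: "toric_self_inter m k = - turn k"
  unfolding toric_self_inter_def
proof (rule the_equality)
  fix s assume s: "fst (m (k - 1)) + fst (m (k + 1)) = - s * fst (m k) \<and>
    snd (m (k - 1)) + snd (m (k + 1)) = - s * snd (m k)"
  then have "(turn k + s) * fst (m k) = 0" "(turn k + s) * snd (m k) = 0"
    using neighbour_sum[of k] by (simp_all add: distrib_right)
  with m_nonzero[of k] show "s = - turn k"
    by (cases "m k") auto
qed (simp add: neighbour_sum)

text \<open>If a boundary lattice point is not a vertex, it lies inside a segment contained in the polygon, and the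
  supporting lines of both adjacent edges contain this segment. Hence they coincide.\<close>

lemma turn_eq_2:
  assumes "\<not> pt (m k) extreme_point_of K"
  shows "turn k = 2"
proof -
  obtain x y where x: "x \<in> K" and y: "y \<in> K" and "pt (m k) \<in> open_segment x y"
    using assms m_in_K[of k] by (auto simp: extreme_point_of_def)
  then obtain t where xy: "x \<noteq> y" and t: "0 < t" "t < 1" "pt (m k) = (1 - t) *\<^sub>R x + t *\<^sub>R y"
    by (auto simp: in_segment)
  have on_line: "pt h \<bullet> x = -1 \<and> pt h \<bullet> y = -1"
    if "\<forall>x\<in>K. pt h \<bullet> x \<ge> -1" "fst h * fst (m k) + snd h * snd (m k) = -1" for h
  proof -
    have "pt h \<bullet> pt (m k) = -1"
      using that(2) by (simp add: inner_pt_pt_iff)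
    then have "(1 - t) * (pt h \<bullet> x + 1) + t * (pt h \<bullet> y + 1) = 0"
      by (simp add: t(3) inner_add_right algebra_simps)
    moreover have "pt h \<bullet> x \<ge> -1" "pt h \<bullet> y \<ge> -1"
      using that(1) x y by blast+
    ultimately show ?thesis
      using t(1,2) by (smt (verit) mult_pos_pos mult_nonneg_nonneg)
  qed
  obtain h where hK: "\<forall>x\<in>K. pt h \<bullet> x \<ge> -1" and hk: "fst h * fst (m k) + snd h * snd (m k) = -1"
    and h: "m (k + 1) = (fst (m k) + snd h, snd (m k) - fst h)"
    by (rule edge_function[of k])
  obtain h' where h'K: "\<forall>x\<in>K. pt h' \<bullet> x \<ge> -1"
    and h'k: "fst h' * fst (m (k - 1)) + snd h' * snd (m (k - 1)) = -1"
    and "m (k - 1 + 1) = (fst (m (k - 1)) + snd h', snd (m (k - 1)) - fst h')"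
    by (rule edge_function[of "k - 1"])
  then have h': "fst (m k) = fst (m (k - 1)) + snd h'" "snd (m k) = snd (m (k - 1)) - fst h'"
    by simp_all
  then have h'k': "fst h' * fst (m k) + snd h' * snd (m k) = -1"
    using h'k by algebra
  have "h = h'"
  proof -
    have "real_of_int (fst h) * (fst x - fst y) + snd h * (snd x - snd y) = 0"
      "real_of_int (fst h') * (fst x - fst y) + snd h' * (snd x - snd y) = 0"
      using on_line[OF hK hk] on_line[OF h'K h'k'] by (simp_all add: inner_prod_def pt_def algebra_simps)
    then have "real_of_int (det2 h h') * (fst x - fst y) = 0" "real_of_int (det2 h h') * (snd x - snd y) = 0"
      unfolding det2_def of_int_diff of_int_mult by algebra+
    then have "det2 h h' = 0"
      using xy by (auto simp: prod_eq_iff)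
    then have "fst h = fst h'" "snd h = snd h'"
      using hk h'k' unfolding det2_def by algebra+
    then show ?thesis by (simp add: prod_eq_iff)
  qed
  have "turn k * fst (m k) = 2 * fst (m k)" "turn k * snd (m k) = 2 * snd (m k)"
    using neighbour_sum[of k] h h' \<open>h = h'\<close> by simp_all
  with m_nonzero[of k] show ?thesis
    by (cases "m k") auto
qed

lemma periodic_mult: "m (k + N * t) = m k"
proof (induction t rule: int_induct[where k = 0])
  case (step1 i)
  then show ?case
    using periodic[of "k + N * i"] by (simp add: algebra_simps)
next
  case (step2 i)
  then show ?case
    using periodic[of "k + N * (i - 1)"] by (simp add: algebra_simps)
qed simp

lemma ex_extreme: "\<exists>j. pt (m j) extreme_point_of K"
proof -
  have "K \<noteq> {}"
    using interior_K interior_subset by blast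
  then obtain x where x: "x extreme_point_of K"
    using extreme_point_exists_convex[OF compact_K convex_K] by blast
  obtain V where V: "K = convex hull (pt ` V)"
    using reflexive by (auto simp: reflexive_polygon_def lattice_polytope_def)
  then obtain u where u: "x = pt u"
    using x extreme_points_of_convex_hull[of "pt ` V"] by auto
  have "x \<in> frontier K"
    using x extreme_point_not_in_interior[OF x] closure_subset by (auto simp: frontier_def extreme_point_of_def)
  then obtain j where "m j = u"
    using bij unfolding u bij_betw_def by (metis (mono_tags, lifting) imageE mem_Collect_eq)
  with x u show ?thesis by blast
qed

lemma mu_positive:
  assumes "\<not> pt (m k) extreme_point_of K"
  shows "mu K m k \<ge> 1" "nu K m k \<ge> 1"
proof -
  obtain j where j: "pt (m j) extreme_point_of K"
    using ex_extreme by blast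
  have "pt (m 0) \<in> frontier K"
    using edge[of 0] by auto
  then have "m ` {1..N} \<noteq> {}"
    using bij unfolding bij_betw_def by blast
  then have "N > 0"
    by simp
  have left: "m (k - int (nat ((k - j) mod N))) = m j"
  proof -
    have "k - int (nat ((k - j) mod N)) = j + N * ((k - j) div N)"
    proof -
      have "int (nat ((k - j) mod N)) = (k - j) - N * ((k - j) div N)"
        using \<open>N > 0\<close> by (simp add: minus_mult_div_eq_mod)
      then show ?thesis by simp
    qed
    then show ?thesis by (simp only: periodic_mult)
  qed
  have "pt (m (k - int (mu K m k))) extreme_point_of K"
    unfolding mu_def
    by (rule LeastI[of "\<lambda>s. pt (m (k - int s)) extreme_point_of K" "nat ((k - j) mod N)"])
       (simp only: left j)
  then show "mu K m k \<ge> 1"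
    using assms by (cases "mu K m k") auto
  have right: "m (k + int (nat ((j - k) mod N))) = m j"
  proof -
    have "k + int (nat ((j - k) mod N)) = j + N * (- ((j - k) div N))"
    proof -
      have "int (nat ((j - k) mod N)) = (j - k) - N * ((j - k) div N)"
        using \<open>N > 0\<close> by (simp add: minus_mult_div_eq_mod)
      then show ?thesis by simp
    qed
    then show ?thesis by (simp only: periodic_mult)
  qed
  have "pt (m (k + int (nu K m k))) extreme_point_of K"
    unfolding nu_def
    by (rule LeastI[of "\<lambda>s. pt (m (k + int s)) extreme_point_of K" "nat ((j - k) mod N)"])
       (simp only: right j)
  then show "nu K m k \<ge> 1"
    using assms by (cases "nu K m k") auto
qed

lemma mu_vertex:
  assumes "pt (m k) extreme_point_of K"
  shows "mu K m k = 0" "nu K m k = 0"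
  unfolding mu_def nu_def using assms by (auto intro: Least_eq_0)

lemma not_extreme_between:
  assumes "k - int (mu K m k) < j" "j < k + int (nu K m k)"
  shows "\<not> pt (m j) extreme_point_of K"
proof (cases "j \<le> k")
  case True
  then have "j = k - int (nat (k - j))" "nat (k - j) < mu K m k"
    using assms by simp_all
  then show ?thesis
    unfolding mu_def by (metis not_less_Least)
next
  case False
  then have "j = k + int (nat (j - k))" "nat (j - k) < nu K m k"
    using assms by simp_all
  then show ?thesis
    unfolding nu_def by (metis not_less_Least)
qed

end

section \<open>The classes in the potential\<close>

locale degeneration = polygon +
  fixes P :: surface and \<phi> :: "(int \<Rightarrow> int) \<Rightarrow> cls"
  assumes N_ge: "N \<ge> 2"
    and identification: "degeneration_identification P K N m \<phi>"
    and m_X: "m (N - 1) = (1, 0)" and m_Y: "m N = (0, 1)"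
begin

lemma N_ge_3: "N \<ge> 3"
proof -
  have "N \<noteq> 2"
    using det_neighbours[of 1] det_neighbours[of 2] periodic[of 1] by (auto simp: det2_def mult.commute)
  with N_ge show ?thesis by simp
qed

lemma m_0: "m 0 = (0, 1)" and m_minus_1: "m (- 1) = (1, 0)"
  using periodic[of 0] periodic[of "- 1"] m_X m_Y by simp_all

lemma ind_periodic: "ind N k (i + N) = ind N k i"
  and ind_shift: "ind N (k + N) i = ind N k i"
  by (simp_all add: ind_def)

lemma ind_small: "0 \<le> k \<Longrightarrow> k < N \<Longrightarrow> 0 \<le> i \<Longrightarrow> i < N \<Longrightarrow> ind N k i = (if i = k then 1 else 0)"
  by (simp add: ind_def)

lemma sum_ind:
  assumes f: "\<And>i. f (i + N) = (f i :: int)"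
  shows "(\<Sum>i=1..N. ind N k i * f i) = f k"
proof -
  define j where "j = (k - 1) mod N + 1"
  have j: "j \<in> {1..N}"
    using N_ge_3 by (auto simp: j_def pos_mod_bound add1_zle_eq)
  have eq: "i mod N = k mod N \<longleftrightarrow> i = j" if "i \<in> {1..N}" for i
  proof -
    have "i mod N = k mod N \<longleftrightarrow> (i - 1) mod N = (k - 1) mod N"
      by (metis mod_diff_left_eq diff_add_cancel mod_add_left_eq)
    also have "(i - 1) mod N = i - 1"
      using that by simp
    finally show ?thesis
      by (auto simp: j_def)
  qed
  have mult: "f (i + N * t) = f i" for i t
  proof (induction t rule: int_induct[where k = 0])
    case (step1 t)
    then show ?case using f[of "i + N * t"] by (simp add: algebra_simps)
  next
    case (step2 t)
    then show ?case using f[of "i + N * (t - 1)"] by (simp add: algebra_simps)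
  qed simp
  have "(k - 1) mod N = (k - 1) - N * ((k - 1) div N)"
    by (simp add: minus_mult_div_eq_mod)
  then have "j = k + N * (- ((k - 1) div N))"
    by (simp add: j_def)
  then have "f j = f k"
    by (simp only: mult)
  have "(\<Sum>i=1..N. ind N k i * f i) = (\<Sum>i=1..N. if i = j then f j else 0)"
    by (rule sum.cong) (auto simp: ind_def eq)
  also have "\<dots> = f k"
    using j \<open>f j = f k\<close> by simp
  finally show ?thesis .
qed

lemma sum_ind_1: "(\<Sum>i=1..N. ind N k i) = 1"
  using sum_ind[of "\<lambda>_. 1" k] by simp

abbreviation H :: "(int \<Rightarrow> int) set" where
  "H \<equiv> toric_H2 N m"

lemma H_0: "(\<lambda>_. 0) \<in> H"
  and H_add: "\<beta> \<in> H \<Longrightarrow> \<gamma> \<in> H \<Longrightarrow> (\<lambda>i. \<beta> i + \<gamma> i) \<in> H"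
  and H_mult: "\<beta> \<in> H \<Longrightarrow> (\<lambda>i. a * \<beta> i) \<in> H"
  by (simp_all add: toric_H2_def distrib_right sum.distrib mult.assoc flip: sum_distrib_left)

lemma H_sum: "(\<And>s. s \<in> S \<Longrightarrow> F s \<in> H) \<Longrightarrow> (\<lambda>i. \<Sum>s\<in>S. F s i) \<in> H"
  by (induction S rule: infinite_finite_induct) (simp_all add: H_0 H_add)

lemma sum_ind_m: "(\<Sum>i=1..N. ind N k i * fst (m i)) = fst (m k)" "(\<Sum>i=1..N. ind N k i * snd (m i)) = snd (m k)"
  by (rule sum_ind, simp add: periodic)+

abbreviation D :: "int \<Rightarrow> int \<Rightarrow> int" where
  "D k \<equiv> toric_divisor N m k"

lemma D_eq: "D k i = - turn k * ind N k i + ind N (k - 1) i + ind N (k + 1) i"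
  by (simp add: toric_divisor_def toric_self_inter_eq)

lemma D_H: "D k \<in> H"
  using neighbour_sum[of k]
  by (simp add: toric_H2_def D_eq ind_periodic distrib_right left_diff_distrib sum.distrib sum_subtractf
      mult.assoc sum_ind_m flip: sum_distrib_left)

lemma beta_H: "beta N m k \<in> H"
  by (simp add: toric_H2_def beta_def ind_periodic left_diff_distrib sum_subtractf mult.assoc sum_ind_m
      m_X m_Y flip: sum_distrib_left)

lemma beta_tilde_eq: "\<not> pt (m k) extreme_point_of K \<Longrightarrow> beta_tilde N k = D k"
  by (simp add: fun_eq_iff beta_tilde_def D_eq turn_eq_2)

subsection \<open>The intersection form\<close>

lemma \<phi>_bij: "bij_betw \<phi> H (H2 P)"
  and \<phi>_add: "\<beta> \<in> H \<Longrightarrow> \<gamma> \<in> H \<Longrightarrow> \<phi> (\<lambda>i. \<beta> i + \<gamma> i) = \<phi> \<beta> + \<phi> \<gamma>"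
  and \<phi>_D: "\<beta> \<in> H \<Longrightarrow> inter P (\<phi> (D k)) (\<phi> \<beta>) = \<beta> k"
  and \<phi>_anticanonical: "\<phi> (\<lambda>i. \<Sum>k=1..N. D k i) = anticanonical P"
  using identification unfolding degeneration_identification_def by blast+

lemma \<phi>_0: "\<phi> (\<lambda>_. 0) = 0"
  using \<phi>_add[OF H_0 H_0] by simp

definition pairing :: "(int \<Rightarrow> int) \<Rightarrow> (int \<Rightarrow> int) \<Rightarrow> int" where
  "pairing \<beta> \<gamma> = inter P (\<phi> \<beta>) (\<phi> \<gamma>)"

lemma pairing_commute: "pairing \<beta> \<gamma> = pairing \<gamma> \<beta>"
  by (simp add: pairing_def inter_commute)

lemma pairing_D: "\<gamma> \<in> H \<Longrightarrow> pairing (D k) \<gamma> = \<gamma> k"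
  by (simp add: pairing_def \<phi>_D)

lemma pairing_add: "\<beta> \<in> H \<Longrightarrow> \<beta>' \<in> H \<Longrightarrow> pairing (\<lambda>i. \<beta> i + \<beta>' i) \<gamma> = pairing \<beta> \<gamma> + pairing \<beta>' \<gamma>"
  by (simp add: pairing_def \<phi>_add inter_add)

lemma pairing_0: "pairing (\<lambda>_. 0) \<gamma> = 0"
  using pairing_add[OF H_0 H_0] by simp

lemma pairing_mult:
  assumes "\<beta> \<in> H"
  shows "pairing (\<lambda>i. a * \<beta> i) \<gamma> = a * pairing \<beta> \<gamma>"
proof (induction a rule: int_induct[where k = 0])
  case base
  then show ?case by (simp add: pairing_0)
next
  case (step1 a)
  then show ?case
    using pairing_add[OF H_mult[OF assms, of a] assms] by (simp add: algebra_simps)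
next
  case (step2 a)
  then show ?case
    using pairing_add[OF H_mult[OF assms, of "a - 1"] assms] by (simp add: algebra_simps)
qed

lemma pairing_sum:
  "(\<And>s. s \<in> S \<Longrightarrow> F s \<in> H) \<Longrightarrow> pairing (\<lambda>i. \<Sum>s\<in>S. F s i) \<gamma> = (\<Sum>s\<in>S. pairing (F s) \<gamma>)"
  by (induction S rule: infinite_finite_induct) (simp_all add: pairing_0 pairing_add H_sum)

lemma cls_deg_\<phi>:
  assumes "\<beta> \<in> H"
  shows "cls_deg P (\<phi> \<beta>) = (\<Sum>k=1..N. \<beta> k)"
proof -
  have "cls_deg P (\<phi> \<beta>) = pairing (\<lambda>i. \<Sum>k=1..N. D k i) \<beta>"
    unfolding cls_deg_def pairing_def \<phi>_anticanonical by (rule inter_commute)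
  also have "\<dots> = (\<Sum>k=1..N. pairing (D k) \<beta>)"
    by (rule pairing_sum) (rule D_H)
  finally show ?thesis
    by (simp add: pairing_D assms)
qed

text \<open>Summation by parts: the coefficients of \<open>\<Sum>j. det (m\<^sub>j, v) D\<^sub>j\<close> at the interior indices
  vanish, because \<open>j \<mapsto> det (m\<^sub>j, v)\<close> satisfies the linear relations between three neighbouring
  ray generators.\<close>

lemma sum_det_D:
  "(\<Sum>j<n. det2 (m (int j)) v * D (int j) i) =
     det2 (m 0) v * ind N (- 1) i - det2 (m (- 1)) v * ind N 0 i
     - det2 (m (int n)) v * ind N (int n - 1) i + det2 (m (int n - 1)) v * ind N (int n) i"
proof (induction n)
  case (Suc n)
  have "det2 (m (int n - 1)) v + det2 (m (int n + 1)) v = turn (int n) * det2 (m (int n)) v"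
    using neighbour_sum[of "int n"] unfolding det2_def by algebra
  then have "det2 (m (int n)) v * D (int n) i + det2 (m (int n - 1)) v * ind N (int n) i =
      det2 (m (int n)) v * ind N (int n - 1) i + det2 (m (int n)) v * ind N (int n + 1) i
      - det2 (m (int n + 1)) v * ind N (int n) i"
    unfolding D_eq by algebra
  with Suc show ?case by (simp add: add.commute)
qed simp

lemma beta_eq_sum_D:
  assumes "k \<ge> 0"
  shows "beta N m k = (\<lambda>i. \<Sum>j<nat k. det2 (m (int j)) (m k) * D (int j) i)"
proof
  fix i
  have "ind N (- 1) i = ind N (N - 1) i" "ind N 0 i = ind N N i"
    using ind_shift[of "- 1" i] ind_shift[of 0 i] by simp_all
  moreover have "det2 (m 0) (m k) = - fst (m k)" "det2 (m (- 1)) (m k) = snd (m k)" "det2 (m k) (m k) = 0"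
    "det2 (m (k - 1)) (m k) = 1"
    using det_neighbours[of "k - 1"] by (simp_all add: det2_def m_0 m_minus_1)
  ultimately show "beta N m k i = (\<Sum>j<nat k. det2 (m (int j)) (m k) * D (int j) i)"
    using assms by (simp add: sum_det_D beta_def)
qed

lemma pairing_beta:
  assumes "k \<ge> 0" "\<gamma> \<in> H"
  shows "pairing (beta N m k) \<gamma> = (\<Sum>j<nat k. det2 (m (int j)) (m k) * \<gamma> (int j))"
  unfolding beta_eq_sum_D[OF assms(1)]
  by (simp add: pairing_sum H_mult D_H pairing_mult pairing_D assms)

lemma beta_small:
  assumes "k \<in> {1..N - 2}" "i \<in> {0..N - 1}"
  shows "beta N m k i = (if i = k then 1 else 0) - (if i = N - 1 then fst (m k) else 0) -
    (if i = 0 then snd (m k) else 0)"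
proof -
  have "ind N N i = ind N 0 i"
    using ind_shift[of 0 i] by simp
  then show ?thesis
    using assms by (auto simp: beta_def ind_small)
qed

text \<open>By summation by parts \<open>\<beta>\<^sub>k\<close> is a combination of the curves \<open>D\<^sub>0, \<dots>, D\<^bsub>k-1\<^esub>\<close>, and of these only \<open>D\<^sub>0\<close>
  meets \<open>\<beta>\<^sub>k\<close>.\<close>

lemma beta_square:
  assumes k: "k \<in> {1..N - 2}"
  shows "pairing (beta N m k) (beta N m k) = fst (m k) * snd (m k)"
proof -
  have "pairing (beta N m k) (beta N m k) = (\<Sum>j<nat k. det2 (m (int j)) (m k) * beta N m k (int j))"
    using k by (intro pairing_beta beta_H) auto
  also have "\<dots> = (\<Sum>j<nat k. if j = 0 then fst (m k) * snd (m k) else 0)"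
  proof (rule sum.cong[OF refl])
    fix j assume "j \<in> {..<nat k}"
    then have "int j \<in> {0..N - 1}" "int j \<noteq> k" "int j \<noteq> N - 1"
      using k by auto
    then show "det2 (m (int j)) (m k) * beta N m k (int j) = (if j = 0 then fst (m k) * snd (m k) else 0)"
      by (simp add: beta_small[OF k] det2_def m_0)
  qed
  also have "\<dots> = fst (m k) * snd (m k)"
    using k by simp
  finally show ?thesis .
qed

subsection \<open>Chains of curves with self-intersection -2\<close>

text \<open>The summand of \<^const>\<open>beta_ij\<close> that belongs to a pair of an entry \<open>i\<close> of \<open>I\<close> and an entry \<open>j\<close> of \<open>J\<close>.\<close>

definition chain :: "int \<Rightarrow> nat \<Rightarrow> nat \<Rightarrow> int \<Rightarrow> int" where
  "chain k i j x = (\<Sum>s=0..<i. beta_tilde N (k - int s) x) + (\<Sum>s=1..<j. beta_tilde N (k + int s) x)"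

text \<open>These sums telescope, so that a chain is determined by its two ends.\<close>

lemma left_chain:
  "(\<Sum>s=0..<i. beta_tilde N (k - int s) x) =
     ind N (k - int i) x - ind N (k - int i + 1) x - ind N k x + ind N (k + 1) x"
  by (induction i) (simp_all add: beta_tilde_def algebra_simps)

lemma right_chain:
  assumes "j \<ge> 1"
  shows "(\<Sum>s=1..<j. beta_tilde N (k + int s) x) =
     ind N (k + int j) x - ind N (k + int j - 1) x - ind N (k + 1) x + ind N k x"
  using assms by (induction j rule: dec_induct) (simp_all add: beta_tilde_def algebra_simps)

lemma beta_ij_insert:
  assumes "finite I" "finite J" "i \<notin> I" "j \<notin> J"
  shows "beta_ij N m k (insert i I) (insert j J) = (\<lambda>x. chain k i j x + beta_ij N m k I J x)"
  using assms by (simp add: beta_ij_def chain_def fun_eq_iff)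

lemma sum_beta_ij: "(\<Sum>x=1..N. beta_ij N m k I J x) = 1 - fst (m k) - snd (m k)"
proof -
  have "(\<Sum>x=1..N. beta_tilde N l x) = 0" for l
    by (simp add: beta_tilde_def sum.distrib sum_subtractf sum_ind_1 flip: sum_distrib_left)
  moreover have "(\<Sum>x=1..N. \<Sum>s\<in>S. \<Sum>t\<in>T s. beta_tilde N (h s t) x) =
      (\<Sum>s\<in>S. \<Sum>t\<in>T s. \<Sum>x=1..N. beta_tilde N (h s t) x)"
    for S and T :: "nat \<Rightarrow> nat set" and h
    by (subst sum.swap, rule sum.cong[OF refl], rule sum.swap)
  ultimately show ?thesis
    by (simp add: beta_ij_def beta_def sum.distrib sum_subtractf sum_ind_1 flip: sum_distrib_left)
qed

context
  fixes k :: int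
  assumes k: "k \<in> {1..N - 2}"
    and ext: "pt (1, 0) extreme_point_of K" "pt (0, 1) extreme_point_of K"
begin

text \<open>The chains around \<open>k\<close> do not reach the indices of the two vertices \<open>(1, 0)\<close> and \<open>(0, 1)\<close>.\<close>

lemma chain_bounds: "int (mu K m k) \<le> k" "k + int (nu K m k) \<le> N - 1"
proof -
  show "int (mu K m k) \<le> k"
  proof (rule ccontr)
    assume "\<not> int (mu K m k) \<le> k"
    then have "\<not> pt (m 0) extreme_point_of K"
      using k by (intro not_extreme_between[of k]) auto
    with ext show False by (simp add: m_0)
  qed
  show "k + int (nu K m k) \<le> N - 1"
  proof (rule ccontr)
    assume "\<not> k + int (nu K m k) \<le> N - 1"
    then have "\<not> pt (m (N - 1)) extreme_point_of K"
      using k by (intro not_extreme_between[of k]) auto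
    with ext show False by (simp add: m_X)
  qed
qed

lemma chain_eq_sum_D:
  assumes i: "i \<in> {1..mu K m k}" and j: "j \<in> {1..nu K m k}"
  shows "chain k i j = (\<lambda>x. \<Sum>s\<in>{k - int i + 1..k + int j - 1}. D s x)"
proof
  fix x
  have "{k - int i + 1..k + int j - 1} = {k - int i + 1..k} \<union> {k + 1..k + int j - 1}"
    using i j by auto
  then have "(\<Sum>s\<in>{k - int i + 1..k + int j - 1}. D s x) =
      (\<Sum>s\<in>{k - int i + 1..k}. D s x) + (\<Sum>s\<in>{k + 1..k + int j - 1}. D s x)"
    by (simp add: sum.union_disjoint)
  also have "(\<Sum>s\<in>{k - int i + 1..k}. D s x) = (\<Sum>s=0..<i. D (k - int s) x)"
    by (rule sum.reindex_bij_witness[of _ "\<lambda>s. k - int s" "\<lambda>s. nat (k - s)"]) auto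
  also have "(\<Sum>s\<in>{k + 1..k + int j - 1}. D s x) = (\<Sum>s=1..<j. D (k + int s) x)"
    by (rule sum.reindex_bij_witness[of _ "\<lambda>s. k + int s" "\<lambda>s. nat (s - k)"]) auto
  also have "(\<Sum>s=0..<i. D (k - int s) x) = (\<Sum>s=0..<i. beta_tilde N (k - int s) x)"
    using i j by (intro sum.cong refl) (simp add: beta_tilde_eq not_extreme_between[of k])
  also have "(\<Sum>s=1..<j. D (k + int s) x) = (\<Sum>s=1..<j. beta_tilde N (k + int s) x)"
    using i j by (intro sum.cong refl) (simp add: beta_tilde_eq not_extreme_between[of k])
  finally show "chain k i j x = (\<Sum>s\<in>{k - int i + 1..k + int j - 1}. D s x)"
    by (simp add: chain_def)
qed

lemma chain_H:
  assumes "i \<in> {1..mu K m k}" "j \<in> {1..nu K m k}"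
  shows "chain k i j \<in> H"
  unfolding chain_eq_sum_D[OF assms] by (intro H_sum D_H)

lemma pairing_chain:
  assumes "i \<in> {1..mu K m k}" "j \<in> {1..nu K m k}" "\<gamma> \<in> H"
  shows "pairing (chain k i j) \<gamma> = (\<Sum>s\<in>{k - int i + 1..k + int j - 1}. \<gamma> s)"
  unfolding chain_eq_sum_D[OF assms(1,2)] by (simp add: pairing_sum D_H pairing_D assms(3))

text \<open>The chain of a pair \<open>(i, j)\<close> is a connected chain of curves with self-intersection \<open>-2\<close>, so its sum \<open>y\<close> has
  \<open>y\<^sup>2 = -2\<close>. It is orthogonal to the chains of pairs with other entries, and \<open>y \<cdot> \<beta>\<^sub>k = 1\<close>. Hence adding
  \<open>y\<close> is the reflection in \<open>y\<close>, which preserves the square: \<open>(\<gamma> + y)\<^sup>2 = \<gamma>\<^sup>2 + 2 - 2\<close>.\<close>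

lemma beta_ij_H_square:
  assumes I: "I \<subseteq> {1..mu K m k}" and J: "J \<subseteq> {1..nu K m k}" and card: "card I = card J"
  shows "beta_ij N m k I J \<in> H"
    and "pairing (beta_ij N m k I J) (beta_ij N m k I J) = fst (m k) * snd (m k)"
proof -
  have "beta_ij N m k I J \<in> H \<and> pairing (beta_ij N m k I J) (beta_ij N m k I J) = fst (m k) * snd (m k)"
    using assms
  proof (induction "card I" arbitrary: I J)
    case 0
    then have "I = {}" "J = {}"
      using finite_subset[of I "{1..mu K m k}"] finite_subset[of J "{1..nu K m k}"] by auto
    moreover have "beta_ij N m k {} {} = beta N m k"
      by (simp add: beta_ij_def fun_eq_iff)
    ultimately show ?case
      using beta_H beta_square[OF k] by simp
  next
    case (Suc n)
    have fin: "finite I" "finite J"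
      using Suc.prems by (auto intro: finite_subset)
    obtain i I' where I': "I = insert i I'" "i \<notin> I'" "card I' = n"
      using Suc(2) by (metis card_Suc_eq)
    obtain j J' where J': "J = insert j J'" "j \<notin> J'" "card J' = n"
      using Suc(2) Suc.prems(3) by (metis card_Suc_eq)
    let ?g = "beta_ij N m k I' J'" and ?y = "chain k i j"
    let ?W = "{k - int i + 1..k + int j - 1}"
    let ?L = "\<lambda>i' s. \<Sum>s'=0..<i'. beta_tilde N (k - int s') s"
      and ?R = "\<lambda>j' s. \<Sum>s'=1..<j'. beta_tilde N (k + int s') s"
    have fin': "finite I'" "finite J'"
      using fin I' J' by simp_all
    have g: "?g \<in> H" "pairing ?g ?g = fst (m k) * snd (m k)"
      using Suc.hyps(1)[of I' J'] I' J' Suc.prems by auto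
    have i: "i \<in> {1..mu K m k}" and j: "j \<in> {1..nu K m k}"
      using Suc.prems I' J' by auto
    have y: "?y \<in> H"
      by (rule chain_H[OF i j])
    have W: "?W \<subseteq> {1..N - 2}"
      using i j chain_bounds by auto
    \<comment> \<open>Intersection numbers with the chain are sums over \<open>W\<close>, and each index function contributes \<open>1\<close> or \<open>0\<close>.
      The summands that depend on whether \<open>j = 1\<close> cancel, since \<open>I\<close> and \<open>J\<close> have equally many entries.\<close>
    have sum_W: "(\<Sum>s\<in>?W. ind N x s) = (if x \<in> ?W then 1 else 0)" if "x \<in> {0..N - 1}" for x
    proof -
      have "(\<Sum>s\<in>?W. ind N x s) = (\<Sum>s\<in>?W. if s = x then 1 else 0)"
        using W that by (intro sum.cong refl) (subst ind_small, auto)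
      then show ?thesis by simp
    qed
    have sum_left: "(\<Sum>s\<in>?W. ?L i' s) =
        (if i' = i then -1 else 0) - (if j = 1 then 1 else 0)" if "i' \<in> {1..mu K m k}" for i'
    proof -
      have "(\<Sum>s\<in>?W. ?L i' s) =
          (\<Sum>s\<in>?W. ind N (k - int i') s) - (\<Sum>s\<in>?W. ind N (k - int i' + 1) s)
          - (\<Sum>s\<in>?W. ind N k s) + (\<Sum>s\<in>?W. ind N (k + 1) s)"
        by (simp add: left_chain sum.distrib sum_subtractf)
      also have "\<dots> = (if i' = i then -1 else 0) - (if j = 1 then 1 else 0)"
        using that i j k chain_bounds by (subst (1 2 3 4) sum_W) auto
      finally show ?thesis .
    qed
    have sum_right: "(\<Sum>s\<in>?W. ?R j' s) =
        (if j' = j then -1 else 0) + (if j = 1 then 1 else 0)" if "j' \<in> {1..nu K m k}" for j'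
    proof -
      have "(\<Sum>s\<in>?W. ?R j' s) =
          (\<Sum>s\<in>?W. ind N (k + int j') s) - (\<Sum>s\<in>?W. ind N (k + int j' - 1) s)
          - (\<Sum>s\<in>?W. ind N (k + 1) s) + (\<Sum>s\<in>?W. ind N k s)"
        using that by (simp only: right_chain atLeastAtMost_iff sum.distrib sum_subtractf)
      also have "\<dots> = (if j' = j then -1 else 0) + (if j = 1 then 1 else 0)"
        using that i j k chain_bounds by (subst (1 2 3 4) sum_W) auto
      finally show ?thesis .
    qed
    have "pairing ?y ?y = (\<Sum>s\<in>?W. ?y s)"
      by (rule pairing_chain[OF i j y])
    also have "\<dots> = -2"
      using sum_left[OF i] sum_right[OF j] by (simp add: chain_def sum.distrib)
    finally have yy: "pairing ?y ?y = -2" .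
    have sum_beta: "(\<Sum>s\<in>?W. beta N m k s) = 1"
    proof -
      have "(\<Sum>s\<in>?W. beta N m k s) = (\<Sum>s\<in>?W. if s = k then 1 else 0)"
        using W k by (intro sum.cong refl) (subst beta_small, auto)
      then show ?thesis
        using i j by simp
    qed
    have "pairing ?y ?g = (\<Sum>s\<in>?W. ?g s)"
      by (rule pairing_chain[OF i j g(1)])
    also have "\<dots> = (\<Sum>s\<in>?W. beta N m k s) + (\<Sum>i'\<in>I'. \<Sum>s\<in>?W. ?L i' s)
        + (\<Sum>j'\<in>J'. \<Sum>s\<in>?W. ?R j' s)"
      unfolding beta_ij_def sum.distrib by (simp only: sum.swap[of _ I'] sum.swap[of _ J'])
    also have "(\<Sum>i'\<in>I'. \<Sum>s\<in>?W. ?L i' s) =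
        (\<Sum>i'\<in>I'. - (if j = 1 then 1 else 0))"
      using I' Suc.prems(1) by (intro sum.cong refl) (subst sum_left, auto)
    also have "(\<Sum>j'\<in>J'. \<Sum>s\<in>?W. ?R j' s) =
        (\<Sum>j'\<in>J'. (if j = 1 then 1 else 0))"
      using J' Suc.prems(2) by (intro sum.cong refl) (subst sum_right, auto)
    also have "(\<Sum>s\<in>?W. beta N m k s) + (\<Sum>i'\<in>I'. - (if j = 1 then 1 else 0)) +
        (\<Sum>j'\<in>J'. (if j = 1 then 1 else 0)) = 1"
      using I'(3) J'(3) by (simp add: sum_beta)
    finally have yg: "pairing ?y ?g = 1" .
    have eq: "beta_ij N m k I J = (\<lambda>x. ?y x + ?g x)"
      unfolding I'(1) J'(1) by (rule beta_ij_insert) (use fin' I' J' in auto)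
    have H: "(\<lambda>x. ?y x + ?g x) \<in> H"
      by (rule H_add[OF y g(1)])
    have "pairing (\<lambda>x. ?y x + ?g x) (\<lambda>x. ?y x + ?g x) = pairing ?y ?y + 2 * pairing ?y ?g + pairing ?g ?g"
      using pairing_add[OF y g(1)] pairing_commute[of _ "\<lambda>x. ?y x + ?g x"] pairing_commute[of ?g ?y] by simp
    with H show ?case
      unfolding eq by (simp add: yy yg g(2))
  qed
  then show "beta_ij N m k I J \<in> H"
    and "pairing (beta_ij N m k I J) (beta_ij N m k I J) = fst (m k) * snd (m k)" by blast+
qed

end

end

subsection \<open>The support of the potential\<close>

lemma qcoeff_zhat:
  "qcoeff (zhat u c) v \<beta> = (if u = v then qhalf (fst u * snd u) * Poly_Mapping.lookup c \<beta> else 0)"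
  by (simp add: qcoeff_def zhat_def lookup_single when_def lookup_single_0_mult)

lemma qhalf_nonzero [simp]: "qhalf n \<noteq> 0"
  by (metis add.right_inverse mult_zero_left qhalf_0 qhalf_add zero_neq_one)

lemma finite_index_pairs: "finite (index_pairs u v)"
proof -
  have "index_pairs u v \<subseteq> Pow {1..u} \<times> Pow {1..v}"
    by (auto simp: index_pairs_def)
  then show ?thesis
    by (rule finite_subset) auto
qed

text \<open>All coefficients in the sum are \<open>1\<close>, so nothing cancels.\<close>

lemma lookup_potential_coeff_nonzero_iff:
  "Poly_Mapping.lookup (potential_coeff K N m \<phi> k) \<beta> \<noteq> 0 \<longleftrightarrow>
     (\<exists>(I, J)\<in>index_pairs (mu K m k) (nu K m k). \<beta> = \<phi> (beta_ij N m k I J))"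
proof -
  let ?A = "{s \<in> index_pairs (mu K m k) (nu K m k). \<phi> (beta_ij N m k (fst s) (snd s)) = \<beta>}"
  have "Poly_Mapping.lookup (potential_coeff K N m \<phi> k) \<beta> =
      (\<Sum>s\<in>index_pairs (mu K m k) (nu K m k). if \<phi> (beta_ij N m k (fst s) (snd s)) = \<beta> then 1 else 0)"
    by (simp add: potential_coeff_def lookup_sum case_prod_beta lookup_single when_def)
  also have "\<dots> = of_nat (card ?A)"
    by (simp add: sum.If_cases finite_index_pairs Int_def)
  finally have "Poly_Mapping.lookup (potential_coeff K N m \<phi> k) \<beta> \<noteq> 0 \<longleftrightarrow> card ?A \<noteq> 0"
    by simp
  also have "\<dots> \<longleftrightarrow> ?A \<noteq> {}"
    by (simp add: finite_index_pairs)
  finally show ?thesis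
    by auto
qed

context degeneration
begin

abbreviation pairs :: "int \<Rightarrow> (nat set \<times> nat set) set" where
  "pairs k \<equiv> index_pairs (mu K m k) (nu K m k)"

abbreviation potential_part :: "int set \<Rightarrow> qtorus" where
  "potential_part A \<equiv> (\<Sum>k\<in>A. zhat (m k) (potential_coeff K N m \<phi> k))"

lemma qcoeff_potential:
  assumes "A \<subseteq> {1..N}"
  shows "qcoeff (potential_part A) u \<beta> \<noteq> 0 \<longleftrightarrow>
    (\<exists>k\<in>A. u = m k \<and> (\<exists>(I, J)\<in>pairs k. \<beta> = \<phi> (beta_ij N m k I J)))"
proof -
  have inj: "inj_on m {1..N}" and fin: "finite A"
    using bij assms by (auto simp: bij_betw_def intro: finite_subset)
  show ?thesis
  proof (cases "\<exists>k\<in>A. u = m k")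
    case True
    then obtain k where k: "k \<in> A" "u = m k" by blast
    have other: "l = k" if "l \<in> A" "m l = m k" for l
      using inj that k assms by (auto simp: inj_on_def)
    have "qcoeff (potential_part A) u \<beta> =
        (\<Sum>l\<in>A. if l = k then qhalf (fst u * snd u) * Poly_Mapping.lookup (potential_coeff K N m \<phi> k) \<beta> else 0)"
      unfolding qcoeff_sum using other by (intro sum.cong refl) (auto simp: qcoeff_zhat k(2))
    also have "\<dots> = qhalf (fst u * snd u) * Poly_Mapping.lookup (potential_coeff K N m \<phi> k) \<beta>"
      using fin k(1) by simp
    finally have "qcoeff (potential_part A) u \<beta> \<noteq> 0 \<longleftrightarrow>
        (\<exists>(I, J)\<in>pairs k. \<beta> = \<phi> (beta_ij N m k I J))"
      by (simp add: lookup_potential_coeff_nonzero_iff)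
    moreover have "(\<exists>l\<in>A. u = m l \<and> Q l) \<longleftrightarrow> Q k" for Q
      using k other by metis
    ultimately show ?thesis by simp
  next
    case False
    then have "qcoeff (potential_part A) u \<beta> = 0"
      unfolding qcoeff_sum by (intro sum.neutral) (auto simp: qcoeff_zhat)
    with False show ?thesis by auto
  qed
qed

lemma beta_ij_empty: "beta_ij N m k {} {} = beta N m k"
  by (simp add: beta_ij_def fun_eq_iff)

lemma beta_axis: "k \<in> {N - 1, N} \<Longrightarrow> beta N m k = (\<lambda>_. 0)"
  by (auto simp: beta_def m_X m_Y fun_eq_iff)

context
  fixes f :: qtorus
  assumes f: "f = toric_potential K N m \<phi>" and leading: "leading_terms_XY P f"
begin

lemma leading_deg: "qcoeff (f - qX - qY) u \<beta> \<noteq> 0 \<Longrightarrow> cls_deg P \<beta> \<ge> 1"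
  using leading unfolding leading_terms_XY_def qcoeff_def by blast

text \<open>Otherwise the coefficient of \<open>X\<close> or \<open>Y\<close> would contain the monomial of the class of a curve with
  self-intersection \<open>-2\<close>, which has degree \<open>0\<close>.\<close>

lemma axis_vertex:
  assumes k: "k \<in> {N - 1, N}"
  shows "pt (m k) extreme_point_of K"
proof (rule ccontr)
  assume ext: "\<not> pt (m k) extreme_point_of K"
  let ?\<beta> = "\<phi> (beta_tilde N k)"
  have "({1}, {1}) \<in> pairs k"
    using mu_positive[OF ext] by (simp add: index_pairs_def)
  moreover have "beta_ij N m k {1} {1} = beta_tilde N k"
    by (simp add: beta_ij_def beta_axis[OF k] fun_eq_iff)
  ultimately have "qcoeff f (m k) ?\<beta> \<noteq> 0"
    unfolding f toric_potential_def qcoeff_potential[OF order_refl]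
    using k N_ge_3 by (intro bexI[of _ k] conjI refl bexI[of _ "({1}, {1})"]) auto
  moreover have H: "beta_tilde N k \<in> H"
    unfolding beta_tilde_eq[OF ext] by (rule D_H)
  have "beta_tilde N k k = -2"
  proof -
    have "(k - 1) mod N \<noteq> k mod N" "(k + 1) mod N \<noteq> k mod N"
      using N_ge_3 by (auto simp: mod_eq_dvd_iff zdvd_not_zless)
    then show ?thesis
      by (simp add: beta_tilde_def ind_def)
  qed
  then have "?\<beta> \<noteq> \<phi> (\<lambda>_. 0)"
    using \<phi>_bij H H_0 by (metis bij_betw_def inj_on_def neg_numeral_neq_zero)
  then have "?\<beta> \<noteq> 0"
    by (simp add: \<phi>_0)
  ultimately have "qcoeff (f - qX - qY) (m k) ?\<beta> \<noteq> 0"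
    by (simp add: qX_eq qY_eq qcoeff_qmono)
  then have "cls_deg P ?\<beta> \<ge> 1"
    by (rule leading_deg)
  moreover have "cls_deg P ?\<beta> = 0"
    unfolding cls_deg_\<phi>[OF H]
    by (simp add: beta_tilde_def sum.distrib sum_subtractf sum_ind_1 flip: sum_distrib_left)
  ultimately show False by simp
qed

lemma vertices: "pt (1, 0) extreme_point_of K" "pt (0, 1) extreme_point_of K"
  using axis_vertex[of "N - 1"] axis_vertex[of N] by (simp_all add: m_X m_Y)

lemma potential_tail: "f - qX - qY = potential_part {1..N - 2}"
proof -
  have "potential_coeff K N m \<phi> k = 1" if "k \<in> {N - 1, N}" for k
  proof -
    have "pairs k = {({}, {})}"
      using mu_vertex[OF axis_vertex[OF that]] by (auto simp: index_pairs_def)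
    then show ?thesis
      by (simp add: potential_coeff_def beta_ij_empty beta_axis[OF that] \<phi>_0)
  qed
  then have axis: "zhat (m (N - 1)) (potential_coeff K N m \<phi> (N - 1)) = qX"
      "zhat (m N) (potential_coeff K N m \<phi> N) = qY"
    by (simp_all add: zhat_def m_X m_Y qX_def qY_def)
  have "{1..N} = insert N (insert (N - 1) {1..N - 2})"
    using N_ge_3 by auto
  then have "f = zhat (m N) (potential_coeff K N m \<phi> N) + (zhat (m (N - 1)) (potential_coeff K N m \<phi> (N - 1)) +
      potential_part {1..N - 2})"
    unfolding f toric_potential_def by simp
  then show ?thesis
    by (simp add: axis)
qed

lemma potential_tail_support:
  assumes "(u, \<beta>) \<in> qsupport (f - qX - qY)"
  obtains k I J where "k \<in> {1..N - 2}" "u = m k" "(I, J) \<in> pairs k"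
    "\<beta> = \<phi> (beta_ij N m k I J)"
proof -
  have "qcoeff (f - qX - qY) u \<beta> \<noteq> 0" and sub: "{1..N - 2} \<subseteq> {1..N}"
    using assms by (auto simp: qsupport_def)
  then show thesis
    using that unfolding potential_tail qcoeff_potential[OF sub] by blast
qed

lemma potential_deg:
  assumes "k \<in> {1..N - 2}" "(I, J) \<in> pairs k"
  shows "cls_deg P (\<phi> (beta_ij N m k I J)) = 1 - fst (m k) - snd (m k)"
    and "cls_deg P (\<phi> (beta_ij N m k I J)) \<ge> 1"
proof -
  have "beta_ij N m k I J \<in> H"
    using assms beta_ij_H_square(1)[OF assms(1) vertices] by (simp add: index_pairs_def)
  then show "cls_deg P (\<phi> (beta_ij N m k I J)) = 1 - fst (m k) - snd (m k)"
    by (simp add: cls_deg_\<phi> sum_beta_ij)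
  have "{1..N - 2} \<subseteq> {1..N}"
    by simp
  then have "qcoeff (f - qX - qY) (m k) (\<phi> (beta_ij N m k I J)) \<noteq> 0"
    unfolding potential_tail using assms by (subst qcoeff_potential) blast+
  then show "cls_deg P (\<phi> (beta_ij N m k I J)) \<ge> 1"
    by (rule leading_deg)
qed

lemma edge_bound:
  assumes h: "\<forall>x\<in>K. pt h \<bullet> x \<ge> -1"
  shows "fst h * fst (m k) + snd h * snd (m k) \<ge> -1"
proof -
  have "real_of_int (fst h * fst (m k) + snd h * snd (m k)) \<ge> -1"
    using h m_in_K[of k] by (auto simp: inner_pt pt_def inner_prod_def)
  then show ?thesis by linarith
qed

text \<open>Points with second coordinate \<open>1\<close> lie to the left of \<open>(0, 1)\<close>, because they do not lie beyond the line
  through the edge from \<open>(1, 0)\<close> to \<open>(0, 1)\<close>. The polygon also lies on one side of the line through the edge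
  from \<open>m\<^bsub>N-2\<^esub> = (c, -1)\<close> to \<open>(1, 0)\<close>; as \<open>c \<le> 1\<close> by the condition on degrees, the first coordinates of
  its points with nonpositive second coordinate are at most \<open>1\<close>.\<close>

lemma exponent_bounds:
  assumes k: "k \<in> {1..N - 2}"
  shows "snd (m k) = 1 \<Longrightarrow> fst (m k) < 0" and "snd (m k) \<le> 0 \<Longrightarrow> fst (m k) \<le> 1"
proof -
  show "fst (m k) < 0" if "snd (m k) = 1"
  proof -
    obtain h where h: "\<forall>x\<in>K. pt h \<bullet> x \<ge> -1" "fst h * fst (m (N - 1)) + snd h * snd (m (N - 1)) = -1"
        "m (N - 1 + 1) = (fst (m (N - 1)) + snd h, snd (m (N - 1)) - fst h)"
      by (rule edge_function)
    then have "fst h = -1" "snd h = -1"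
      by (simp_all add: m_X m_Y)
    then have "fst (m k) \<le> 0"
      using edge_bound[OF h(1), of k] that by simp
    moreover have "m k \<noteq> m N"
      using bij k inj_onD[of m "{1..N}" k N] by (auto simp: bij_betw_def)
    ultimately show ?thesis
      using that by (cases "m k") (auto simp: m_Y)
  qed
  show "fst (m k) \<le> 1" if "snd (m k) \<le> 0"
  proof -
    obtain h where h: "\<forall>x\<in>K. pt h \<bullet> x \<ge> -1" "fst h * fst (m (N - 2)) + snd h * snd (m (N - 2)) = -1"
        "m (N - 2 + 1) = (fst (m (N - 2)) + snd h, snd (m (N - 2)) - fst h)"
      by (rule edge_function)
    have "N - 2 + 1 = N - 1" by simp
    then have c: "fst (m (N - 2)) = 1 - snd h" "snd (m (N - 2)) = fst h"
      using h(3) by (simp_all add: m_X)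
    have "det2 (m (N - 2)) (m (N - 2 + 1)) = 1"
      by (rule det_neighbours)
    then have "fst h = -1"
      using c by (simp add: det2_def m_X \<open>N - 2 + 1 = N - 1\<close>)
    moreover have "1 - fst (m (N - 2)) - snd (m (N - 2)) \<ge> 1"
    proof -
      have "N - 2 \<in> {1..N - 2}" "({}, {}) \<in> index_pairs (mu K m (N - 2)) (nu K m (N - 2))"
        using N_ge_3 by (simp_all add: index_pairs_def)
      then show ?thesis
        using potential_deg by metis
    qed
    ultimately have "snd h \<ge> 0"
      using c by simp
    then have "snd h * snd (m k) \<le> 0"
      using that by (rule mult_nonneg_nonpos)
    with edge_bound[OF h(1), of k] \<open>fst h = -1\<close> show ?thesis by simp
  qed
qed

text \<open>With \<open>\<beta>\<^sup>2 = a b\<close> and \<open>deg \<beta> = 1 - a - b\<close> the condition of the dimension count reads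
  \<open>(1 - a) (1 - b) \<ge> 0\<close>.\<close>

lemma potential_effective:
  assumes P: "very_ample_anticanonical P" and below: "\<And>u. pt u \<in> K \<Longrightarrow> snd u \<le> 1"
    and k: "k \<in> {1..N - 2}" and IJ: "(I, J) \<in> pairs k"
  shows "\<phi> (beta_ij N m k I J) \<in> NE P"
proof -
  let ?\<beta> = "beta_ij N m k I J"
  have H: "?\<beta> \<in> H" and square: "pairing ?\<beta> ?\<beta> = fst (m k) * snd (m k)"
    using beta_ij_H_square[OF k vertices, of I J] IJ by (simp_all add: index_pairs_def)
  have "(1 - fst (m k)) * (1 - snd (m k)) \<ge> 0"
  proof (cases "snd (m k) = 1")
    case False
    then have "snd (m k) \<le> 0"
      using below[OF m_in_K[of k]] by simp
    then show ?thesis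
      using exponent_bounds(2)[OF k] by (intro mult_nonneg_nonneg) auto
  qed simp
  then have "pairing ?\<beta> ?\<beta> + cls_deg P (\<phi> ?\<beta>) \<ge> 0"
    by (simp add: square potential_deg(1)[OF k IJ] algebra_simps)
  moreover have "\<phi> ?\<beta> \<in> H2 P"
    using \<phi>_bij H by (auto simp: bij_betw_def)
  ultimately show ?thesis
    using effective_by_dimension[OF P] potential_deg(2)[OF k IJ] by (simp add: pairing_def)
qed

text \<open>As \<open>deg \<beta> = 1 - a - b\<close>, the weight for the constant \<open>2\<close> is \<open>1 + deg \<beta>\<close>, and it remains positive without the
  summand \<open>b\<close> because \<open>b \<le> 1 \<le> deg \<beta>\<close>.\<close>

lemma quantum_curve_potential:
  assumes P: "very_ample_anticanonical P" and below: "\<And>u. pt u \<in> K \<Longrightarrow> snd u \<le> 1"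
  shows "quantum_curve (NE P) (cls_deg P) 2 (f - qX - qY)"
proof
  fix u \<beta> assume "(u, \<beta>) \<in> qsupport (f - qX - qY)"
  then obtain k I J where k: "k \<in> {1..N - 2}" "(I, J) \<in> pairs k"
    and u: "u = m k" "\<beta> = \<phi> (beta_ij N m k I J)"
    by (rule potential_tail_support)
  have deg: "cls_deg P \<beta> = 1 - fst u - snd u" "cls_deg P \<beta> \<ge> 1"
    using potential_deg[OF k] by (simp_all add: u)
  have b: "snd u \<le> 1"
    using below[OF m_in_K] by (simp add: u)
  show "\<beta> \<in> NE P"
    using potential_effective[OF P below k] by (simp add: u)
  show "cls_deg P \<beta> \<ge> 1" "snd u \<le> 1"
    by fact+
  show "2 * cls_deg P \<beta> + fst u \<ge> 1" "2 * cls_deg P \<beta> + fst u + snd u \<ge> 1"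
    using deg b by linarith+
  show "fst u < 0" if "snd u = 1"
    using exponent_bounds(1)[OF k(1)] that by (simp add: u)
qed (simp_all add: NE_0 NE_add finite_NE_splits cls_deg_add)

end

end

section \<open>The wavefunction and its period\<close>

lemma one_plus_X_times_invertible:
  fixes h :: "qpoly fps"
  shows "\<exists>c. (1 + fls_X * fps_to_fls h) * c = 1"
proof -
  let ?u = "1 + fps_X * h"
  have "fps_to_fls (?u * unit_inv ?u) = 1"
    by (simp add: unit_inv_right)
  then have "(1 + fls_X * fps_to_fls h) * fps_to_fls (unit_inv ?u) = 1"
    by (simp add: fls_times_fps_to_fls)
  then show ?thesis by blast
qed

context quantum_curve
begin

lemma one_minus_potential: "1 - potential = 1 - qX - qY - g"
  by (simp add: potential_def algebra_simps)

lemma wavefunction_ratio_unital: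
  assumes M: "M = NE P" and deg: "deg = cls_deg P" and Y: "wavefunction_ratio P (1 - potential) Y"
  shows "unital_ser Y" and "eval_curve M (1 - qX - qY - g) Y = (\<lambda>_. 0)"
proof -
  obtain h :: "complex poly" and U where U: "U \<in> positive_part P"
    and Y_eq: "Y = (\<lambda>\<beta>. ser_const (1 + fls_X * fps_to_fls (fps_of_poly (map_poly qconst h))) \<beta> + U \<beta>)"
    and eval: "eval_curve (NE P) (1 - potential) Y = (\<lambda>_. 0)"
    using Y unfolding wavefunction_ratio_def by blast
  have U': "\<beta> \<in> M \<and> deg \<beta> \<ge> 1" if "U \<beta> \<noteq> 0" for \<beta>
    using U that by (auto simp: positive_part_def power_series_def M deg)
  have "local_ser Y"
    unfolding local_ser_def
  proof (intro allI impI)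
    fix \<beta> assume "Y \<beta> \<noteq> 0"
    then have "\<beta> = 0 \<or> U \<beta> \<noteq> 0"
      by (auto simp: Y_eq ser_const_def)
    then show "\<beta> \<in> M \<and> (\<beta> = 0 \<or> 1 \<le> deg \<beta>)"
      using U' zero_M by blast
  qed
  moreover have "U 0 = 0"
    using U'[of 0] by auto
  then have "Y 0 = 1 + fls_X * fps_to_fls (fps_of_poly (map_poly qconst h))"
    by (simp add: Y_eq ser_const_def)
  ultimately show "unital_ser Y"
    unfolding unital_ser_def using one_plus_X_times_invertible by metis
  show "eval_curve M (1 - qX - qY - g) Y = (\<lambda>_. 0)"
    using eval by (simp only: M one_minus_potential)
qed

lemma wavefunction_ratio_Laurent:
  assumes M: "M = NE P" and deg: "deg = cls_deg P"
    and F: "F \<in> X_series" "fps_nth F 0 = 1" and fixed: "wave_step F = F"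
  shows "wavefunction_ratio P (1 - potential) (Laurent F)"
  unfolding wavefunction_ratio_def
proof (intro conjI exI)
  let ?U = "\<lambda>\<beta>. if \<beta> = 0 then 0 else Laurent F \<beta>"
  show "?U \<in> positive_part P"
  proof -
    have "\<beta> \<in> M \<and> deg \<beta> \<ge> 1" if "Laurent F \<beta> \<noteq> 0" "\<beta> \<noteq> 0" for \<beta>
      using Laurent_local[OF F(1)] that unfolding local_ser_def by blast
    then show ?thesis
      unfolding positive_part_def power_series_def M[symmetric] deg[symmetric] by auto
  qed
  show "Laurent F = (\<lambda>\<beta>. ser_const (1 + fls_X * fps_to_fls (fps_of_poly (map_poly qconst [:-1:]))) \<beta> + ?U \<beta>)"
  proof
    fix \<beta>
    have "map_poly qconst [:-1:] = [:-1:]"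
      by (simp add: map_poly_pCons qconst_def single_uminus)
    then show "Laurent F \<beta> = ser_const (1 + fls_X * fps_to_fls (fps_of_poly (map_poly qconst [:-1:]))) \<beta> + ?U \<beta>"
      using Laurent_solution(2)[OF F fixed] by (simp add: ser_const_def fps_of_poly_pCons)
  qed
  show "eval_curve (NE P) (1 - potential) (Laurent F) = (\<lambda>_. 0)"
    using Laurent_solution(1)[OF F fixed] unfolding M one_minus_potential .
qed

end

theorem theorem2p24:
  fixes P :: surface
    and K :: "(real \<times> real) set"
    and r :: nat
    and m :: "int \<Rightarrow> int \<times> int"
    and \<phi> :: "(int \<Rightarrow> int) \<Rightarrow> cls"
    and N :: int
    and f p :: qtorus
  assumes "very_ample_anticanonical P"
    and "reflexive_polygon K"
    and "N = int r + 2"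
    and "boundary_enumeration K N m"
    and "degeneration_identification P K N m \<phi>"
    and "m (int r + 1) = (1, 0)"
    and "m (int r + 2) = (0, 1)"
    and "\<And>u. pt u \<in> K \<Longrightarrow> snd u \<le> 1"
    and "f = toric_potential K N m \<phi>"
    and "leading_terms_XY P f"
    and "p = 1 - f"
  shows "(\<exists>!Y. wavefunction_ratio P p Y) \<and>
    quantum_A_period p \<in> power_series (NE P) \<and>
    quantum_A_period p = wavefunction_A_period P p"
proof -
  have m: "m (N - 1) = (1, 0)" "m N = (0, 1)"
    using assms(6,7) by (simp_all add: assms(3) algebra_simps)
  interpret degeneration K N m P \<phi>
    by standard (use assms m in auto)
  interpret quantum_curve "NE P" "cls_deg P" 2 "f - qX - qY"
    using assms by (intro quantum_curve_potential)
  have p: "p = 1 - potential"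
    by (simp add: assms(11) potential_def)
  obtain F where F: "F \<in> X_series" "fps_nth F 0 = 1" "wave_step F = F"
    by (rule wave_fixed_point)
  have sol: "wavefunction_ratio P p (Laurent F)"
    unfolding p by (rule wavefunction_ratio_Laurent[OF refl refl F])
  have unique: "Y = Laurent F" if "wavefunction_ratio P p Y" for Y
  proof (rule solution_unique)
    show "unital_ser Y" "eval_curve (NE P) (1 - qX - qY - (f - qX - qY)) Y = (\<lambda>_. 0)"
      using wavefunction_ratio_unital[OF refl refl] that unfolding p by blast+
    show "unital_ser (Laurent F)" "eval_curve (NE P) (1 - qX - qY - (f - qX - qY)) (Laurent F) = (\<lambda>_. 0)"
      using wavefunction_ratio_unital[OF refl refl] sol unfolding p by blast+
    show "cls_deg P \<beta> \<ge> 1" if "(u, \<beta>) \<in> qsupport (f - qX - qY)" for u \<beta>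
      using support_deg[OF that] .
  qed
  have "(THE Y. wavefunction_ratio P p Y) = Laurent F"
    using sol unique by (rule the_equality)
  then have "quantum_A_period p = wavefunction_A_period P p"
    unfolding wavefunction_A_period_def p using periods_equal[OF F] by simp
  moreover have "quantum_A_period p \<in> power_series (NE P)"
    unfolding p by (rule quantum_A_period_M)
  ultimately show ?thesis
    using sol unique by blast
qed

end
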